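(* The following statements are equivalent: (1) $n(\omega^* )>\mathfrak c$. (2) $\mathrm{FA}_{\mathfrak c}([\omega]^\omega,\subseteq^* )$: for every collection of $\mathfrak c$ dense subsets of the pre-ordered set $([\omega]^\omega,\subseteq^* )$ there exists a filter intersecting all of them. (3) For every MAD family $\mathcal A$, $\Psi(\mathcal A)$ is $(\mathfrak c,\omega^* )$-pseudocompact. (4) For every MAD family $\mathcal A$ there exists $p\in\omega^*$ such that $\Psi(\mathcal A)$ is $p$-pseudocompact. (5) For every MAD family $\mathcal A$ there exists $p\in\omega^*$ such that $\exp(\Psi(\mathcal A))$ is $p$-pseudocompact. (6) Every MAD family is pseudocompact, i.e. $\exp(\Psi(\mathcal A))$ is a pseudocompact space for every MAD family $\mathcal A$. (7) $\mathfrak h=\mathfrak c$ and every base tree has a branch of cardinality $\mathfrak c$.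
   Context: An almost disjoint family (on $\omega$) is an infinite set $\mathcal A$ of infinite subsets of $\omega$ such that $a\cap b$ is finite for all distinct $a,b\in\mathcal A$. A MAD family is an almost disjoint family not properly contained in any other almost disjoint family. $\Psi(\mathcal A)$ is the set $\omega\cup\mathcal A$ with the topology having base $\{\{n\}:n\in\omega\}\cup\{\{a\}\cup(a\setminus F): a\in\mathcal A,\ F\in[\omega]^{<\omega}\}$. For a $T_1$ space $X$, $\exp(X)$ is the set of all nonempty closed subsets of $X$ with the Vietoris topology, generated by the subbase of all sets $U^+=\{F\in\exp(X):F\subseteq U\}$ and $U^-=\{F\in\exp(X):F\cap U\ne\emptyset\}$ with $U\subseteq X$ open. A space is pseudocompact if every continuous real-valued function on it is bounded. $\omega^*$ is the space of free ultrafilters on $\omega$ (with base $\{B^*:B\subseteq\omega\}$, $B^*=\{q\in\omega^*:B\in q\}$). For a space $X$ with no isolated points, $n(X)$ (the Baire, or Novák, number) is the least cardinality of a collection of open dense subsets of $X$ with empty intersection. For $p\in\omega^*$, a point $x\in X$ is a $p$-limit point of a sequence $(U_n:n\in\omega)$ of nonempty open subsets of $X$ if $\{n\in\omega:U_n\cap V\neq\emptyset\}\in p$ for every neighbourhood $V$ of $x$. $X$ is $p$-pseudocompact if every sequence of nonempty open subsets of $X$ has a $p$-limit point. For a cardinal $\kappa$ and $A\subseteq\omega^*$, $X$ is $(\kappa,A)$-pseudocompact if for every family $(U^\alpha:\alpha<\kappa)$ of sequences of nonempty open subsets of $X$ there exists $p\in A$ such that for every $\alpha<\kappa$ the sequence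 $U^\alpha$ has a $p$-limit point. $\subseteq^*$ is inclusion modulo a finite set. A subset $D$ of $[\omega]^\omega$ is dense if every $X\in[\omega]^\omega$ has some $Y\in D$ with $Y\subseteq^* X$; a filter in $([\omega]^\omega,\subseteq^* )$ is a nonempty, upward closed, downward directed subset. $\mathfrak c=2^{\aleph_0}$, and $\mathfrak h$ is the least size of a collection of dense and $\subseteq^*$-downward closed subsets of $[\omega]^\omega$ whose intersection is not dense. A base tree is a set $T\subseteq[\omega]^\omega$ such that $(T,\supseteq^* )$ is a tree of height $\mathfrak h$ with root $\omega$, each level of $T$ other than the root is a MAD family, and $T$ is dense, i.e. every $X\in[\omega]^\omega$ has some $t\in T$ with $t\subseteq^* X$. A branch is a maximal chain of $T$. *)

theory Defs
  imports "HOL-Analysis.Analysis"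
begin

unbundle cardinal_syntax

text \<open>Cardinals are well-orders as in the library (\<open>|A|\<close> is the cardinality of \<open>A\<close>,
  an initial ordinal), compared by \<open>\<le>o\<close>, \<open><o\<close> and \<open>=o\<close>.\<close>

text \<open>The least cardinality of a member of \<open>\<C>\<close>; meaningful for nonempty \<open>\<C>\<close>.\<close>
definition least_card :: "'a set set \<Rightarrow> 'a rel" where
  "least_card \<C> = |SOME A. A \<in> \<C> \<and> (\<forall>B\<in>\<C>. |A| \<le>o |B| )|"

lemma least_card:
  assumes "\<C> \<noteq> {}"
  shows "\<exists>A\<in>\<C>. least_card \<C> = |A| \<and> (\<forall>B\<in>\<C>. |A| \<le>o |B| )"
proof -
  have "\<exists>r\<in>card_of ` \<C>. \<forall>r'\<in>card_of ` \<C>. r \<le>o r'"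
    using assms by (intro exists_minim_Well_order) (auto simp: card_of_Well_order)
  then have "\<exists>A. A \<in> \<C> \<and> (\<forall>B\<in>\<C>. |A| \<le>o |B| )"
    by auto
  from someI_ex[OF this] show ?thesis
    unfolding least_card_def by blast
qed

definition continuum :: "nat set rel" where
  "continuum = |UNIV :: nat set set|"

definition pseudocompact_space :: "'a topology \<Rightarrow> bool" where
  "pseudocompact_space X \<longleftrightarrow>
     (\<forall>f. continuous_map X euclideanreal f \<longrightarrow> bounded (f ` topspace X))"

definition vietoris :: "'a topology \<Rightarrow> 'a set topology" where
  "vietoris X = topology_generated_by
     ({{F. closedin X F \<and> F \<noteq> {} \<and> F \<subseteq> U} | U. openin X U} \<union>
      {{F. closedin X F \<and> F \<noteq> {} \<and> F \<inter> U \<noteq> {}} | U. openin X U})"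

lemma topspace_vietoris: "topspace (vietoris X) = {F. closedin X F \<and> F \<noteq> {}}"
  unfolding vietoris_def topology_generated_by_topspace
  by (auto dest: closedin_subset)

text \<open>Intended for spaces without isolated points.\<close>
definition novak_number :: "'a topology \<Rightarrow> 'a set rel" where
  "novak_number X = least_card
     {\<D>. (\<forall>U\<in>\<D>. openin X U \<and> X closure_of U = topspace X) \<and> topspace X \<inter> \<Inter>\<D> = {}}"

text \<open>Ultrafilters on \<open>\<omega>\<close> are library filters: \<open>B \<in> q\<close> is \<open>eventually (\<lambda>n. n \<in> B) q\<close>,
  and \<open>q \<le> cofinite\<close> says that \<open>q\<close> contains all cofinite sets, i.e. is free.\<close>
definition free_ultrafilters :: "nat filter set" where
  "free_ultrafilters = {q. q \<noteq> bot \<and> q \<le> cofinite \<and>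
     (\<forall>P. eventually P q \<or> eventually (\<lambda>n. \<not> P n) q)}"

definition omega_star :: "nat filter topology" where
  "omega_star = topology_generated_by
     {{q \<in> free_ultrafilters. eventually (\<lambda>n. n \<in> B) q} | B. True}"

lemma topspace_omega_star: "topspace omega_star = free_ultrafilters"
proof -
  have "eventually (\<lambda>n. n \<in> UNIV) q" for q :: "nat filter"
    by simp
  then show ?thesis
    unfolding omega_star_def topology_generated_by_topspace by blast
qed

definition p_limit_point :: "nat filter \<Rightarrow> 'a topology \<Rightarrow> (nat \<Rightarrow> 'a set) \<Rightarrow> 'a \<Rightarrow> bool" where
  "p_limit_point p X U x \<longleftrightarrow> x \<in> topspace X \<and>
     (\<forall>V. openin X V \<and> x \<in> V \<longrightarrow> eventually (\<lambda>n. U n \<inter> V \<noteq> {}) p)"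

definition nonempty_open_seq :: "'a topology \<Rightarrow> (nat \<Rightarrow> 'a set) \<Rightarrow> bool" where
  "nonempty_open_seq X U \<longleftrightarrow> (\<forall>n. openin X (U n) \<and> U n \<noteq> {})"

definition p_pseudocompact :: "nat filter \<Rightarrow> 'a topology \<Rightarrow> bool" where
  "p_pseudocompact p X \<longleftrightarrow> (\<forall>U. nonempty_open_seq X U \<longrightarrow> (\<exists>x. p_limit_point p X U x))"

text \<open>A family indexed by the cardinal \<open>\<kappa>\<close> is indexed by the field of the well-order \<open>\<kappa>\<close>.\<close>
definition ka_pseudocompact :: "'i rel \<Rightarrow> nat filter set \<Rightarrow> 'a topology \<Rightarrow> bool" where
  "ka_pseudocompact \<kappa> A X \<longleftrightarrow>
     (\<forall>U. (\<forall>\<alpha>\<in>Field \<kappa>. nonempty_open_seq X (U \<alpha>)) \<longrightarrow>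
       (\<exists>p\<in>A. \<forall>\<alpha>\<in>Field \<kappa>. \<exists>x. p_limit_point p X (U \<alpha>) x))"

definition almost_disjoint_family :: "nat set set \<Rightarrow> bool" where
  "almost_disjoint_family \<A> \<longleftrightarrow> infinite \<A> \<and> (\<forall>a\<in>\<A>. infinite a) \<and>
     (\<forall>a\<in>\<A>. \<forall>b\<in>\<A>. a \<noteq> b \<longrightarrow> finite (a \<inter> b))"

definition mad_family :: "nat set set \<Rightarrow> bool" where
  "mad_family \<A> \<longleftrightarrow> almost_disjoint_family \<A> \<and>
     \<not> (\<exists>\<B>. almost_disjoint_family \<B> \<and> \<A> \<subset> \<B>)"

text \<open>The point set is the disjoint union of \<open>\<omega>\<close> (left summand) and \<open>\<A>\<close> (right summand).\<close>
definition Psi :: "nat set set \<Rightarrow> (nat + nat set) topology" where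
  "Psi \<A> = topology_generated_by
     ({{Inl n} | n. True} \<union> {insert (Inr a) (Inl ` (a - F)) | a F. a \<in> \<A> \<and> finite F})"

lemma topspace_Psi: "topspace (Psi \<A>) = range Inl \<union> Inr ` \<A>"
  unfolding Psi_def topology_generated_by_topspace by blast

definition infsets :: "nat set set" where
  "infsets = {a. infinite a}"

definition almost_subset :: "nat set \<Rightarrow> nat set \<Rightarrow> bool" (infix "\<subseteq>\<^sup>*" 50) where
  "a \<subseteq>\<^sup>* b \<longleftrightarrow> finite (a - b)"

definition ae_dense :: "nat set set \<Rightarrow> bool" where
  "ae_dense D \<longleftrightarrow> D \<subseteq> infsets \<and> (\<forall>X\<in>infsets. \<exists>Y\<in>D. Y \<subseteq>\<^sup>* X)"

definition ae_down_closed :: "nat set set \<Rightarrow> bool" where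
  "ae_down_closed D \<longleftrightarrow> (\<forall>X\<in>D. \<forall>Y\<in>infsets. Y \<subseteq>\<^sup>* X \<longrightarrow> Y \<in> D)"

definition ae_filter :: "nat set set \<Rightarrow> bool" where
  "ae_filter G \<longleftrightarrow> G \<subseteq> infsets \<and> G \<noteq> {} \<and>
     (\<forall>X\<in>G. \<forall>Y\<in>infsets. X \<subseteq>\<^sup>* Y \<longrightarrow> Y \<in> G) \<and>
     (\<forall>X\<in>G. \<forall>Y\<in>G. \<exists>Z\<in>G. Z \<subseteq>\<^sup>* X \<and> Z \<subseteq>\<^sup>* Y)"

definition forcing_axiom :: "'i rel \<Rightarrow> bool" where
  "forcing_axiom \<kappa> \<longleftrightarrow>
     (\<forall>\<D>. |\<D>| =o \<kappa> \<and> (\<forall>D\<in>\<D>. ae_dense D) \<longrightarrow>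
       (\<exists>G. ae_filter G \<and> (\<forall>D\<in>\<D>. G \<inter> D \<noteq> {})))"

definition cardinal_h :: "nat set set rel" where
  "cardinal_h = least_card
     {\<H>. (\<forall>D\<in>\<H>. ae_dense D \<and> ae_down_closed D) \<and> \<not> ae_dense (infsets \<inter> \<Inter>\<H>)}"

text \<open>Trees are given as (reflexive) partial orders \<open>r\<close>. Ordinals are well-orders up to \<open>=o\<close>,
  which only relates well-orders; the ordinal 0 is the empty relation.\<close>
definition tree_order :: "'a set \<Rightarrow> 'a rel \<Rightarrow> bool" where
  "tree_order T r \<longleftrightarrow> partial_order_on T r \<and>
     (\<forall>t\<in>T. well_order_on (underS r t) (Restr r (underS r t)))"

text \<open>The members of level \<open>\<alpha>\<close> are those whose strict predecessors have order type \<open>\<alpha>\<close>.\<close>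
definition tree_level :: "'a rel \<Rightarrow> 'i rel \<Rightarrow> 'a set" where
  "tree_level r \<alpha> = {t \<in> Field r. Restr r (underS r t) =o \<alpha>}"

text \<open>The height is the least ordinal whose level is empty. Every ordinal below \<open>\<alpha>\<close> is
  represented in the type of \<open>\<alpha>\<close>, so it is enough to let \<open>\<beta>\<close> range over that type.\<close>
definition tree_height :: "'a rel \<Rightarrow> 'i rel \<Rightarrow> bool" where
  "tree_height r \<alpha> \<longleftrightarrow> Well_order \<alpha> \<and> tree_level r \<alpha> = {} \<and>
     (\<forall>\<beta> :: 'i rel. \<beta> <o \<alpha> \<longrightarrow> tree_level r \<beta> \<noteq> {})"

definition ae_order :: "nat set set \<Rightarrow> nat set rel" where
  "ae_order T = {(s, t). s \<in> T \<and> t \<in> T \<and> t \<subseteq>\<^sup>* s}"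

definition base_tree :: "nat set set \<Rightarrow> bool" where
  "base_tree T \<longleftrightarrow> T \<subseteq> infsets \<and>
     tree_order T (ae_order T) \<and>
     tree_height (ae_order T) cardinal_h \<and>
     tree_level (ae_order T) ({} :: nat set set rel) = {UNIV} \<and>
     (\<forall>\<alpha> :: nat set set rel. \<alpha> <o cardinal_h \<and> \<alpha> \<noteq> {} \<longrightarrow>
        mad_family (tree_level (ae_order T) \<alpha>)) \<and>
     ae_dense T"

definition branch :: "nat set set \<Rightarrow> nat set set \<Rightarrow> bool" where
  "branch T b \<longleftrightarrow> pred_on.maxchain T (\<lambda>s t. t \<subseteq>\<^sup>* s) b"

end

theory Submission
  imports Defs
begin

text \<open>A filter in \<open>[\<omega>]\<^sup>\<omega>\<close> meeting \<open>\<cc>\<close> many dense sets extends to a free ultrafilter, which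
  gives (1) \<open>\<longleftrightarrow>\<close> (2), and, as there are only \<open>\<cc>\<close> many sequences of isolated points of
  \<open>\<Psi>(\<A>)\<close>, also (2) \<open>\<longrightarrow>\<close> (3) \<open>\<longrightarrow>\<close> (4). For (6) \<open>\<longrightarrow>\<close> (2), index the dense sets \<open>D\<^sub>x\<close> by
  the branches \<open>x\<close> of the binary tree \<open>2\<^sup><\<^sup>\<omega>\<close> and copy \<open>D\<^sub>x\<close> to the branch \<open>x\<close>. A MAD family
  consisting of such copies and of sets almost disjoint from all branches has the property that an
  accumulation point of the levels of the tree in \<open>exp(\<Psi>(\<A>))\<close> yields a filter meeting every \<open>D\<^sub>x\<close>.

  For (2) \<open>\<longrightarrow>\<close> (7), a refining system of maximal antichains of length \<open>\<hh>\<close> has the property that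
  every infinite set meets \<open>\<cc>\<close> many members of one antichain. The members can thus be labelled by
  reals so that, for every label, the sets lying below a member with that label are dense. A filter
  meeting these \<open>\<cc>\<close> many dense sets takes one member from each antichain, whence \<open>\<cc> \<le> \<hh>\<close>.
  Conversely, if \<open>\<hh> = \<cc>\<close>, then given \<open>\<cc>\<close> many dense sets one builds a base tree whose branches of
  size \<open>\<cc>\<close> generate filters meeting all of them.\<close>

subsection \<open>Almost inclusion, MAD families and ultrafilters\<close>

text \<open>The obstacle in (6) \<longrightarrow> (2) is that pseudocompactness of the hyperspace
  controls one sequence, while \<cc> many dense sets have to be met. The levels of the binary tree
  are finite, hence isolated points of the hyperspace, and every branch passes through each level
  exactly once. One set of level numbers is therefore read off along all branches simultaneously,
  and almost disjointness of the branches keeps the copies of different \<open>D\<^sub>x\<close>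
  apart. Only an accumulation point is available, not a p-limit, but the traces of its
  neighbourhoods still generate a filter. In (4) \<longrightarrow> (5) the ultrafilter stays the
  same: isolated points are dense in \<Psi>(\<A>), so open sets of the hyperspace may be replaced by
  finite sets of isolated points. In (2) \<longrightarrow> (7) the count works because a filter
  contains at most one member of each antichain: it sees at most \<hh> labels, yet must see all
  \<cc> of them. The \<cc> many members met on one antichain come from a binary splitting of
  countable height, whose indices are bounded below \<hh> by uncountable cofinality.\<close>

lemma almost_subset_trans: "a \<subseteq>\<^sup>* b \<Longrightarrow> b \<subseteq>\<^sup>* c \<Longrightarrow> a \<subseteq>\<^sup>* c"
  unfolding almost_subset_def by (rule finite_subset[of _ "(a - b) \<union> (b - c)"]) auto

lemma subset_almost_subset: "a \<subseteq> b \<Longrightarrow> a \<subseteq>\<^sup>* b"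
  unfolding almost_subset_def by (metis Diff_eq_empty_iff finite.emptyI)

lemma almost_subset_refl [simp]: "a \<subseteq>\<^sup>* a"
  by (simp add: almost_subset_def)

lemma infinite_Int_almost_subset:
  assumes "infinite (a \<inter> b)" "b \<subseteq>\<^sup>* c"
  shows "infinite (a \<inter> c)"
proof
  assume "finite (a \<inter> c)"
  then have "finite ((a \<inter> c) \<union> (b - c))"
    using assms(2) by (simp add: almost_subset_def)
  then have "finite (a \<inter> b)"
    by (rule rev_finite_subset) auto
  with assms(1) show False by simp
qed

lemma almost_subset_imp_infinite_Int:
  assumes "infinite a" "a \<subseteq>\<^sup>* b"
  shows "infinite (a \<inter> b)"
  using infinite_Int_almost_subset[of a a b] assms by simp

text \<open>Each \<open>X n\<close> differs from the intersection of the first sets by finitely many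
  points, so these intersections are infinite. A strictly increasing diagonal sequence through them
  leaves \<open>X m\<close> only at its first \<open>m\<close> terms.\<close>

lemma pseudo_intersection:
  fixes X :: "nat \<Rightarrow> nat set"
  assumes inf: "\<And>n. infinite (X n)" and dec: "\<And>n. X (Suc n) \<subseteq>\<^sup>* X n"
  shows "\<exists>Y. infinite Y \<and> (\<forall>n. Y \<subseteq>\<^sup>* X n)"
proof -
  have dec': "X n \<subseteq>\<^sup>* X m" if "m \<le> n" for m n
    using that by (induction n rule: dec_induct) (auto intro: almost_subset_trans dec)
  have infI: "infinite (\<Inter>m\<le>n. X m)" for n
  proof
    assume "finite (\<Inter>m\<le>n. X m)"
    moreover have "finite (\<Union>m\<in>{..n}. X n - X m)"
      using dec' unfolding almost_subset_def by (intro finite_UN_I) auto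
    ultimately have "finite ((\<Inter>m\<le>n. X m) \<union> (\<Union>m\<in>{..n}. X n - X m))"
      by (rule finite_UnI)
    then have "finite (X n)"
      by (rule rev_finite_subset) auto
    with inf show False by simp
  qed
  have "\<exists>y. \<forall>n. y n \<in> (\<Inter>m\<le>n. X m) \<and> y n < y (Suc n)"
  proof (rule dependent_nat_choice)
    show "\<exists>x. x \<in> (\<Inter>m\<le>0. X m)"
      using infI[of 0] by (metis ex_in_conv finite.emptyI)
    fix x n assume "x \<in> (\<Inter>m\<le>n. X m)"
    show "\<exists>y. y \<in> (\<Inter>m\<le>Suc n. X m) \<and> x < y"
      using infI[of "Suc n"] by (metis infinite_nat_iff_unbounded)
  qed
  then obtain y where y: "\<And>n. y n \<in> (\<Inter>m\<le>n. X m)" "\<And>n. y n < y (Suc n)"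
    by auto
  have "strict_mono y"
    using y(2) by (simp add: strict_mono_Suc_iff)
  then have "infinite (range y)"
    by (simp add: range_inj_infinite strict_mono_imp_inj_on)
  moreover have "range y \<subseteq>\<^sup>* X m" for m
  proof -
    have "range y - X m \<subseteq> y ` {..<m}"
      using y(1) by (fastforce simp: not_less)
    then show ?thesis
      unfolding almost_subset_def by (rule finite_subset) simp
  qed
  ultimately show ?thesis by blast
qed

lemma ae_denseE:
  assumes "ae_dense D" "infinite X"
  obtains Y where "Y \<in> D" "infinite Y" "Y \<subseteq>\<^sup>* X"
  using assms unfolding ae_dense_def infsets_def by blast

lemma ae_down_closedD:
  "ae_down_closed D \<Longrightarrow> X \<in> D \<Longrightarrow> infinite Y \<Longrightarrow> Y \<subseteq>\<^sup>* X \<Longrightarrow> Y \<in> D"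
  unfolding ae_down_closed_def infsets_def by blast

text \<open>Descending below \<open>X\<close> through the sets \<open>D n\<close> one after another,
  a pseudo-intersection of the descent lies in all of them by downward closure.\<close>

lemma ae_dense_countable_Inter:
  fixes D :: "nat \<Rightarrow> nat set set"
  assumes "\<And>n. ae_dense (D n)" "\<And>n. ae_down_closed (D n)"
  shows "ae_dense (infsets \<inter> \<Inter>(range D))"
  unfolding ae_dense_def
proof (intro conjI ballI)
  fix X :: "nat set" assume "X \<in> infsets"
  then have X: "infinite X" by (simp add: infsets_def)
  \<comment> \<open>The clause for \<open>n = 0\<close> fixes the start of the descent at
    \<open>X\<close>, so that the pseudo-intersection ends up below \<open>X\<close>.\<close>
  have "\<exists>Z. \<forall>n. (infinite (Z n) \<and> (n = 0 \<longrightarrow> Z n = X)) \<and> (Z (Suc n) \<subseteq>\<^sup>* Z n \<and> Z (Suc n) \<in> D n)"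
  proof (rule dependent_nat_choice)
    show "\<exists>Z. infinite Z \<and> ((0::nat) = 0 \<longrightarrow> Z = X)"
      using X by auto
    fix Z and n :: nat assume "infinite Z \<and> (n = 0 \<longrightarrow> Z = X)"
    with ae_denseE[OF assms(1)[of n]] obtain Y where "Y \<in> D n" "infinite Y" "Y \<subseteq>\<^sup>* Z"
      by blast
    then show "\<exists>Y. (infinite Y \<and> (Suc n = 0 \<longrightarrow> Y = X)) \<and> (Y \<subseteq>\<^sup>* Z \<and> Y \<in> D n)"
      by blast
  qed
  then obtain Z where Z: "\<And>n. infinite (Z n)" "Z 0 = X" "\<And>n. Z (Suc n) \<subseteq>\<^sup>* Z n" "\<And>n. Z (Suc n) \<in> D n"
    by blast
  then obtain Y where Y: "infinite Y" "\<And>n. Y \<subseteq>\<^sup>* Z n"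
    using pseudo_intersection[of Z] by blast
  have "Y \<in> D n" for n
    using ae_down_closedD[OF assms(2) Z(4) Y(1)] Y(2) by blast
  moreover have "Y \<subseteq>\<^sup>* X"
    using Y(2)[of 0] Z(2) by simp
  ultimately show "\<exists>Y\<in>infsets \<inter> \<Inter>(range D). Y \<subseteq>\<^sup>* X"
    using Y(1) by (auto simp: infsets_def)
qed auto

section \<open>MAD families inside dense sets\<close>

text \<open>A proper extension contains a new set almost disjoint from the whole family, and adding
  one such set is already a proper extension.\<close>

lemma mad_family_iff:
  "mad_family \<A> \<longleftrightarrow>
     almost_disjoint_family \<A> \<and> (\<forall>X. infinite X \<longrightarrow> (\<exists>a\<in>\<A>. infinite (a \<inter> X)))"
proof -
  have "(\<exists>\<B>. almost_disjoint_family \<B> \<and> \<A> \<subset> \<B>) \<longleftrightarrow>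
        (\<exists>X. infinite X \<and> (\<forall>a\<in>\<A>. finite (a \<inter> X)))" if ad: "almost_disjoint_family \<A>"
  proof
    assume "\<exists>\<B>. almost_disjoint_family \<B> \<and> \<A> \<subset> \<B>"
    then obtain \<B> X where "almost_disjoint_family \<B>" "\<A> \<subseteq> \<B>" "X \<in> \<B>" "X \<notin> \<A>"
      by blast
    then show "\<exists>X. infinite X \<and> (\<forall>a\<in>\<A>. finite (a \<inter> X))"
      unfolding almost_disjoint_family_def by (metis subsetD)
  next
    assume "\<exists>X. infinite X \<and> (\<forall>a\<in>\<A>. finite (a \<inter> X))"
    then obtain X where X: "infinite X" "\<And>a. a \<in> \<A> \<Longrightarrow> finite (a \<inter> X)"
      by blast
    then have "X \<notin> \<A>" by (metis Int_absorb)
    moreover have "almost_disjoint_family (insert X \<A>)"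
      using X ad unfolding almost_disjoint_family_def by (auto simp: Int_commute)
    ultimately show "\<exists>\<B>. almost_disjoint_family \<B> \<and> \<A> \<subset> \<B>"
      by blast
  qed
  then show ?thesis
    unfolding mad_family_def by blast
qed

lemma mad_familyD:
  assumes "mad_family \<A>"
  shows "infinite \<A>" and "\<And>a. a \<in> \<A> \<Longrightarrow> infinite a"
    and "\<And>a b. a \<in> \<A> \<Longrightarrow> b \<in> \<A> \<Longrightarrow> infinite (a \<inter> b) \<Longrightarrow> a = b"
    and "\<And>X. infinite X \<Longrightarrow> \<exists>a\<in>\<A>. infinite (a \<inter> X)"
  using assms unfolding mad_family_iff almost_disjoint_family_def by blast+

text \<open>Zorn is applied to almost disjoint subfamilies of \<open>E\<close> that contain a
  countable family chosen below the pieces of a partition of \<open>X\<close>. This start makes the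
  result infinite and puts a member below \<open>X\<close>; density of \<open>E\<close> turns
  maximality inside \<open>E\<close> into maximality among all almost disjoint families.\<close>

lemma ex_mad_family_dense:
  assumes dense: "ae_dense E" and X: "infinite X"
  shows "\<exists>\<A>. mad_family \<A> \<and> \<A> \<subseteq> E \<and> (\<exists>Y\<in>\<A>. Y \<subseteq>\<^sup>* X)"
proof -
  obtain C :: "nat \<Rightarrow> nat set" where
    C: "pairwise (\<lambda>i j. disjnt (C i) (C j)) UNIV" "(\<Union>i. C i) \<subseteq> X" "\<And>i. infinite (C i)"
    using infinite_infinite_partition[OF X] by blast
  have "\<exists>Y. Y \<in> E \<and> infinite Y \<and> Y \<subseteq>\<^sup>* C i" for i
    using ae_denseE[OF dense C(3)[of i]] by blast
  then obtain Y where Y: "\<And>i. Y i \<in> E" "\<And>i. infinite (Y i)" "\<And>i. Y i \<subseteq>\<^sup>* C i"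
    by metis
  have fin: "finite (Y i \<inter> Y j)" if "i \<noteq> j" for i j
  proof (rule ccontr)
    assume "infinite (Y i \<inter> Y j)"
    then have "infinite (Y i \<inter> C j)"
      using infinite_Int_almost_subset Y(3) by blast
    then have "infinite (C j \<inter> C i)"
      using infinite_Int_almost_subset Y(3) by (metis Int_commute)
    moreover have "C j \<inter> C i = {}"
      using C(1) that by (auto simp: pairwise_def disjnt_def)
    ultimately show False by simp
  qed
  then have "inj Y"
    using Y(2) by (metis Int_absorb injI)
  define \<S> where "\<S> = {\<A>. range Y \<subseteq> \<A> \<and> \<A> \<subseteq> E \<and> (\<forall>a\<in>\<A>. \<forall>b\<in>\<A>. a \<noteq> b \<longrightarrow> finite (a \<inter> b))}"
  have "\<exists>\<A>\<in>\<S>. \<forall>\<B>\<in>\<S>. \<A> \<subseteq> \<B> \<longrightarrow> \<B> = \<A>"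
  proof (rule subset_Zorn_nonempty)
    have "finite (a \<inter> b)" if "a \<in> range Y" "b \<in> range Y" "a \<noteq> b" for a b
      using that fin by (metis rangeE)
    then have "range Y \<in> \<S>"
      using Y(1) by (auto simp only: \<S>_def mem_Collect_eq)
    then show "\<S> \<noteq> {}" by blast
  next
    fix \<C> assume C: "\<C> \<noteq> {}" "subset.chain \<S> \<C>"
    have fin': "finite (a \<inter> b)" if mem: "\<A> \<in> \<C>" "\<B> \<in> \<C>" "a \<in> \<A>" "b \<in> \<B>" "a \<noteq> b" for a b \<A> \<B>
    proof -
      have "\<A> \<subseteq> \<B> \<or> \<B> \<subseteq> \<A>" "\<A> \<in> \<S>" "\<B> \<in> \<S>"
        using C(2) mem unfolding subset.chain_def by auto
      then consider "\<A> \<in> \<S>" "a \<in> \<A>" "b \<in> \<A>" | "\<B> \<in> \<S>" "a \<in> \<B>" "b \<in> \<B>"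
        using mem by blast
      then show ?thesis
        using \<open>a \<noteq> b\<close> by cases (simp_all add: \<S>_def)
    qed
    have "\<forall>a\<in>\<Union>\<C>. \<forall>b\<in>\<Union>\<C>. a \<noteq> b \<longrightarrow> finite (a \<inter> b)"
    proof (intro ballI impI)
      fix a b assume "a \<in> \<Union>\<C>" "b \<in> \<Union>\<C>" and neq: "a \<noteq> b"
      then obtain \<A> \<B> where "\<A> \<in> \<C>" "a \<in> \<A>" "\<B> \<in> \<C>" "b \<in> \<B>"
        by auto
      then show "finite (a \<inter> b)"
        using fin' neq by simp
    qed
    moreover have "\<C> \<subseteq> \<S>"
      using C(2) by (simp add: subset.chain_def)
    then have "range Y \<subseteq> \<Union>\<C>" "\<Union>\<C> \<subseteq> E"
      using C(1) unfolding \<S>_def by fast+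
    ultimately show "\<Union>\<C> \<in> \<S>"
      unfolding \<S>_def by (intro CollectI conjI)
  qed
  then obtain \<A> where \<A>: "\<A> \<in> \<S>" and max: "\<And>\<B>. \<B> \<in> \<S> \<Longrightarrow> \<A> \<subseteq> \<B> \<Longrightarrow> \<B> = \<A>"
    by blast
  have sub: "range Y \<subseteq> \<A>" "\<A> \<subseteq> E"
    using \<A> by (auto simp: \<S>_def)
  have "infinite \<A>"
    using sub(1) \<open>inj Y\<close> by (meson finite_subset range_inj_infinite)
  moreover have "\<forall>a\<in>\<A>. infinite a"
    using sub(2) dense by (auto simp: ae_dense_def infsets_def)
  moreover have "\<forall>a\<in>\<A>. \<forall>b\<in>\<A>. a \<noteq> b \<longrightarrow> finite (a \<inter> b)"
    using \<A> by (auto simp: \<S>_def)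
  moreover have "\<exists>a\<in>\<A>. infinite (a \<inter> Z)" if Z: "infinite Z" for Z
  proof (rule ccontr)
    assume *: "\<not> (\<exists>a\<in>\<A>. infinite (a \<inter> Z))"
    obtain W where W: "W \<in> E" "infinite W" "W \<subseteq>\<^sup>* Z"
      using ae_denseE[OF dense Z] by blast
    have fW: "finite (a \<inter> W)" if "a \<in> \<A>" for a
      using * that W(3) infinite_Int_almost_subset by blast
    have "insert W \<A> \<in> \<S>"
      using \<A> W fW by (auto simp: \<S>_def Int_commute)
    then have "W \<in> \<A>"
      using max by blast
    then show False
      using fW[of W] W(2) by simp
  qed
  ultimately have "mad_family \<A>"
    unfolding mad_family_iff almost_disjoint_family_def by blast
  moreover have "Y 0 \<subseteq>\<^sup>* X"
    using Y(3)[of 0] C(2) by (meson UN_subset_iff UNIV_I almost_subset_trans subset_almost_subset)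
  ultimately show ?thesis
    using sub by blast
qed

section \<open>Filters and free ultrafilters\<close>

text \<open>Zorn on the proper filters below \<open>F\<close>, ordered downwards: the infimum of a
  chain is proper because an eventual \<open>False\<close> would already occur in one
  member.\<close>

lemma ex_ultrafilter_le:
  fixes F :: "'a filter"
  assumes "F \<noteq> bot"
  shows "\<exists>q\<le>F. q \<noteq> bot \<and> (\<forall>P. eventually P q \<or> eventually (\<lambda>x. \<not> P x) q)"
proof -
  define S where "S = {q. q \<noteq> bot \<and> q \<le> F}"
  have "\<exists>q\<in>S. \<forall>q'\<in>S. q' \<le> q \<longrightarrow> q' = q"
  proof (rule predicate_Zorn[where P = "\<lambda>a b. b \<le> a", simplified])
    show "partial_order_on S (relation_of (\<lambda>a b. b \<le> a) S)"
      by (rule partial_order_on_relation_ofI) auto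
    fix C assume C: "C \<in> Chains (relation_of (\<lambda>a b. b \<le> a) S)"
    have sub: "C \<subseteq> S" and ch: "\<And>a b. a \<in> C \<Longrightarrow> b \<in> C \<Longrightarrow> b \<le> a \<or> a \<le> b"
      using C by (auto simp: Chains_def relation_of_def)
    show "\<exists>u\<in>S. \<forall>a\<in>C. u \<le> a"
    proof (cases "C = {}")
      case True
      then show ?thesis using assms by (auto simp: S_def)
    next
      case False
      have "Inf C \<noteq> bot"
      proof
        assume "Inf C = bot"
        then have "eventually (\<lambda>_. False) (INF q\<in>C. q)"
          by simp
        then have "\<exists>q\<in>C. eventually (\<lambda>_. False) q"
        proof (subst (asm) eventually_INF_base)
          fix a b assume "a \<in> C" "b \<in> C"
          then show "\<exists>x\<in>C. x \<le> inf a b"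
            using ch[of a b] by (auto intro: bexI[of _ a] bexI[of _ b])
        qed (use False in auto)
        then show False
          using sub by (auto simp: S_def trivial_limit_def)
      qed
      moreover have "Inf C \<le> F"
        using False sub by (auto simp: S_def intro: Inf_lower2)
      ultimately show ?thesis
        by (auto simp: S_def intro!: bexI[of _ "Inf C"] Inf_lower)
    qed
  qed
  then obtain q where q: "q \<noteq> bot" "q \<le> F" and min: "\<And>q'. q' \<noteq> bot \<Longrightarrow> q' \<le> q \<Longrightarrow> q' = q"
    unfolding S_def by (blast intro: order_trans)
  have "eventually P q \<or> eventually (\<lambda>x. \<not> P x) q" for P
  \<comment> \<open>Minimality of \<open>q\<close> leaves two cases for its restriction to
    \<open>P\<close>: it is trivial, or it is \<open>q\<close> itself.\<close>
  proof (cases "inf q (principal {x. P x}) = bot")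
    case True
    then show ?thesis
      by (simp add: trivial_limit_def eventually_inf_principal)
  next
    case False
    then have "inf q (principal {x. P x}) = q"
      by (rule min) simp
    then have "q \<le> principal {x. P x}"
      by (metis inf_le2)
    then show ?thesis
      by (simp add: le_principal)
  qed
  with q show ?thesis by auto
qed

text \<open>Directedness of \<open>G\<close> holds only modulo finite sets. Combining each member
  with the cofinite filter turns \<open>G\<close> into a filter base and makes every ultrafilter
  above it free.\<close>

lemma ae_filter_extends:
  assumes G: "ae_filter G"
  shows "\<exists>q\<in>free_ultrafilters. \<forall>B\<in>G. eventually (\<lambda>n. n \<in> B) q"
proof -
  define F where "F = (INF B\<in>G. inf cofinite (principal B))"
  have ev: "eventually P F \<longleftrightarrow> (\<exists>B\<in>G. finite {n \<in> B. \<not> P n})" for P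
  proof -
    have "eventually P F \<longleftrightarrow> (\<exists>B\<in>G. eventually P (inf cofinite (principal B)))"
      unfolding F_def
    proof (rule eventually_INF_base)
      show "G \<noteq> {}"
        using G by (simp add: ae_filter_def)
      fix A B assume "A \<in> G" "B \<in> G"
      then obtain Z where Z: "Z \<in> G" "Z \<subseteq>\<^sup>* A" "Z \<subseteq>\<^sup>* B"
        using G unfolding ae_filter_def by blast
      have "inf cofinite (principal Z) \<le> inf cofinite (principal C)" if "Z \<subseteq>\<^sup>* C" for C
        using that by (auto simp: le_principal eventually_inf_principal eventually_cofinite
            almost_subset_def set_diff_eq)
      then show "\<exists>Z\<in>G. inf cofinite (principal Z) \<le> inf (inf cofinite (principal A)) (inf cofinite (principal B))"
        using Z by (meson le_inf_iff)
    qed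
    then show ?thesis
      by (simp add: eventually_inf_principal eventually_cofinite)
  qed
  have "F \<noteq> bot"
    using G by (auto simp: trivial_limit_def ev ae_filter_def infsets_def)
  then obtain q where q: "q \<le> F" "q \<noteq> bot" "\<forall>P. eventually P q \<or> eventually (\<lambda>x. \<not> P x) q"
    using ex_ultrafilter_le by blast
  have "F \<le> cofinite"
    using G by (auto simp: le_filter_def ev eventually_cofinite ae_filter_def)
  then have "q \<in> free_ultrafilters"
    using q by (auto simp: free_ultrafilters_def)
  moreover have "eventually (\<lambda>n. n \<in> B) q" if "B \<in> G" for B
    using that q(1) ev[of "\<lambda>n. n \<in> B"] by (auto intro: filter_leD bexI[of _ B])
  ultimately show ?thesis by blast
qed

text \<open>Applied to a single set and to a branch of a tree, which serve as bases of
  filters.\<close>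

lemma ae_filter_above:
  assumes "b \<subseteq> infsets" "b \<noteq> {}" "\<And>s t. s \<in> b \<Longrightarrow> t \<in> b \<Longrightarrow> \<exists>u\<in>b. u \<subseteq>\<^sup>* s \<and> u \<subseteq>\<^sup>* t"
  shows "ae_filter {Y \<in> infsets. \<exists>t\<in>b. t \<subseteq>\<^sup>* Y}"
  unfolding ae_filter_def
proof (intro conjI ballI impI)
  show "{Y \<in> infsets. \<exists>t\<in>b. t \<subseteq>\<^sup>* Y} \<noteq> {}"
    using assms(1,2) by (blast intro: almost_subset_refl)
next
  fix X Y assume "X \<in> {Y \<in> infsets. \<exists>t\<in>b. t \<subseteq>\<^sup>* Y}" "Y \<in> infsets" "X \<subseteq>\<^sup>* Y"
  then show "Y \<in> {Y \<in> infsets. \<exists>t\<in>b. t \<subseteq>\<^sup>* Y}"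
    by (blast intro: almost_subset_trans)
next
  fix X Y assume "X \<in> {Y \<in> infsets. \<exists>t\<in>b. t \<subseteq>\<^sup>* Y}" "Y \<in> {Y \<in> infsets. \<exists>t\<in>b. t \<subseteq>\<^sup>* Y}"
  then obtain s t where "s \<in> b" "t \<in> b" "s \<subseteq>\<^sup>* X" "t \<subseteq>\<^sup>* Y"
    by blast
  moreover then obtain u where "u \<in> b" "u \<subseteq>\<^sup>* s" "u \<subseteq>\<^sup>* t"
    using assms(3) by blast
  ultimately have "u \<subseteq>\<^sup>* X" "u \<subseteq>\<^sup>* Y"
    using almost_subset_trans by metis+
  moreover have "u \<in> {Y \<in> infsets. \<exists>t\<in>b. t \<subseteq>\<^sup>* Y}"
    using \<open>u \<in> b\<close> assms(1) by (auto intro: bexI[of _ u])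
  ultimately show "\<exists>Z\<in>{Y \<in> infsets. \<exists>t\<in>b. t \<subseteq>\<^sup>* Y}. Z \<subseteq>\<^sup>* X \<and> Z \<subseteq>\<^sup>* Y"
    by blast
qed auto

lemma ex_free_ultrafilter:
  assumes "infinite B"
  shows "\<exists>q\<in>free_ultrafilters. eventually (\<lambda>n. n \<in> B) q"
  using ae_filter_extends[OF ae_filter_above[of "{B}"]] assms by (auto simp: infsets_def)

lemma free_ultrafilter_infinite:
  assumes "q \<in> free_ultrafilters" "eventually (\<lambda>n. n \<in> B) q"
  shows "infinite B"
proof
  assume "finite B"
  then have "eventually (\<lambda>n. n \<notin> B) q"
    using assms(1) by (auto simp: free_ultrafilters_def eventually_cofinite intro!: filter_leD[of q cofinite])
  with assms(2) have "eventually (\<lambda>n. False) q"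
    by eventually_elim simp
  with assms(1) show False
    by (simp add: free_ultrafilters_def)
qed

lemma free_ultrafilter_almost_subset:
  assumes "q \<in> free_ultrafilters" "eventually (\<lambda>n. n \<in> A) q" "A \<subseteq>\<^sup>* B"
  shows "eventually (\<lambda>n. n \<in> B) q"
proof -
  have "eventually (\<lambda>n. n \<notin> A - B) q"
    using assms(1,3)
    by (auto simp: free_ultrafilters_def eventually_cofinite almost_subset_def set_diff_eq
        intro!: filter_leD[of q cofinite])
  with assms(2) show ?thesis
    by eventually_elim simp
qed

lemma free_ultrafilter_not:
  "q \<in> free_ultrafilters \<Longrightarrow> eventually (\<lambda>n. \<not> P n) q \<longleftrightarrow> \<not> eventually P q"
proof
  assume q: "q \<in> free_ultrafilters" and "eventually (\<lambda>n. \<not> P n) q"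
  show "\<not> eventually P q"
  proof
    assume "eventually P q"
    with \<open>eventually (\<lambda>n. \<not> P n) q\<close> have "eventually (\<lambda>n. False) q"
      by eventually_elim simp
    with q show False by (simp add: free_ultrafilters_def)
  qed
qed (auto simp: free_ultrafilters_def)

section \<open>The continuum, and the forcing axiom for at most \<cc> dense sets\<close>

lemma infinite_UNIV_nat_set: "infinite (UNIV :: nat set set)"
  by (metis Pow_UNIV finite_Pow_iff infinite_UNIV_nat)

lemma Card_order_continuum: "Card_order continuum"
  by (simp add: continuum_def card_of_Card_order)

lemma card_of_nat_sets_ordLeq_continuum: "|A :: nat set set| \<le>o continuum"
  unfolding continuum_def by (rule card_of_mono1) simp

text \<open>\<open>S\<close> is coded on the even numbers, and all odd numbers are added to make the
  code infinite.\<close>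

lemma continuum_ordLeq_infsets: "continuum \<le>o |infsets|"
  unfolding continuum_def
proof (rule card_of_ordLeqI)
  show "inj_on (\<lambda>S. (\<lambda>n. 2 * n) ` S \<union> range (\<lambda>n. Suc (2 * n))) (UNIV :: nat set set)"
  proof (rule inj_onI)
    fix S T :: "nat set"
    assume "(\<lambda>n. 2 * n) ` S \<union> range (\<lambda>n. Suc (2 * n)) = (\<lambda>n. 2 * n) ` T \<union> range (\<lambda>n. Suc (2 * n))"
    then have "2 * n \<in> (\<lambda>n. 2 * n) ` S \<union> range (\<lambda>n. Suc (2 * n)) \<longleftrightarrow>
               2 * n \<in> (\<lambda>n. 2 * n) ` T \<union> range (\<lambda>n. Suc (2 * n))" for n
      by simp
    moreover have "2 * n \<notin> range (\<lambda>n. Suc (2 * n))" for n :: nat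
      by (auto, presburger)
    ultimately show "S = T"
      by (auto simp: image_iff)
  qed
  show "(\<lambda>n. 2 * n) ` S \<union> range (\<lambda>n. Suc (2 * n)) \<in> infsets" for S :: "nat set"
    by (auto simp: infsets_def finite_image_iff inj_on_def)
qed

text \<open>A family of fewer than \<open>\<cc>\<close> dense sets is padded with the dense sets \<open>[\<omega>]\<^sup>\<omega> - {X}\<close>.\<close>
lemma forcing_axiomD:
  assumes FA: "forcing_axiom continuum" and card: "|\<D>| \<le>o continuum"
    and dense: "\<And>D. D \<in> \<D> \<Longrightarrow> ae_dense D"
  shows "\<exists>G. ae_filter G \<and> (\<forall>D\<in>\<D>. G \<inter> D \<noteq> {})"
proof -
  define E where "E = (\<lambda>X. infsets - {X}) ` infsets"
  have dense_E: "ae_dense (infsets - {X})" for X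
    unfolding ae_dense_def
  proof (intro conjI ballI)
    fix Z :: "nat set" assume "Z \<in> infsets"
    then have Z: "infinite Z" by (simp add: infsets_def)
    then obtain z where "z \<in> Z" by (metis ex_in_conv finite.emptyI)
    \<comment> \<open>\<open>Z\<close> and \<open>Z\<close> minus a point are different, so at least
      one of them avoids \<open>X\<close>.\<close>
    then have "Z \<noteq> X \<or> Z - {z} \<noteq> X" by auto
    moreover have "Z - {z} \<in> infsets" "Z \<in> infsets" "Z - {z} \<subseteq>\<^sup>* Z"
      using Z by (simp_all add: infsets_def subset_almost_subset)
    ultimately show "\<exists>Y\<in>infsets - {X}. Y \<subseteq>\<^sup>* Z"
      by (metis Diff_iff almost_subset_refl singletonD)
  qed auto
  have "inj_on (\<lambda>X. infsets - {X}) infsets"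
    by (rule inj_onI) blast
  then have "|infsets| \<le>o |E|"
    unfolding E_def by (intro card_of_ordLeqI) auto
  then have "continuum \<le>o |\<D> \<union> E|"
    using continuum_ordLeq_infsets by (meson card_of_mono1 ordLeq_transitive sup_ge2)
  moreover have "|E| \<le>o continuum"
    unfolding E_def using card_of_image card_of_nat_sets_ordLeq_continuum ordLeq_transitive by blast
  then have "|\<D> \<union> E| \<le>o continuum"
    using card Card_order_continuum infinite_UNIV_nat_set
    by (intro card_of_Un_ordLeq_infinite_Field) (auto simp: continuum_def Field_card_of)
  ultimately have "|\<D> \<union> E| =o continuum"
    by (simp add: ordIso_iff_ordLeq)
  moreover have "\<forall>D\<in>\<D> \<union> E. ae_dense D"
    using dense dense_E by (auto simp: E_def)
  ultimately show ?thesis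
    using FA unfolding forcing_axiom_def by (meson UnCI)
qed

lemma forcing_axiom_indexed:
  fixes D :: "'i \<Rightarrow> nat set set"
  assumes FA: "forcing_axiom continuum" and card: "|I| \<le>o continuum"
    and dense: "\<And>i. i \<in> I \<Longrightarrow> ae_dense (D i)"
  shows "\<exists>G. ae_filter G \<and> (\<forall>i\<in>I. G \<inter> D i \<noteq> {})"
proof -
  have "|D ` I| \<le>o continuum"
    using card card_of_image ordLeq_transitive by blast
  with forcing_axiomD[OF FA this] dense show ?thesis by auto
qed

subsection \<open>Dense open subsets of \<open>\<omega>\<^sup>*\<close>\<close>

text \<open>The basic open set usually written \<open>B\<^sup>*\<close>.\<close>

definition star :: "nat set \<Rightarrow> nat filter set" where
  "star B = {q \<in> free_ultrafilters. eventually (\<lambda>n. n \<in> B) q}"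

lemma star_Int: "star (A \<inter> B) = star A \<inter> star B"
  by (auto simp: star_def eventually_conj_iff)

lemma star_mono: "A \<subseteq>\<^sup>* B \<Longrightarrow> star A \<subseteq> star B"
  by (auto simp: star_def intro: free_ultrafilter_almost_subset)

lemma openin_star: "openin omega_star (star B)"
  unfolding omega_star_def star_def by (rule topology_generated_by_Basis) auto

lemma openin_omega_starD:
  assumes "openin omega_star U" "q \<in> U"
  shows "\<exists>B. q \<in> star B \<and> star B \<subseteq> U"
proof -
  have "generate_topology_on {star B | B. True} U"
    using assms(1) by (simp add: omega_star_def star_def openin_topology_generated_by_iff)
  then show ?thesis
    using assms(2)
  proof (induction arbitrary: q)
    case (Int a b)
    then obtain A B where "q \<in> star A" "star A \<subseteq> a" "q \<in> star B" "star B \<subseteq> b"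
      by blast
    then show ?case
      by (intro exI[of _ "A \<inter> B"]) (auto simp: star_Int)
  next
    case (UN K)
    then show ?case by (meson Union_iff Union_upper order_trans)
  qed auto
qed

text \<open>The basic sets form a base, and the nonempty ones are exactly those given by infinite
  \<open>B\<close>; so density can be tested on infinite sets alone.\<close>

lemma closure_of_omega_star_eq_topspace:
  "omega_star closure_of U = topspace omega_star \<longleftrightarrow> (\<forall>B. infinite B \<longrightarrow> star B \<inter> U \<noteq> {})"
proof
  assume cl: "omega_star closure_of U = topspace omega_star"
  show "\<forall>B. infinite B \<longrightarrow> star B \<inter> U \<noteq> {}"
  proof (intro allI impI)
    fix B :: "nat set" assume "infinite B"
    then obtain q where "q \<in> star B"
      using ex_free_ultrafilter by (auto simp: star_def)
    moreover then have "q \<in> omega_star closure_of U"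
      using cl by (simp add: topspace_omega_star star_def)
    ultimately show "star B \<inter> U \<noteq> {}"
      using openin_star[of B] by (auto simp: in_closure_of)
  qed
next
  assume meet: "\<forall>B. infinite B \<longrightarrow> star B \<inter> U \<noteq> {}"
  have "\<exists>y. y \<in> U \<and> y \<in> T" if T: "openin omega_star T" "q \<in> T" for q T
  proof -
    obtain B where "q \<in> star B" "star B \<subseteq> T"
      using openin_omega_starD[OF T] by blast
    moreover then have "infinite B"
      using free_ultrafilter_infinite by (auto simp: star_def)
    ultimately show ?thesis
      using meet by blast
  qed
  then show "omega_star closure_of U = topspace omega_star"
    by (auto simp: in_closure_of)
qed

lemma continuum_less_novak_number_iff:
  "continuum <o novak_number omega_star \<longleftrightarrow>
    (\<forall>\<D>. |\<D>| \<le>o continuum \<and> (\<forall>U\<in>\<D>. openin omega_star U \<and> omega_star closure_of U = topspace omega_star)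
      \<longrightarrow> topspace omega_star \<inter> \<Inter>\<D> \<noteq> {})" (is "_ \<longleftrightarrow> ?R")
proof -
  define \<C> where "\<C> = {\<D>. (\<forall>U\<in>\<D>. openin omega_star U \<and> omega_star closure_of U = topspace omega_star)
      \<and> topspace omega_star \<inter> \<Inter>\<D> = {}}"
  \<comment> \<open>Complements of points form a family of dense open sets with empty intersection;
    without any such family \<open>least_card\<close> would carry no information.\<close>
  have "topspace omega_star - {q} \<in> {U. openin omega_star U \<and> omega_star closure_of U = topspace omega_star}"
    (is "?U \<in> _") for q
  proof -
    have "\<exists>B. x \<in> star B \<and> star B \<subseteq> ?U" if x: "x \<in> ?U" for x
    proof -
      \<comment> \<open>Inclusion between ultrafilters is equality, so distinct ones are separated
        by some \<open>P\<close>.\<close>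
      have "\<exists>P. eventually P x \<and> \<not> eventually P q" if "q \<in> free_ultrafilters"
      proof (rule ccontr)
        assume "\<not> ?thesis"
        then have sub: "\<And>P. eventually P x \<Longrightarrow> eventually P q"
          by blast
        then have "eventually P x" if "eventually P q" for P
          using that x \<open>q \<in> free_ultrafilters\<close> free_ultrafilter_not[of x "P"] free_ultrafilter_not[of q "P"]
          by (auto simp: topspace_omega_star)
        with sub have "x = q"
          by (simp add: filter_eq_iff) blast
        with x show False by simp
      qed
      then have "\<exists>P. eventually P x \<and> q \<notin> star {n. P n}"
        by (cases "q \<in> free_ultrafilters") (auto simp: star_def intro: always_eventually)
      then obtain P where "eventually P x" "q \<notin> star {n. P n}"
        by blast
      then have "x \<in> star {n. P n} \<and> star {n. P n} \<subseteq> ?U"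
        using x by (auto simp: star_def topspace_omega_star)
      then show ?thesis
        by blast
    qed
    then have "openin omega_star ?U"
      by (subst openin_subopen) (meson openin_star)
    moreover have "star B \<inter> ?U \<noteq> {}" if B: "infinite B" for B
    proof -
      \<comment> \<open>Two disjoint infinite parts of \<open>B\<close> carry different
        ultrafilters, so \<open>star B\<close> is not reduced to the point \<open>q\<close>.\<close>
      obtain C :: "nat \<Rightarrow> nat set" where
        C: "pairwise (\<lambda>i j. disjnt (C i) (C j)) UNIV" "(\<Union>i. C i) \<subseteq> B" "\<And>i. infinite (C i)"
        using infinite_infinite_partition[OF B] by blast
      obtain q0 q1 where q01: "q0 \<in> star (C 0)" "q1 \<in> star (C 1)"
        using ex_free_ultrafilter[OF C(3)] by (auto simp: star_def) blast
      have "C 0 \<inter> C 1 = {}"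
        using C(1) by (auto simp: pairwise_def disjnt_def)
      then have "star (C 0) \<inter> star (C 1) = star {}"
        by (simp flip: star_Int)
      also have "star {} = {}"
        using free_ultrafilter_infinite[of _ "{}"] by (auto simp: star_def)
      finally have "q0 \<noteq> q1"
        using q01 by blast
      moreover have "q0 \<in> star B" "q1 \<in> star B"
        using q01 C(2) star_mono subset_almost_subset by (metis UN_subset_iff UNIV_I subsetD)+
      ultimately show ?thesis
        by (auto simp: star_def topspace_omega_star)
    qed
    ultimately show ?thesis
      by (simp add: closure_of_omega_star_eq_topspace)
  qed
  then have "range (\<lambda>q. topspace omega_star - {q}) \<in> \<C>"
    by (auto simp: \<C>_def)
  then have "\<C> \<noteq> {}" by blast
  then obtain A where A: "A \<in> \<C>" "novak_number omega_star = |A|" "\<And>B. B \<in> \<C> \<Longrightarrow> |A| \<le>o |B|"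
    using least_card[of \<C>] unfolding novak_number_def \<C>_def[symmetric] by blast
  have "continuum <o |A| \<longleftrightarrow> \<not> |A| \<le>o continuum"
    unfolding continuum_def by (simp add: not_ordLeq_iff_ordLess card_of_Well_order)
  also have "\<dots> \<longleftrightarrow> (\<forall>\<D>\<in>\<C>. \<not> |\<D>| \<le>o continuum)"
    using A(1,3) ordLeq_transitive by blast
  also have "\<dots> \<longleftrightarrow> ?R"
    unfolding \<C>_def by blast
  finally show ?thesis
    by (simp add: A(2))
qed

text \<open>A dense \<open>D\<close> corresponds to the dense open union of the
  \<open>star B\<close> with \<open>B\<close> in \<open>D\<close>, and a dense open \<open>U\<close>
  to the infinite \<open>B\<close> with \<open>star B\<close> inside \<open>U\<close>. A common
  point of the open sets is itself the required filter; conversely a filter is extended to an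
  ultrafilter, which is a common point.\<close>

lemma novak_iff_forcing_axiom:
  "continuum <o novak_number omega_star \<longleftrightarrow> forcing_axiom continuum"
proof
  assume R: "continuum <o novak_number omega_star"
  show "forcing_axiom continuum"
    unfolding forcing_axiom_def
  proof (intro allI impI)
    fix \<D> assume D: "|\<D>| =o continuum \<and> (\<forall>D\<in>\<D>. ae_dense D)"
    define U where "U D = (\<Union>B\<in>D. star B)" for D
    have "|U ` \<D>| \<le>o continuum"
      using D card_of_image ordIso_imp_ordLeq ordLeq_transitive by blast
    moreover have "openin omega_star (U D)" for D
      unfolding U_def using openin_star by (auto intro: openin_Union)
    moreover have "star B \<inter> U D \<noteq> {}" if DB: "D \<in> \<D>" "infinite B" for B D
    proof -
      obtain Y where Y: "Y \<in> D" "infinite Y" "Y \<subseteq>\<^sup>* B"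
        using ae_denseE[of D B] D DB by blast
      then obtain q where "q \<in> star Y"
        using ex_free_ultrafilter by (auto simp: star_def)
      then show ?thesis
        using Y star_mono[OF Y(3)] by (auto simp: U_def)
    qed
    ultimately have "topspace omega_star \<inter> \<Inter>(U ` \<D>) \<noteq> {}"
      using R unfolding continuum_less_novak_number_iff
      by (auto simp: closure_of_omega_star_eq_topspace)
    then obtain q where q: "q \<in> free_ultrafilters" "\<And>D. D \<in> \<D> \<Longrightarrow> q \<in> U D"
      by (auto simp: topspace_omega_star)
    define G where "G = {B. eventually (\<lambda>n. n \<in> B) q}"
    have "ae_filter G"
      unfolding ae_filter_def
    proof (intro conjI ballI impI)
      show "G \<subseteq> infsets"
        using q(1) free_ultrafilter_infinite by (auto simp: G_def infsets_def)
      have "UNIV \<in> G"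
        by (simp add: G_def)
      then show "G \<noteq> {}"
        by blast
    next
      fix X Y assume "X \<in> G" "X \<subseteq>\<^sup>* Y"
      then show "Y \<in> G"
        using q(1) free_ultrafilter_almost_subset by (auto simp: G_def)
    next
      fix X Y assume "X \<in> G" "Y \<in> G"
      then have "X \<inter> Y \<in> G"
        by (simp add: G_def eventually_conj_iff)
      moreover have "X \<inter> Y \<subseteq>\<^sup>* X" "X \<inter> Y \<subseteq>\<^sup>* Y"
        by (simp_all add: subset_almost_subset)
      ultimately show "\<exists>Z\<in>G. Z \<subseteq>\<^sup>* X \<and> Z \<subseteq>\<^sup>* Y"
        by blast
    qed
    moreover have "\<forall>D\<in>\<D>. G \<inter> D \<noteq> {}"
      using q(2) by (fastforce simp: U_def star_def G_def)
    ultimately show "\<exists>G. ae_filter G \<and> (\<forall>D\<in>\<D>. G \<inter> D \<noteq> {})"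
      by blast
  qed
next
  assume FA: "forcing_axiom continuum"
  show "continuum <o novak_number omega_star"
    unfolding continuum_less_novak_number_iff
  proof (intro allI impI, elim conjE)
    fix \<D> :: "nat filter set set"
    assume card: "|\<D>| \<le>o continuum"
      and od: "\<forall>U\<in>\<D>. openin omega_star U \<and> omega_star closure_of U = topspace omega_star"
    define D where "D U = {B. infinite B \<and> star B \<subseteq> U}" for U
    have "ae_dense (D U)" if U: "U \<in> \<D>" for U
      unfolding ae_dense_def
    proof (intro conjI ballI)
      show "D U \<subseteq> infsets" by (auto simp: D_def infsets_def)
      fix X :: "nat set" assume "X \<in> infsets"
      then obtain q where q: "q \<in> star X" "q \<in> U"
        using od U by (auto simp: infsets_def closure_of_omega_star_eq_topspace)
      then obtain B where B: "q \<in> star B" "star B \<subseteq> U"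
        using openin_omega_starD od U by blast
      have "q \<in> star (B \<inter> X)"
        using q B by (simp add: star_Int)
      then have "infinite (B \<inter> X)"
        using free_ultrafilter_infinite[of q "B \<inter> X"] by (simp add: star_def)
      then have "B \<inter> X \<in> D U"
        using B(2) by (auto simp: D_def star_Int)
      then show "\<exists>Y\<in>D U. Y \<subseteq>\<^sup>* X"
        by (intro bexI[of _ "B \<inter> X"] subset_almost_subset) auto
    qed
    then obtain G where G: "ae_filter G" "\<And>U. U \<in> \<D> \<Longrightarrow> G \<inter> D U \<noteq> {}"
      using forcing_axiom_indexed[OF FA card] by metis
    then obtain q where q: "q \<in> free_ultrafilters" "\<And>B. B \<in> G \<Longrightarrow> eventually (\<lambda>n. n \<in> B) q"
      using ae_filter_extends by blast
    have "q \<in> U" if U: "U \<in> \<D>" for U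
      using G(2)[OF U] q by (auto simp: D_def star_def)
    then show "topspace omega_star \<inter> \<Inter>\<D> \<noteq> {}"
      using q(1) by (auto simp: topspace_omega_star)
  qed
qed

subsection \<open>The spaces \<open>\<Psi>(\<A>)\<close>\<close>

text \<open>The right-hand side survives finite intersections and arbitrary unions; conversely the
  finitely many points of \<open>a\<close> missing from \<open>V\<close> serve as \<open>F\<close>
  in a basic neighbourhood.\<close>

lemma openin_Psi_iff:
  "openin (Psi \<A>) V \<longleftrightarrow>
     V \<subseteq> range Inl \<union> Inr ` \<A> \<and> (\<forall>a. Inr a \<in> V \<longrightarrow> finite {k \<in> a. Inl k \<notin> V})"
    (is "_ \<longleftrightarrow> ?R V")
proof
  define \<B> where "\<B> = {{Inl n} | n. True} \<union> {insert (Inr a) (Inl ` (a - F)) | a F. a \<in> \<A> \<and> finite F}"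
  have eq: "openin (Psi \<A>) V \<longleftrightarrow> generate_topology_on \<B> V" for V
    unfolding Psi_def \<B>_def by (rule openin_topology_generated_by_iff)
  {
    assume "openin (Psi \<A>) V"
    then have "generate_topology_on \<B> V" by (simp add: eq)
    then show "?R V"
    proof induction
      case (Int V W)
      have "{k \<in> a. Inl k \<notin> V \<inter> W} = {k \<in> a. Inl k \<notin> V} \<union> {k \<in> a. Inl k \<notin> W}" for a
        by auto
      with Int show ?case
        by auto
    next
      case (UN K)
      have "finite {k \<in> a. Inl k \<notin> \<Union>K}" if "Inr a \<in> V" "V \<in> K" for a V
        by (rule finite_subset[of _ "{k \<in> a. Inl k \<notin> V}"]) (use UN that in auto)
      with UN show ?case
        by blast
    next
      case (Basis s)
      then show ?case
        by (auto simp: \<B>_def elim: rev_finite_subset)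
    qed auto
  }
  {
    assume R: "?R V"
    have "\<exists>T. openin (Psi \<A>) T \<and> x \<in> T \<and> T \<subseteq> V" if x: "x \<in> V" for x
    proof (cases x)
      case (Inl n)
      then have "openin (Psi \<A>) {x}"
        unfolding eq by (intro generate_topology_on.Basis) (auto simp: \<B>_def)
      then show ?thesis
        using x by blast
    next
      case (Inr a)
      define F where "F = {k \<in> a. Inl k \<notin> V}"
      have "a \<in> \<A>" "finite F"
        using R x Inr by (auto simp: F_def)
      then have "openin (Psi \<A>) (insert (Inr a) (Inl ` (a - F)))"
        unfolding eq by (intro generate_topology_on.Basis) (auto simp: \<B>_def)
      then show ?thesis
        using x Inr by (intro exI[of _ "insert (Inr a) (Inl ` (a - F))"]) (auto simp: F_def)
    qed
    then show "openin (Psi \<A>) V"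
      by (subst openin_subopen) blast
  }
qed

lemma openin_Psi_Inl: "openin (Psi \<A>) (Inl ` S)"
  by (auto simp: openin_Psi_iff)

lemma openin_Psi_insert_Inr: "a \<in> \<A> \<Longrightarrow> openin (Psi \<A>) (insert (Inr a) (Inl ` a))"
  by (auto simp: openin_Psi_iff inj_image_mem_iff)

lemma closedin_Psi_finite_Inl:
  assumes "finite S"
  shows "closedin (Psi \<A>) (Inl ` S)"
proof -
  have "{k \<in> a. (Inl k :: nat + nat set) \<notin> (range Inl \<union> Inr ` \<A>) - Inl ` S} \<subseteq> S" for a
    by auto
  then show ?thesis
    using assms by (auto simp: closedin_def topspace_Psi openin_Psi_iff intro: finite_subset)
qed

text \<open>A neighbourhood of \<open>Inr a\<close> omits only finitely many points of the infinite
  set \<open>a\<close>; hence the isolated points are dense.\<close>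

lemma openin_Psi_nonempty:
  assumes inf: "\<And>a. a \<in> \<A> \<Longrightarrow> infinite a" and V: "openin (Psi \<A>) V" "V \<noteq> {}"
  shows "\<exists>k. Inl k \<in> V"
proof -
  obtain x where x: "x \<in> V" using V(2) by blast
  show ?thesis
  proof (cases x)
    case (Inr a)
    then have "infinite a" "finite {k \<in> a. Inl k \<notin> V}"
      using inf x V(1) by (auto simp: openin_Psi_iff)
    then have "{k \<in> a. Inl k \<notin> V} \<noteq> a"
      by auto
    then show ?thesis
      by auto
  qed (use x in auto)
qed

lemma p_limit_point_mono:
  assumes "p_limit_point p X U x" "\<And>n. U n \<subseteq> V n"
  shows "p_limit_point p X V x"
  unfolding p_limit_point_def
proof (intro conjI allI impI)
  show "x \<in> topspace X"
    using assms(1) by (simp add: p_limit_point_def)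
  fix W assume "openin X W \<and> x \<in> W"
  then have "eventually (\<lambda>n. U n \<inter> W \<noteq> {}) p"
    using assms(1) by (simp add: p_limit_point_def)
  then show "eventually (\<lambda>n. V n \<inter> W \<noteq> {}) p"
    by eventually_elim (use assms(2) in blast)
qed

text \<open>Together with \<open>p_limit_point_mono\<close> this reduces sequences of open sets to
  sequences of isolated points.\<close>

lemma nonempty_open_seq_Psi:
  assumes "mad_family \<A>" "nonempty_open_seq (Psi \<A>) U"
  shows "\<exists>f. \<forall>n. {Inl (f n)} \<subseteq> U n"
proof -
  have "\<exists>k. Inl k \<in> U n" for n
    using openin_Psi_nonempty[of \<A> "U n"] assms mad_familyD(2)
    by (auto simp: nonempty_open_seq_def)
  then show ?thesis
    by simp metis
qed

lemma nonempty_open_seq_Inl: "nonempty_open_seq (Psi \<A>) (\<lambda>n. {Inl (f n)})"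
  using openin_Psi_Inl[of \<A> "{f n}" for n] by (auto simp: nonempty_open_seq_def)

section \<open>Limits of sequences of isolated points\<close>

text \<open>Along such a \<open>B\<close> the sequence of points \<open>Inl (f n)\<close> converges
  in \<Psi>(\<A>), either to \<open>Inl k\<close> or to \<open>Inr a\<close>.\<close>

definition dense_for :: "nat set set \<Rightarrow> (nat \<Rightarrow> nat) \<Rightarrow> nat set set" where
  "dense_for \<A> f = {B. infinite B \<and>
     ((\<exists>k. \<forall>n\<in>B. f n = k) \<or> (inj_on f B \<and> (\<exists>a\<in>\<A>. f ` B \<subseteq> a)))}"

text \<open>Either \<open>f\<close> has finitely many values on \<open>X\<close>, one of them taken
  infinitely often, or the infinite image of \<open>X\<close> has infinite intersection with a
  member of the family, over which an injective section is chosen.\<close>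

lemma ae_dense_dense_for:
  assumes mad: "mad_family \<A>"
  shows "ae_dense (dense_for \<A> f)"
  unfolding ae_dense_def
proof (intro conjI ballI)
  show "dense_for \<A> f \<subseteq> infsets"
    by (auto simp: dense_for_def infsets_def)
  fix X :: "nat set" assume "X \<in> infsets"
  then have X: "infinite X" by (simp add: infsets_def)
  show "\<exists>Y\<in>dense_for \<A> f. Y \<subseteq>\<^sup>* X"
  proof (cases "finite (f ` X)")
    case True
    then obtain k where "infinite {n \<in> X. f n = f k}"
      using pigeonhole_infinite[OF X] by blast
    then have "{n \<in> X. f n = f k} \<in> dense_for \<A> f"
      by (auto simp: dense_for_def)
    then show ?thesis
      by (rule rev_bexI) (auto intro: subset_almost_subset)
  next
    case False
    then obtain a where a: "a \<in> \<A>" "infinite (a \<inter> f ` X)"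
      using mad_familyD(4)[OF mad] by blast
    have "a \<inter> f ` X \<subseteq> f ` X" by blast
    then obtain B where B: "B \<subseteq> X" "inj_on f B" "a \<inter> f ` X = f ` B"
      by (meson subset_image_inj)
    then have "infinite B"
      using a(2) by (metis finite_imageI)
    moreover have "f ` B \<subseteq> a"
      using B(3) by blast
    ultimately have "B \<in> dense_for \<A> f"
      using a(1) B(2) by (auto simp: dense_for_def)
    then show ?thesis
      using B(1) subset_almost_subset by blast
  qed
qed

text \<open>In the injective case a neighbourhood of \<open>Inr a\<close> omits finitely many points
  of \<open>a\<close>, and their preimage in \<open>B\<close> is finite.\<close>

lemma p_limit_point_dense_for:
  assumes p: "p \<in> free_ultrafilters" and B: "eventually (\<lambda>n. n \<in> B) p" "B \<in> dense_for \<A> f"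
  shows "\<exists>x. p_limit_point p (Psi \<A>) (\<lambda>n. {Inl (f n)}) x"
proof -
  consider k where "\<forall>n\<in>B. f n = k" | a where "inj_on f B" "a \<in> \<A>" "f ` B \<subseteq> a"
    using B(2) by (auto simp: dense_for_def)
  then show ?thesis
  proof cases
    case 1
    have "p_limit_point p (Psi \<A>) (\<lambda>n. {Inl (f n)}) (Inl k)"
      unfolding p_limit_point_def topspace_Psi
    proof (intro conjI allI impI)
      fix V :: "(nat + nat set) set" assume "openin (Psi \<A>) V \<and> Inl k \<in> V"
      with B(1) 1 show "eventually (\<lambda>n. {Inl (f n)} \<inter> V \<noteq> {}) p"
        by (auto elim!: eventually_mono)
    qed auto
    then show ?thesis ..
  next
    case 2
    have "p_limit_point p (Psi \<A>) (\<lambda>n. {Inl (f n)}) (Inr a)"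
      unfolding p_limit_point_def topspace_Psi
    proof (intro conjI allI impI)
      fix V :: "(nat + nat set) set" assume V: "openin (Psi \<A>) V \<and> Inr a \<in> V"
      have "finite {k \<in> a. Inl k \<notin> V}"
        using V by (simp add: openin_Psi_iff)
      then have "finite (f -` {k \<in> a. Inl k \<notin> V} \<inter> B)"
        using 2(1) by (rule finite_vimage_IntI)
      moreover have "B - {n. Inl (f n) \<in> V} \<subseteq> f -` {k \<in> a. Inl k \<notin> V} \<inter> B"
        using 2(3) by auto
      ultimately have "B \<subseteq>\<^sup>* {n. Inl (f n) \<in> V}"
        unfolding almost_subset_def by (rule rev_finite_subset)
      then have "eventually (\<lambda>n. n \<in> {n. Inl (f n) \<in> V}) p"
        by (rule free_ultrafilter_almost_subset[OF p B(1)])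
      then show "eventually (\<lambda>n. {Inl (f n)} \<inter> V \<noteq> {}) p"
        by simp
    qed (use 2 in auto)
    then show ?thesis ..
  qed
qed

lemma forcing_axiom_imp_ka_pseudocompact:
  assumes FA: "forcing_axiom continuum" and mad: "mad_family \<A>"
  shows "ka_pseudocompact continuum free_ultrafilters (Psi \<A>)"
  unfolding ka_pseudocompact_def
proof (intro allI impI)
  fix U :: "nat set \<Rightarrow> nat \<Rightarrow> (nat + nat set) set"
  assume "\<forall>\<alpha>\<in>Field continuum. nonempty_open_seq (Psi \<A>) (U \<alpha>)"
  then have "\<exists>f. \<forall>n. {Inl (f n)} \<subseteq> U \<alpha> n" for \<alpha>
    using nonempty_open_seq_Psi[OF mad, of "U \<alpha>"] by (simp add: continuum_def Field_card_of)
  then obtain f where f: "\<And>\<alpha> n. {Inl (f \<alpha> n)} \<subseteq> U \<alpha> n"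
    by metis
  have "|UNIV :: nat set set| \<le>o continuum"
    by (rule card_of_nat_sets_ordLeq_continuum)
  then obtain G where G: "ae_filter G" "\<And>\<alpha>. G \<inter> dense_for \<A> (f \<alpha>) \<noteq> {}"
    using forcing_axiom_indexed[OF FA, of UNIV "\<lambda>\<alpha>. dense_for \<A> (f \<alpha>)"]
      ae_dense_dense_for[OF mad] by auto
  then obtain p where p: "p \<in> free_ultrafilters" "\<And>B. B \<in> G \<Longrightarrow> eventually (\<lambda>n. n \<in> B) p"
    using ae_filter_extends by blast
  have "\<exists>x. p_limit_point p (Psi \<A>) (U \<alpha>) x" for \<alpha>
  proof -
    obtain B where "B \<in> G" "B \<in> dense_for \<A> (f \<alpha>)"
      using G(2) by blast
    then obtain x where "p_limit_point p (Psi \<A>) (\<lambda>n. {Inl (f \<alpha> n)}) x"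
      using p_limit_point_dense_for p by blast
    then have "p_limit_point p (Psi \<A>) (U \<alpha>) x"
      by (rule p_limit_point_mono) (rule f)
    then show ?thesis ..
  qed
  with p(1) show "\<exists>p\<in>free_ultrafilters. \<forall>\<alpha>\<in>Field continuum. \<exists>x. p_limit_point p (Psi \<A>) (U \<alpha>) x"
    by blast
qed

lemma ka_pseudocompact_imp_p_pseudocompact:
  assumes ka: "ka_pseudocompact continuum free_ultrafilters (Psi \<A>)" and mad: "mad_family \<A>"
  shows "\<exists>p\<in>free_ultrafilters. p_pseudocompact p (Psi \<A>)"
proof -
  \<comment> \<open>Subsets of \<omega> code functions by their graphs; other sets may decode to
    arbitrary values. Surjectivity of the decoding puts all sequences of isolated points into one
    family of size \<cc>, so a single \<open>p\<close> serves them all.\<close>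
  define f where "f S n = (SOME m. prod_encode (n, m) \<in> S)" for S n
  have surj: "\<exists>S. f S = g" for g
  proof
    show "f (range (\<lambda>n. prod_encode (n, g n))) = g"
      by (auto simp: f_def fun_eq_iff inj_eq)
  qed
  obtain p where p: "p \<in> free_ultrafilters"
    "\<And>S. \<exists>x. p_limit_point p (Psi \<A>) (\<lambda>n. {Inl (f S n)}) x"
    using ka nonempty_open_seq_Inl unfolding ka_pseudocompact_def
    by (auto simp: continuum_def Field_card_of dest!: spec[of _ "\<lambda>S n. {Inl (f S n)}"])
  have "p_pseudocompact p (Psi \<A>)"
    unfolding p_pseudocompact_def
  proof (intro allI impI)
    fix U assume "nonempty_open_seq (Psi \<A>) U"
    then obtain g where g: "\<And>n. {Inl (g n)} \<subseteq> U n"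
      using nonempty_open_seq_Psi[OF mad] by blast
    obtain x where "p_limit_point p (Psi \<A>) (\<lambda>n. {Inl (g n)}) x"
      using p(2) surj by metis
    then have "p_limit_point p (Psi \<A>) U x"
      by (rule p_limit_point_mono) (rule g)
    then show "\<exists>x. p_limit_point p (Psi \<A>) U x" ..
  qed
  with p(1) show ?thesis by blast
qed

subsection \<open>Vietoris hyperspaces\<close>

lemma openin_vietoris_subset:
  "openin X U \<Longrightarrow> openin (vietoris X) {F. closedin X F \<and> F \<noteq> {} \<and> F \<subseteq> U}"
  unfolding vietoris_def by (rule topology_generated_by_Basis) blast

lemma openin_vietoris_meets:
  "openin X U \<Longrightarrow> openin (vietoris X) {F. closedin X F \<and> F \<noteq> {} \<and> F \<inter> U \<noteq> {}}"
  unfolding vietoris_def by (rule topology_generated_by_Basis) blast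

text \<open>The usual basic open set of the Vietoris topology, with the containing set
  \<open>U\<close> kept apart from the sets to be met, so that the intersection of two is visibly of
  the same form.\<close>

definition vietoris_basic :: "'a topology \<Rightarrow> 'a set \<Rightarrow> 'a set set \<Rightarrow> 'a set set" where
  "vietoris_basic X U \<W> =
     {F. closedin X F \<and> F \<noteq> {} \<and> F \<subseteq> U \<and> (\<forall>W\<in>\<W>. F \<inter> W \<noteq> {})}"

lemma openin_vietoris_basic:
  assumes "openin (vietoris X) V" "L \<in> V"
  shows "\<exists>U \<W>. openin X U \<and> finite \<W> \<and> (\<forall>W\<in>\<W>. openin X W) \<and>
           L \<in> vietoris_basic X U \<W> \<and> vietoris_basic X U \<W> \<subseteq> V"
proof -
  have "generate_topology_on
     ({{F. closedin X F \<and> F \<noteq> {} \<and> F \<subseteq> U} | U. openin X U} \<union>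
      {{F. closedin X F \<and> F \<noteq> {} \<and> F \<inter> U \<noteq> {}} | U. openin X U}) V"
    using assms(1) by (simp add: vietoris_def openin_topology_generated_by_iff)
  then show ?thesis
    using assms(2)
  proof induction
    case (Int V V')
    then have "L \<in> V" "L \<in> V'"
      by simp_all
    obtain U \<W> where U: "openin X U" "finite \<W>" "\<forall>W\<in>\<W>. openin X W"
      "L \<in> vietoris_basic X U \<W>" "vietoris_basic X U \<W> \<subseteq> V"
      using Int.IH(1)[OF \<open>L \<in> V\<close>] by (elim exE conjE) assumption
    obtain U' \<W>' where U': "openin X U'" "finite \<W>'" "\<forall>W\<in>\<W>'. openin X W"
      "L \<in> vietoris_basic X U' \<W>'" "vietoris_basic X U' \<W>' \<subseteq> V'"
      using Int.IH(2)[OF \<open>L \<in> V'\<close>] by (elim exE conjE) assumption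
    have "vietoris_basic X (U \<inter> U') (\<W> \<union> \<W>') = vietoris_basic X U \<W> \<inter> vietoris_basic X U' \<W>'"
      by (auto simp: vietoris_basic_def)
    with U U' show ?case
      by (intro exI[of _ "U \<inter> U'"] exI[of _ "\<W> \<union> \<W>'"]) auto
  next
    case (UN K)
    then obtain V where V: "V \<in> K" "L \<in> V"
      by blast
    then have "V \<subseteq> \<Union>K"
      by blast
    with UN.IH[OF V] show ?case
      by (meson subset_trans)
  next
    case (Basis V)
    then consider U where "openin X U" "V = {F. closedin X F \<and> F \<noteq> {} \<and> F \<subseteq> U}"
      | W where "openin X W" "V = {F. closedin X F \<and> F \<noteq> {} \<and> F \<inter> W \<noteq> {}}"
      by blast
    then show ?case
    proof cases
      case 1
      then show ?thesis
        using Basis.prems by (intro exI[of _ U] exI[of _ "{}"]) (auto simp: vietoris_basic_def)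
    next
      case 2
      then show ?thesis
        using Basis.prems
        by (intro exI[of _ "topspace X"] exI[of _ "{W}"])
          (auto simp: vietoris_basic_def dest: closedin_subset)
    qed
  qed auto
qed

text \<open>By density of the isolated points, every set to be met can be hit inside
  \<open>U\<close> by an isolated point, and finite sets of isolated points are closed.\<close>

lemma vietoris_nonempty_contains_finite:
  assumes inf: "\<And>a. a \<in> \<A> \<Longrightarrow> infinite a" and V: "openin (vietoris (Psi \<A>)) V" "V \<noteq> {}"
  shows "\<exists>S. finite S \<and> S \<noteq> {} \<and> Inl ` S \<in> V"
proof -
  obtain L where L: "L \<in> V" using V(2) by blast
  obtain U \<W> where U: "openin (Psi \<A>) U"
    and W: "finite \<W>" "\<forall>W\<in>\<W>. openin (Psi \<A>) W"
    and basic: "L \<in> vietoris_basic (Psi \<A>) U \<W>" "vietoris_basic (Psi \<A>) U \<W> \<subseteq> V"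
    using openin_vietoris_basic[OF V(1) L] by (elim exE conjE) assumption
  \<comment> \<open>Including \<open>U\<close> itself guarantees a point even when there is no set
    to be met.\<close>
  have "\<exists>k. Inl k \<in> U \<inter> W" if W': "W \<in> insert U \<W>" for W
  proof (rule openin_Psi_nonempty[OF inf])
    show "openin (Psi \<A>) (U \<inter> W)"
      using W' U W(2) by auto
    show "U \<inter> W \<noteq> {}"
      using W' basic(1) by (auto simp: vietoris_basic_def)
  qed
  then obtain k where k: "\<And>W. W \<in> insert U \<W> \<Longrightarrow> Inl (k W) \<in> U \<inter> W"
    by metis
  define S where "S = k ` insert U \<W>"
  have "finite S" "S \<noteq> {}"
    using W(1) by (auto simp: S_def)
  moreover have "Inl ` S \<in> V"
  proof (rule subsetD[OF basic(2)], unfold vietoris_basic_def, intro CollectI conjI ballI)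
    show "closedin (Psi \<A>) (Inl ` S)"
      using \<open>finite S\<close> by (rule closedin_Psi_finite_Inl)
    show "Inl ` S \<subseteq> U"
      using k by (auto simp: S_def)
    show "Inl ` S \<inter> W \<noteq> {}" if "W \<in> \<W>" for W
      using k[of W] that by (auto simp: S_def)
  qed (use \<open>S \<noteq> {}\<close> in auto)
  ultimately show ?thesis by blast
qed

text \<open>The limit is the set of all points whose neighbourhoods meet \<open>p\<close>-almost all terms; it lies
  in an open \<open>U\<close> only if \<open>p\<close>-almost all terms do, by \<open>p\<close>-pseudocompactness applied to points
  chosen outside \<open>U\<close>.\<close>
lemma p_pseudocompact_vietoris_Psi:
  assumes p: "p \<in> free_ultrafilters" and mad: "mad_family \<A>" and pp: "p_pseudocompact p (Psi \<A>)"
  shows "p_pseudocompact p (vietoris (Psi \<A>))"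
  unfolding p_pseudocompact_def
proof (intro allI impI)
  fix \<U> assume "nonempty_open_seq (vietoris (Psi \<A>)) \<U>"
  then have "\<exists>S. finite S \<and> S \<noteq> {} \<and> Inl ` S \<in> \<U> n" for n
    using vietoris_nonempty_contains_finite[of \<A> "\<U> n"] mad_familyD(2)[OF mad]
    by (auto simp: nonempty_open_seq_def)
  then obtain S where S: "\<And>n. finite (S n)" "\<And>n. S n \<noteq> {}" "\<And>n. Inl ` S n \<in> \<U> n"
    by metis
  define L where "L = {x \<in> topspace (Psi \<A>). \<forall>V. openin (Psi \<A>) V \<and> x \<in> V \<longrightarrow>
     eventually (\<lambda>n. Inl ` S n \<inter> V \<noteq> {}) p}"
  have lim: "\<exists>x\<in>L. \<forall>V. openin (Psi \<A>) V \<and> x \<in> V \<longrightarrow> eventually (\<lambda>n. Inl (f n) \<in> V) p"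
    if f: "\<And>n. f n \<in> S n" for f
  proof -
    obtain x where x: "p_limit_point p (Psi \<A>) (\<lambda>n. {Inl (f n)}) x"
      using pp nonempty_open_seq_Inl unfolding p_pseudocompact_def by blast
    then have ev: "\<forall>V. openin (Psi \<A>) V \<and> x \<in> V \<longrightarrow> eventually (\<lambda>n. Inl (f n) \<in> V) p"
      by (simp add: p_limit_point_def)
    moreover have "x \<in> L"
      unfolding L_def
    proof (intro CollectI conjI allI impI)
      fix V assume "openin (Psi \<A>) V \<and> x \<in> V"
      with ev have "eventually (\<lambda>n. Inl (f n) \<in> V) p" by blast
      then show "eventually (\<lambda>n. Inl ` S n \<inter> V \<noteq> {}) p"
        by eventually_elim (use f in blast)
    qed (use x in \<open>simp add: p_limit_point_def\<close>)
    ultimately show ?thesis by blast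
  qed
  have "\<exists>k. k \<in> S n" for n
    using S(2)[of n] by blast
  then have "\<exists>f. \<forall>n. f n \<in> S n"
    by metis
  then have "L \<noteq> {}"
    using lim by blast
  have "openin (Psi \<A>) (topspace (Psi \<A>) - L)"
  \<comment> \<open>A neighbourhood witnessing that \<open>x\<close> is not in \<open>L\<close>
    witnesses the same for each of its points.\<close>
  proof (subst openin_subopen, intro ballI)
    fix x assume "x \<in> topspace (Psi \<A>) - L"
    then obtain V where V: "openin (Psi \<A>) V" "x \<in> V" "\<not> eventually (\<lambda>n. Inl ` S n \<inter> V \<noteq> {}) p"
      by (auto simp: L_def)
    then have "V \<subseteq> topspace (Psi \<A>) - L"
      using openin_subset by (auto simp: L_def)
    with V show "\<exists>T. openin (Psi \<A>) T \<and> x \<in> T \<and> T \<subseteq> topspace (Psi \<A>) - L"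
      by blast
  qed
  moreover have "L \<subseteq> topspace (Psi \<A>)"
    by (auto simp: L_def)
  ultimately have "closedin (Psi \<A>) L"
    by (simp add: closedin_def)
  have sub: "eventually (\<lambda>n. Inl ` S n \<subseteq> U) p" if U: "openin (Psi \<A>) U" "L \<subseteq> U" for U
  proof (rule ccontr)
    assume "\<not> eventually (\<lambda>n. Inl ` S n \<subseteq> U) p"
    then have ev: "eventually (\<lambda>n. \<not> Inl ` S n \<subseteq> U) p"
      using free_ultrafilter_not[OF p] by blast
    have "\<exists>k\<in>S n. \<not> Inl ` S n \<subseteq> U \<longrightarrow> Inl k \<notin> U" for n
      using S(2)[of n] by blast
    then obtain f where f: "\<And>n. f n \<in> S n" "\<And>n. \<not> Inl ` S n \<subseteq> U \<Longrightarrow> Inl (f n) \<notin> U"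
      by metis
    from lim[OF f(1)] U have "eventually (\<lambda>n. Inl (f n) \<in> U) p"
      by blast
    with ev have "eventually (\<lambda>n. False) p"
      by eventually_elim (use f(2) in blast)
    with p show False
      by (simp add: free_ultrafilters_def)
  qed
  have "p_limit_point p (vietoris (Psi \<A>)) \<U> L"
    unfolding p_limit_point_def topspace_vietoris
  proof (intro conjI allI impI)
    show "L \<in> {F. closedin (Psi \<A>) F \<and> F \<noteq> {}}"
      using \<open>closedin (Psi \<A>) L\<close> \<open>L \<noteq> {}\<close> by blast
    fix V assume "openin (vietoris (Psi \<A>)) V \<and> L \<in> V"
    then have VL: "openin (vietoris (Psi \<A>)) V" "L \<in> V"
      by simp_all
    obtain U \<W> where U: "openin (Psi \<A>) U"
      and W: "finite \<W>" "\<forall>W\<in>\<W>. openin (Psi \<A>) W"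
      and basic: "L \<in> vietoris_basic (Psi \<A>) U \<W>" "vietoris_basic (Psi \<A>) U \<W> \<subseteq> V"
      using openin_vietoris_basic[OF VL] by (elim exE conjE) assumption
    have "L \<subseteq> U"
      using basic(1) by (simp add: vietoris_basic_def)
    have "eventually (\<lambda>n. Inl ` S n \<inter> W \<noteq> {}) p" if W': "W \<in> \<W>" for W
    proof -
      obtain x where "x \<in> L" "x \<in> W"
        using basic(1) W' by (auto simp: vietoris_basic_def)
      then show ?thesis
        using W(2) W' by (simp add: L_def)
    qed
    then have "\<forall>W\<in>\<W>. eventually (\<lambda>n. Inl ` S n \<inter> W \<noteq> {}) p"
      by blast
    then have "eventually (\<lambda>n. \<forall>W\<in>\<W>. Inl ` S n \<inter> W \<noteq> {}) p"
      using W(1) by (simp add: eventually_ball_finite)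
    with sub[OF U \<open>L \<subseteq> U\<close>] show "eventually (\<lambda>n. \<U> n \<inter> V \<noteq> {}) p"
    proof eventually_elim
      case (elim n)
      then have "Inl ` S n \<in> V"
        using closedin_Psi_finite_Inl[OF S(1)] S(2)
        by (intro subsetD[OF basic(2)]) (simp add: vietoris_basic_def)
      with S(3) show ?case by blast
    qed
  qed
  then show "\<exists>x. p_limit_point p (vietoris (Psi \<A>)) \<U> x" ..
qed

text \<open>For unbounded \<open>f\<close> the open sets where \<open>f\<close> exceeds
  \<open>n\<close> in absolute value are nonempty. Near a p-limit \<open>x\<close> the values stay
  below \<open>\<bar>f x\<bar> + 1\<close>, so only finitely many of these sets come close, while
  members of \<open>p\<close> are infinite.\<close>

lemma p_pseudocompact_imp_pseudocompact_space:
  assumes p: "p \<in> free_ultrafilters" and pp: "p_pseudocompact p X"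
  shows "pseudocompact_space X"
  unfolding pseudocompact_space_def
proof (intro allI impI, rule ccontr)
  fix f assume f: "continuous_map X euclideanreal f" and unb: "\<not> bounded (f ` topspace X)"
  define U where "U n = {x \<in> topspace X. f x \<in> {y. real n < \<bar>y\<bar>}}" for n
  have "openin X (U n)" for n
    unfolding U_def by (rule openin_continuous_map_preimage[OF f]) (auto intro!: open_Collect_less continuous_intros)
  moreover have "U n \<noteq> {}" for n
  proof
    assume "U n = {}"
    then have "\<forall>x\<in>topspace X. \<bar>f x\<bar> \<le> real n"
      by (auto simp: U_def not_less)
    with unb show False
      by (auto simp: bounded_iff)
  qed
  ultimately obtain x where x: "p_limit_point p X U x"
    using pp unfolding p_pseudocompact_def nonempty_open_seq_def by blast
  define V where "V = {y \<in> topspace X. f y \<in> {z. \<bar>z\<bar> < \<bar>f x\<bar> + 1}}"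
  have "openin X V"
    unfolding V_def by (rule openin_continuous_map_preimage[OF f]) (auto intro!: open_Collect_less continuous_intros)
  moreover have "x \<in> V"
    using x by (simp add: V_def p_limit_point_def)
  ultimately have "eventually (\<lambda>n. U n \<inter> V \<noteq> {}) p"
    using x by (simp add: p_limit_point_def)
  then have "eventually (\<lambda>n. n \<in> {n. real n < \<bar>f x\<bar> + 1}) p"
    by eventually_elim (auto simp: U_def V_def)
  moreover have "finite {n. real n < \<bar>f x\<bar> + 1}"
    by (rule finite_subset[of _ "{..nat \<lceil>\<bar>f x\<bar> + 1\<rceil>}"]) (auto, linarith)
  ultimately show False
    using free_ultrafilter_infinite[OF p] by blast
qed

subsection \<open>From pseudocompact hyperspaces to the forcing axiom\<close>

text \<open>Without an accumulation point, the function with value \<open>n\<close> at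
  \<open>\<Phi> n\<close> and 0 elsewhere would be continuous and unbounded: around a point outside
  the sequence, the finitely many closed points \<open>\<Phi> n\<close> can be removed from a
  neighbourhood.\<close>

lemma pseudocompact_space_accumulation:
  assumes pc: "pseudocompact_space X" and inj: "inj \<Phi>"
    and op: "\<And>n. openin X {\<Phi> n}" and cl: "\<And>n. closedin X {\<Phi> n}"
  shows "\<exists>L\<in>topspace X. \<forall>V. openin X V \<and> L \<in> V \<longrightarrow> infinite {n::nat. \<Phi> n \<in> V}"
proof (rule ccontr)
  assume *: "\<not> ?thesis"
  define f where "f L = (if L \<in> range \<Phi> then real (inv \<Phi> L) else 0)" for L
  have f_\<Phi>: "f (\<Phi> n) = real n" for n
    using inj by (simp add: f_def)
  have "openin X {x \<in> topspace X. f x \<in> U}" for U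
  proof (subst openin_subopen, intro ballI)
    fix L assume "L \<in> {x \<in> topspace X. f x \<in> U}"
    then have L: "L \<in> topspace X" "f L \<in> U" by auto
    show "\<exists>T. openin X T \<and> L \<in> T \<and> T \<subseteq> {x \<in> topspace X. f x \<in> U}"
    proof (cases "L \<in> range \<Phi>")
      case True
      then have "openin X {L}"
        using op by auto
      with L show ?thesis by blast
    next
      case False
      obtain V where V: "openin X V" "L \<in> V" "finite {n. \<Phi> n \<in> V}"
        using * L(1) by blast
      have "closedin X (\<Union>n\<in>{n. \<Phi> n \<in> V}. {\<Phi> n})"
        using V(3) cl by (intro closedin_Union) auto
      then have "openin X (V - (\<Union>n\<in>{n. \<Phi> n \<in> V}. {\<Phi> n}))"
        using V(1) by (rule openin_diff[rotated])
      moreover have "f x = f L" "x \<in> topspace X" if "x \<in> V - (\<Union>n\<in>{n. \<Phi> n \<in> V}. {\<Phi> n})" for x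
        using that False openin_subset[OF V(1)] by (auto simp: f_def)
      ultimately show ?thesis
        using V(2) False L(2)
        by (intro exI[of _ "V - (\<Union>n\<in>{n. \<Phi> n \<in> V}. {\<Phi> n})"]) auto
    qed
  qed
  then have "continuous_map X euclideanreal f"
    by (simp add: continuous_map_def)
  then have "bounded (f ` topspace X)"
    using pc by (simp add: pseudocompact_space_def)
  then obtain C where C: "\<And>L. L \<in> topspace X \<Longrightarrow> \<bar>f L\<bar> \<le> C"
    by (auto simp: bounded_iff)
  obtain n where "C < real n"
    using reals_Archimedean2 by blast
  moreover have "\<Phi> n \<in> topspace X"
    using openin_subset[OF op[of n]] by simp
  ultimately show False
    using C[of "\<Phi> n"] f_\<Phi>[of n] by simp
qed

text \<open>Meeting each \<open>{k}\<close> with \<open>k\<close> in \<open>S\<close> and lying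
  inside \<open>S\<close> are finitely many open conditions that only this set satisfies.\<close>

lemma openin_vietoris_singleton:
  assumes "finite S" "S \<noteq> {}"
  shows "openin (vietoris (Psi \<A>)) {Inl ` S}"
proof -
  let ?U = "Inl ` S :: (nat + nat set) set"
  let ?M = "\<lambda>k. {F. closedin (Psi \<A>) F \<and> F \<noteq> {} \<and> F \<inter> Inl ` {k} \<noteq> {}}"
  have "openin (vietoris (Psi \<A>)) (\<Inter>k\<in>S. ?M k)"
  proof (rule openin_Inter)
    fix V assume "V \<in> ?M ` S"
    then show "openin (vietoris (Psi \<A>)) V"
      by (elim imageE, hypsubst, intro openin_vietoris_meets openin_Psi_Inl)
  qed (use assms in auto)
  then have "openin (vietoris (Psi \<A>)) ((\<Inter>k\<in>S. ?M k) \<inter> {F. closedin (Psi \<A>) F \<and> F \<noteq> {} \<and> F \<subseteq> ?U})"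
    by (intro openin_Int openin_vietoris_subset openin_Psi_Inl)
  moreover have "(\<Inter>k\<in>S. ?M k) \<inter> {F. closedin (Psi \<A>) F \<and> F \<noteq> {} \<and> F \<subseteq> ?U} = {?U}"
    using closedin_Psi_finite_Inl[OF assms(1), of \<A>] assms(2) by auto
  ultimately show ?thesis
    by simp
qed

text \<open>A different nonempty closed set has a point outside or misses some \<open>k\<close> in
  \<open>S\<close>; both are open conditions.\<close>

lemma closedin_vietoris_singleton:
  assumes "finite S" "S \<noteq> {}"
  shows "closedin (vietoris (Psi \<A>)) {Inl ` S}"
  unfolding closedin_def
proof
  let ?U = "Inl ` S :: (nat + nat set) set"
  show "{?U} \<subseteq> topspace (vietoris (Psi \<A>))"
    using closedin_Psi_finite_Inl[OF assms(1), of \<A>] assms(2) by (simp add: topspace_vietoris)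
  have op: "openin (Psi \<A>) (topspace (Psi \<A>) - Inl ` T)" if "finite T" for T
    using closedin_Psi_finite_Inl[OF that] by (simp add: closedin_def)
  have "topspace (vietoris (Psi \<A>)) - {?U} =
      {F. closedin (Psi \<A>) F \<and> F \<noteq> {} \<and> F \<inter> (topspace (Psi \<A>) - ?U) \<noteq> {}} \<union>
      (\<Union>k\<in>S. {F. closedin (Psi \<A>) F \<and> F \<noteq> {} \<and> F \<subseteq> topspace (Psi \<A>) - Inl ` {k}})"
    (is "_ = ?R")
  proof (rule set_eqI)
    fix F
    show "F \<in> topspace (vietoris (Psi \<A>)) - {?U} \<longleftrightarrow> F \<in> ?R"
    proof (cases "closedin (Psi \<A>) F \<and> F \<noteq> {}")
      case True
      then have "F \<subseteq> topspace (Psi \<A>)"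
        by (simp add: closedin_subset)
      then have "F \<in> ?R \<longleftrightarrow> \<not> F \<subseteq> ?U \<or> \<not> ?U \<subseteq> F"
        using True by blast
      then show ?thesis
        using True by (auto simp: topspace_vietoris)
    qed (auto simp: topspace_vietoris)
  qed
  also have "openin (vietoris (Psi \<A>)) \<dots>"
  proof (intro openin_Un openin_Union openin_vietoris_meets op assms)
    fix V assume "V \<in> (\<lambda>k. {F. closedin (Psi \<A>) F \<and> F \<noteq> {} \<and> F \<subseteq> topspace (Psi \<A>) - Inl ` {k}}) ` S"
    then show "openin (vietoris (Psi \<A>)) V"
      by (elim imageE, hypsubst, intro openin_vietoris_subset op) simp
  qed
  finally show "openin (vietoris (Psi \<A>)) (topspace (vietoris (Psi \<A>)) - {?U})" .
qed

text \<open>A coding of the binary tree: \<open>node x n\<close> is the restriction to \<open>n\<close> of the branch \<open>x\<close>.\<close>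
definition node :: "nat set \<Rightarrow> nat \<Rightarrow> nat" where
  "node x n = prod_encode (n, set_encode (x \<inter> {..<n}))"

lemma node_eq_iff: "node x n = node y m \<longleftrightarrow> n = m \<and> x \<inter> {..<n} = y \<inter> {..<n}"
proof -
  have "set_encode (x \<inter> {..<n}) = set_encode (y \<inter> {..<n}) \<longleftrightarrow> x \<inter> {..<n} = y \<inter> {..<n}"
    using inj_on_eq_iff[OF inj_on_set_encode] by simp
  then show ?thesis
    by (auto simp: node_def)
qed

lemma inj_node: "inj (node x)"
  by (rule injI) (simp add: node_eq_iff)

lemma finite_level: "finite (range (\<lambda>x. node x n))"
proof -
  have "range (\<lambda>x. node x n) \<subseteq> (\<lambda>s. prod_encode (n, set_encode s)) ` Pow {..<n}"
    by (auto simp: node_def)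
  then show ?thesis
    by (rule finite_subset) simp
qed

text \<open>If \<open>x\<close> and \<open>y\<close> differ at \<open>k\<close>, the branches share
  no node beyond level \<open>k\<close>.\<close>

lemma finite_branch_Int:
  assumes "x \<noteq> y"
  shows "finite (range (node x) \<inter> range (node y))"
proof -
  obtain k where k: "k \<in> x \<longleftrightarrow> k \<notin> y"
    using assms by blast
  have "n \<le> k" if "node x n = node y m" for n m
  proof (rule ccontr)
    assume "\<not> n \<le> k"
    then have "k \<in> x \<inter> {..<n} \<longleftrightarrow> k \<notin> y \<inter> {..<n}"
      using k by auto
    moreover have "x \<inter> {..<n} = y \<inter> {..<n}"
      using that unfolding node_eq_iff by (rule conjunct2)
    ultimately show False
      by metis
  qed
  then have "range (node x) \<inter> range (node y) \<subseteq> node x ` {..k}"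
    by auto
  then show ?thesis
    by (rule finite_subset) simp
qed

text \<open>The second kind is there for density: an infinite set meeting every branch finitely has
  no copy of an infinite set almost below it.\<close>

definition branch_sets :: "(nat set \<Rightarrow> nat set set) \<Rightarrow> nat set set" where
  "branch_sets D = {node x ` B | x B. B \<in> D x} \<union>
     {a. infinite a \<and> (\<forall>x. finite (a \<inter> range (node x)))}"

text \<open>A set meeting branch \<open>x\<close> infinitely is pulled back along
  \<open>node x\<close>, where density of \<open>D x\<close> applies; any other infinite set is
  itself of the second kind.\<close>

lemma ae_dense_branch_sets:
  assumes dense: "\<And>x. ae_dense (D x)"
  shows "ae_dense (branch_sets D)"
  unfolding ae_dense_def
proof (intro conjI ballI)
  have "infinite (node x ` B)" if "B \<in> D x" for x B
    using that dense[of x] inj_on_subset[OF inj_node[of x]]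
    by (auto simp: ae_dense_def infsets_def finite_image_iff)
  then show "branch_sets D \<subseteq> infsets"
    by (auto simp: branch_sets_def infsets_def)
  fix X :: "nat set" assume "X \<in> infsets"
  then have X: "infinite X" by (simp add: infsets_def)
  show "\<exists>Y\<in>branch_sets D. Y \<subseteq>\<^sup>* X"
  proof (cases "\<forall>x. finite (X \<inter> range (node x))")
    case True
    with X have "X \<in> branch_sets D"
      by (simp add: branch_sets_def)
    then show ?thesis
      using almost_subset_refl by blast
  next
    case False
    then obtain x where inf: "infinite (X \<inter> range (node x))"
      by blast
    define Z where "Z = {n. node x n \<in> X}"
    have "X \<inter> range (node x) = node x ` Z"
      by (auto simp: Z_def)
    then have "infinite Z"
      using inf by (metis finite_imageI)
    then obtain B where B: "B \<in> D x" "B \<subseteq>\<^sup>* Z"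
      using ae_denseE[OF dense] by blast
    have "node x ` B - X \<subseteq> node x ` (B - Z)"
      by (auto simp: Z_def)
    then have "node x ` B \<subseteq>\<^sup>* X"
      using B(2) unfolding almost_subset_def by (rule finite_subset[OF _ finite_imageI])
    moreover have "node x ` B \<in> branch_sets D"
      using B(1) by (auto simp: branch_sets_def)
    ultimately show ?thesis by blast
  qed
qed

text \<open>The MAD family consists of copies, inside each branch \<open>x\<close> of the binary tree, of members
  of \<open>D x\<close>, and of sets almost disjoint from all branches. An accumulation point of the sequence
  of levels of the tree must contain a member of the family inside each branch.\<close>
lemma pseudocompact_imp_forcing_axiom:
  assumes pc: "\<And>\<A>. mad_family \<A> \<Longrightarrow> pseudocompact_space (vietoris (Psi \<A>))"
  shows "forcing_axiom continuum"
  unfolding forcing_axiom_def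
proof (intro allI impI, elim conjE)
  fix \<D> :: "nat set set set"
  assume card: "|\<D>| =o continuum" and dense: "\<forall>D\<in>\<D>. ae_dense D"
  obtain D where "bij_betw D (UNIV :: nat set set) \<D>"
    using card ordIso_symmetric card_of_ordIso unfolding continuum_def by blast
  then have D: "range D = \<D>"
    by (simp add: bij_betw_def)
  have dense_D: "ae_dense (D x)" for x
    using dense D by blast
  then obtain \<A> where mad: "mad_family \<A>" and \<A>: "\<A> \<subseteq> branch_sets D"
    using ex_mad_family_dense[OF ae_dense_branch_sets[of D], of UNIV] by auto
  define F where "F n = range (\<lambda>x. node x n)" for n
  define \<Phi> where "\<Phi> n = (Inl ` F n :: (nat + nat set) set)" for n
  have F: "finite (F n)" "F n \<noteq> {}" for n
    using finite_level by (auto simp: F_def)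
  have disj: "n = m" if "k \<in> F n" "k \<in> F m" for k n m
    using that by (auto simp: F_def node_eq_iff)
  have "inj \<Phi>"
  proof (rule injI)
    fix n m assume "\<Phi> n = \<Phi> m"
    then have "F n = F m"
      by (simp add: \<Phi>_def inj_image_eq_iff)
    with F(2)[of n] disj show "n = m"
      by blast
  qed
  have "\<exists>L\<in>topspace (vietoris (Psi \<A>)). \<forall>V. openin (vietoris (Psi \<A>)) V \<and> L \<in> V \<longrightarrow>
      infinite {n. \<Phi> n \<in> V}"
    using pseudocompact_space_accumulation[OF pc[OF mad] \<open>inj \<Phi>\<close>]
      openin_vietoris_singleton[OF F] closedin_vietoris_singleton[OF F]
    by (simp add: \<Phi>_def)
  then obtain L where L: "closedin (Psi \<A>) L" "L \<noteq> {}"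
    and acc: "\<And>V. openin (vietoris (Psi \<A>)) V \<Longrightarrow> L \<in> V \<Longrightarrow> infinite {n. \<Phi> n \<in> V}"
    unfolding topspace_vietoris by blast
  \<comment> \<open>Levels are disjoint, so the open condition of containing \<open>k\<close> holds
    for at most one \<open>\<Phi> n\<close>; hence no isolated point lies in
    \<open>L\<close>.\<close>
  have L_Inr: "\<exists>a\<in>\<A>. y = Inr a" if y: "y \<in> L" for y
  proof (cases y)
    case (Inl k)
    have "infinite {n. \<Phi> n \<in> {F. closedin (Psi \<A>) F \<and> F \<noteq> {} \<and> F \<inter> Inl ` {k} \<noteq> {}}}"
      using y Inl L by (intro acc openin_vietoris_meets openin_Psi_Inl) auto
    then have "infinite {n. k \<in> F n}"
      by (rule contrapos_nn) (erule rev_finite_subset, auto simp: \<Phi>_def)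
    moreover have "{n. k \<in> F n} \<subseteq> {n}" if "k \<in> F n" for n
      using that disj by auto
    ultimately have False
      by (metis (no_types, lifting) empty_Collect_eq finite.emptyI finite.insertI finite_subset)
    then show ?thesis ..
  next
    case (Inr a)
    then show ?thesis
      using y closedin_subset[OF L(1)] by (auto simp: topspace_Psi)
  qed
  have meets_branch: "\<exists>a\<in>\<A>. Inr a \<in> L \<and> infinite (a \<inter> range (node x))" for x
  proof (rule ccontr)
    assume *: "\<not> ?thesis"
    \<comment> \<open>If the members of \<open>\<A>\<close> in \<open>L\<close> met branch
      \<open>x\<close> only finitely, deleting the branch from them would leave \<open>U\<close>
      open. But every level has a node on the branch, so no level lies inside
      \<open>U\<close>.\<close>
    define U where "U = L \<union> Inl ` (\<Union>a\<in>{a. Inr a \<in> L}. a - range (node x))"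
    have "openin (Psi \<A>) U"
      unfolding openin_Psi_iff
    proof (intro conjI allI impI)
      show "U \<subseteq> range Inl \<union> Inr ` \<A>"
        using L_Inr by (auto simp: U_def)
      fix a assume "Inr a \<in> U"
      then have a: "Inr a \<in> L"
        by (auto simp: U_def)
      then have "finite (a \<inter> range (node x))"
        using * L_Inr by blast
      moreover have "{k \<in> a. Inl k \<notin> U} \<subseteq> a \<inter> range (node x)"
        using a by (auto simp: U_def)
      ultimately show "finite {k \<in> a. Inl k \<notin> U}"
        by (rule rev_finite_subset)
    qed
    then have "infinite {n. \<Phi> n \<in> {F. closedin (Psi \<A>) F \<and> F \<noteq> {} \<and> F \<subseteq> U}}"
      using L by (intro acc openin_vietoris_subset) (auto simp: U_def)
    then obtain n where "\<Phi> n \<subseteq> U"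
      using not_finite_existsD by blast
    then have "Inl (node x n) \<in> U"
      by (auto simp: \<Phi>_def F_def)
    then show False
      using L_Inr by (auto simp: U_def)
  qed
  \<comment> \<open>The filter generated by the traces of the neighbourhoods of \<open>L\<close> on
    the level numbers; they are infinite because \<open>L\<close> is an accumulation point.\<close>
  define G where "G = {B. infinite B \<and> (\<exists>V. openin (vietoris (Psi \<A>)) V \<and> L \<in> V \<and> {n. \<Phi> n \<in> V} \<subseteq>\<^sup>* B)}"
  have "ae_filter G"
    unfolding ae_filter_def
  proof (intro conjI ballI impI)
    show "G \<subseteq> infsets"
      by (auto simp: G_def infsets_def)
    have "UNIV \<in> G"
      using L by (auto simp: G_def almost_subset_def topspace_vietoris
          intro!: exI[of _ "topspace (vietoris (Psi \<A>))"])
    then show "G \<noteq> {}"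
      by blast
  next
    fix X Y assume "X \<in> G" "Y \<in> infsets" "X \<subseteq>\<^sup>* Y"
    then show "Y \<in> G"
      by (auto simp: G_def infsets_def intro: almost_subset_trans)
  next
    fix X Y assume "X \<in> G" "Y \<in> G"
    then obtain V W where VW: "openin (vietoris (Psi \<A>)) V" "L \<in> V" "{n. \<Phi> n \<in> V} \<subseteq>\<^sup>* X"
      "openin (vietoris (Psi \<A>)) W" "L \<in> W" "{n. \<Phi> n \<in> W} \<subseteq>\<^sup>* Y"
      by (auto simp: G_def)
    define Z where "Z = {n. \<Phi> n \<in> V \<inter> W}"
    have VW': "openin (vietoris (Psi \<A>)) (V \<inter> W)" "L \<in> V \<inter> W"
      using VW by auto
    then have "infinite Z"
      unfolding Z_def by (rule acc)
    with VW' have "Z \<in> G"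
      unfolding G_def Z_def by (auto intro!: exI[of _ "V \<inter> W"])
    moreover have "Z \<subseteq>\<^sup>* X" "Z \<subseteq>\<^sup>* Y"
      using VW(3,6) by (auto simp: Z_def intro: almost_subset_trans[OF subset_almost_subset])
    ultimately show "\<exists>Z\<in>G. Z \<subseteq>\<^sup>* X \<and> Z \<subseteq>\<^sup>* Y"
      by blast
  qed
  moreover have "G \<inter> D x \<noteq> {}" for x
  proof -
    obtain a where a: "a \<in> \<A>" "Inr a \<in> L" "infinite (a \<inter> range (node x))"
      using meets_branch by blast
    \<comment> \<open>Meeting a branch infinitely, \<open>a\<close> is one of the copies; almost
      disjointness of the branches then shows that it is a copy on branch \<open>x\<close>.\<close>
    then obtain y B where B: "a = node y ` B" "B \<in> D y"
      using \<A> by (auto simp: branch_sets_def)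
    have "infinite (range (node y) \<inter> range (node x))"
      using a(3) by (rule infinite_super[rotated]) (auto simp: B)
    then have "y = x"
      using finite_branch_Int by blast
    define W :: "(nat + nat set) set" where "W = insert (Inr a) (Inl ` a)"
    define V where "V = {F. closedin (Psi \<A>) F \<and> F \<noteq> {} \<and> F \<inter> W \<noteq> {}}"
    have "openin (vietoris (Psi \<A>)) V"
      unfolding V_def W_def by (intro openin_vietoris_meets openin_Psi_insert_Inr a)
    moreover have "L \<in> V"
      using L a(2) by (auto simp: V_def W_def)
    \<comment> \<open>A node determines its level, so level \<open>n\<close> meets \<open>a\<close>
      only for \<open>n\<close> in \<open>B\<close>.\<close>
    moreover have "{n. \<Phi> n \<in> V} \<subseteq> B"
    proof
      fix n assume "n \<in> {n. \<Phi> n \<in> V}"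
      then obtain z m where "m \<in> B" "node z n = node x m"
        by (auto simp: V_def W_def \<Phi>_def F_def B \<open>y = x\<close>)
      then show "n \<in> B"
        by (simp add: node_eq_iff)
    qed
    moreover have "infinite B"
      using B(2) dense_D[of y] by (auto simp: ae_dense_def infsets_def)
    ultimately have "B \<in> G"
      by (auto simp: G_def intro: subset_almost_subset)
    with B(2) \<open>y = x\<close> show ?thesis
      by blast
  qed
  ultimately show "\<exists>G. ae_filter G \<and> (\<forall>D\<in>\<D>. G \<inter> D \<noteq> {})"
    using D by blast
qed

subsection \<open>The cardinal \<open>\<hh>\<close>\<close>

lemma ae_dense_mono: "ae_dense A \<Longrightarrow> A \<subseteq> B \<Longrightarrow> B \<subseteq> infsets \<Longrightarrow> ae_dense B"
  unfolding ae_dense_def by blast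

lemma ae_down_closed_Int: "ae_down_closed A \<Longrightarrow> ae_down_closed B \<Longrightarrow> ae_down_closed (A \<inter> B)"
  by (auto simp: ae_down_closed_def)

lemma ae_down_closed_Inter:
  assumes "\<And>D. D \<in> \<E> \<Longrightarrow> ae_down_closed D"
  shows "ae_down_closed (infsets \<inter> \<Inter>\<E>)"
  unfolding ae_down_closed_def
proof (intro ballI impI)
  fix X Y assume X: "X \<in> infsets \<inter> \<Inter>\<E>" and Y: "Y \<in> infsets" "Y \<subseteq>\<^sup>* X"
  then have "Y \<in> D" if "D \<in> \<E>" for D
    using assms[OF that] that unfolding ae_down_closed_def by blast
  with Y show "Y \<in> infsets \<inter> \<Inter>\<E>"
    by blast
qed

lemma cardinal_h_class:
  obtains \<H> where "cardinal_h = |\<H>|"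
    and "\<And>D. D \<in> \<H> \<Longrightarrow> ae_dense D" and "\<And>D. D \<in> \<H> \<Longrightarrow> ae_down_closed D"
    and "\<not> ae_dense (infsets \<inter> \<Inter>\<H>)"
    and "\<And>\<E>. (\<And>D. D \<in> \<E> \<Longrightarrow> ae_dense D) \<Longrightarrow> (\<And>D. D \<in> \<E> \<Longrightarrow> ae_down_closed D) \<Longrightarrow>
           \<not> ae_dense (infsets \<inter> \<Inter>\<E>) \<Longrightarrow> cardinal_h \<le>o |\<E>|"
    and "cardinal_h \<le>o continuum"
proof -
  define \<C> where "\<C> = {\<H>. (\<forall>D\<in>\<H>. ae_dense D \<and> ae_down_closed D) \<and> \<not> ae_dense (infsets \<inter> \<Inter>\<H>)}"
  \<comment> \<open>\<open>E X\<close> is dense because two disjoint sets cannot both almost contain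
    \<open>X\<close>, and \<open>Y\<close> is never in \<open>E Y\<close>, so the intersection of
    all \<open>E X\<close> is empty. This makes the class defining \<open>cardinal_h\<close>
    nonempty and gives the bound \<cc>.\<close>
  define E where "E X = {Y \<in> infsets. \<not> X \<subseteq>\<^sup>* Y}" for X
  have "ae_dense (E X)" if X: "X \<in> infsets" for X
    unfolding ae_dense_def
  proof (intro conjI ballI)
    fix Z :: "nat set" assume "Z \<in> infsets"
    then have "infinite Z"
      by (simp add: infsets_def)
    then obtain C :: "nat \<Rightarrow> nat set" where
      C: "pairwise (\<lambda>i j. disjnt (C i) (C j)) UNIV" "(\<Union>i. C i) \<subseteq> Z" "\<And>i. infinite (C i)"
      using infinite_infinite_partition by blast
    have "\<not> (X \<subseteq>\<^sup>* C 0 \<and> X \<subseteq>\<^sup>* C 1)"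
    proof
      assume *: "X \<subseteq>\<^sup>* C 0 \<and> X \<subseteq>\<^sup>* C 1"
      have "C 0 \<inter> C 1 = {}"
        using C(1) by (auto simp: pairwise_def disjnt_def)
      then have "X \<subseteq> (X - C 0) \<union> (X - C 1)"
        by blast
      with * have "finite X"
        unfolding almost_subset_def by (meson finite_UnI finite_subset)
      with X show False
        by (simp add: infsets_def)
    qed
    then obtain i where "\<not> X \<subseteq>\<^sup>* C i"
      by blast
    then have "C i \<in> E X"
      using C(3) by (simp add: E_def infsets_def)
    moreover have "C i \<subseteq>\<^sup>* Z"
      using C(2) by (auto intro: subset_almost_subset)
    ultimately show "\<exists>Y\<in>E X. Y \<subseteq>\<^sup>* Z"
      by blast
  qed (auto simp: E_def)
  moreover have "ae_down_closed (E X)" for X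
    using almost_subset_trans by (auto simp: ae_down_closed_def E_def)
  moreover have "infsets \<inter> \<Inter>(E ` infsets) = {}"
    using almost_subset_refl by (fastforce simp: E_def)
  then have "\<not> ae_dense (infsets \<inter> \<Inter>(E ` infsets))"
    by (auto simp: ae_dense_def infsets_def)
  ultimately have E: "E ` infsets \<in> \<C>"
    by (auto simp: \<C>_def)
  then have "\<C> \<noteq> {}"
    by blast
  then obtain \<H> where \<H>: "\<H> \<in> \<C>" "cardinal_h = |\<H>|" "\<And>\<E>. \<E> \<in> \<C> \<Longrightarrow> |\<H>| \<le>o |\<E>|"
    using least_card[of \<C>] unfolding cardinal_h_def \<C>_def[symmetric] by blast
  have "cardinal_h \<le>o |E ` infsets|"
    using \<H>(2,3) E by simp
  then have "cardinal_h \<le>o continuum"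
    using card_of_image[of E infsets] card_of_nat_sets_ordLeq_continuum[of infsets]
    by (meson ordLeq_transitive)
  with \<H> show thesis
    using that[of \<H>] by (simp add: \<C>_def)
qed

lemma Card_order_cardinal_h: "Card_order cardinal_h"
  by (rule cardinal_h_class) (erule ssubst, rule card_of_Card_order)

lemma cardinal_h_ordLeq_continuum: "cardinal_h \<le>o continuum"
  by (rule cardinal_h_class)

lemma cardinal_h_least:
  assumes "\<And>D. D \<in> \<E> \<Longrightarrow> ae_dense D" "\<And>D. D \<in> \<E> \<Longrightarrow> ae_down_closed D"
    and "\<not> ae_dense (infsets \<inter> \<Inter>\<E>)"
  shows "cardinal_h \<le>o |\<E>|"
proof (rule cardinal_h_class)
  fix \<H>
  assume "\<And>\<E>. (\<And>D. D \<in> \<E> \<Longrightarrow> ae_dense D) \<Longrightarrow> (\<And>D. D \<in> \<E> \<Longrightarrow> ae_down_closed D) \<Longrightarrow>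
    \<not> ae_dense (infsets \<inter> \<Inter>\<E>) \<Longrightarrow> cardinal_h \<le>o |\<E>|"
  from this[OF assms] show ?thesis .
qed

lemma ae_dense_Inter_less_cardinal_h:
  assumes card: "|I| <o cardinal_h"
    and D: "\<And>i. i \<in> I \<Longrightarrow> ae_dense (D i)" "\<And>i. i \<in> I \<Longrightarrow> ae_down_closed (D i)"
  shows "ae_dense (infsets \<inter> \<Inter>(D ` I))"
proof (rule ccontr)
  assume *: "\<not> ae_dense (infsets \<inter> \<Inter>(D ` I))"
  have "cardinal_h \<le>o |D ` I|"
    by (rule cardinal_h_least[OF _ _ *]) (use D in auto)
  then have "cardinal_h \<le>o |I|"
    using card_of_image ordLeq_transitive by blast
  with card show False
    by (simp add: not_ordLess_ordLeq)
qed

lemma Linear_order_cardinal_h: "Linear_order cardinal_h"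
  using Card_order_cardinal_h unfolding card_order_on_def well_order_on_def by blast

lemma cardinal_h_total:
  assumes "i \<in> Field cardinal_h" "j \<in> Field cardinal_h"
  shows "i \<in> underS cardinal_h j \<or> i = j \<or> j \<in> underS cardinal_h i"
  using assms Linear_order_cardinal_h
  unfolding order_on_defs total_on_def underS_def by blast

lemma underS_Field: "j \<in> underS r i \<Longrightarrow> j \<in> Field r"
  by (auto simp: underS_def Field_def)

text \<open>This replaces the facts that \<open>\<hh>\<close> has uncountable cofinality and no last element.\<close>
lemma countable_bounded_cardinal_h:
  assumes C: "countable C" "C \<noteq> {}" "C \<subseteq> Field cardinal_h"
  shows "\<exists>j\<in>Field cardinal_h. C \<subseteq> underS cardinal_h j"
proof (rule ccontr)
  assume *: "\<not> ?thesis"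
  obtain \<H> where \<H>: "cardinal_h = |\<H>|" "\<And>D. D \<in> \<H> \<Longrightarrow> ae_dense D"
      "\<And>D. D \<in> \<H> \<Longrightarrow> ae_down_closed D" "\<not> ae_dense (infsets \<inter> \<Inter>\<H>)"
    by (rule cardinal_h_class) (rule that; assumption)
  have Field: "Field cardinal_h = \<H>"
    by (simp add: \<H>(1) Field_card_of)
  define J where "J = from_nat_into C"
  have J: "range J = C" "J n \<in> \<H>" for n
    using C Field by (auto simp: J_def range_from_nat_into intro: from_nat_into subsetD)
  \<comment> \<open>The field of \<open>cardinal_h\<close> is \<open>\<H>\<close>, so the well-order
    lists the dense sets themselves. If \<open>C\<close> is cofinal, the sets at \<open>C\<close>
    together with the intersections of all sets before them are countably many dense sets whose
    intersection is contained in that of \<open>\<H>\<close>.\<close>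
  define E where "E m = (if even m then infsets \<inter> \<Inter>((\<lambda>D. D) ` underS cardinal_h (J (m div 2)))
     else J (m div 2))" for m :: nat
  have "ae_dense (E m)" for m
  proof -
    have "|underS cardinal_h (J (m div 2))| <o cardinal_h"
      using J(2) Field by (intro card_of_underS Card_order_cardinal_h) simp
    then have "ae_dense (infsets \<inter> \<Inter>((\<lambda>D. D) ` underS cardinal_h (J (m div 2))))"
      using \<H>(2,3) underS_Field[of _ cardinal_h] Field
      by (intro ae_dense_Inter_less_cardinal_h) auto
    then show ?thesis
      using \<H>(2) J(2) by (simp add: E_def)
  qed
  moreover have "ae_down_closed (E m)" for m
  proof -
    have "ae_down_closed (infsets \<inter> \<Inter>((\<lambda>D. D) ` underS cardinal_h (J (m div 2))))"
      using \<H>(3) underS_Field[of _ cardinal_h] Field by (intro ae_down_closed_Inter) auto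
    then show ?thesis
      using \<H>(3) J(2) by (simp add: E_def)
  qed
  ultimately have "ae_dense (infsets \<inter> \<Inter>(range E))"
    by (rule ae_dense_countable_Inter)
  moreover have "\<Inter>(range E) \<subseteq> \<Inter>\<H>"
  proof
    fix Y assume Y: "Y \<in> \<Inter>(range E)"
    show "Y \<in> \<Inter>\<H>"
    proof
      fix D assume "D \<in> \<H>"
      then obtain n where "J n \<notin> underS cardinal_h D"
        using * J(1) Field by blast
      then have "D = J n \<or> D \<in> underS cardinal_h (J n)"
        using cardinal_h_total J(2) \<open>D \<in> \<H>\<close> Field by blast
      moreover have "Y \<in> E (2 * n)" "Y \<in> E (Suc (2 * n))"
        using Y by blast+
      ultimately show "Y \<in> D"
        by (auto simp: E_def)
    qed
  qed
  then have "infsets \<inter> \<Inter>(range E) \<subseteq> infsets \<inter> \<Inter>\<H>"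
    by blast
  ultimately have "ae_dense (infsets \<inter> \<Inter>\<H>)"
    by (rule ae_dense_mono) simp
  with \<H>(4) show False by simp
qed

text \<open>Below a set witnessing that the intersection is not dense, the intersection is empty; this
  set is identified with \<open>\<omega>\<close>.\<close>
lemma cardinal_h_empty_Inter:
  obtains D where "\<And>i. i \<in> Field cardinal_h \<Longrightarrow> ae_dense (D i)"
    and "\<And>i. i \<in> Field cardinal_h \<Longrightarrow> ae_down_closed (D i)"
    and "\<And>X. infinite X \<Longrightarrow> \<exists>i\<in>Field cardinal_h. X \<notin> D i"
proof -
  obtain \<H> where \<H>: "cardinal_h = |\<H>|" "\<And>D. D \<in> \<H> \<Longrightarrow> ae_dense D"
      "\<And>D. D \<in> \<H> \<Longrightarrow> ae_down_closed D" "\<not> ae_dense (infsets \<inter> \<Inter>\<H>)"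
    by (rule cardinal_h_class) (rule that; assumption)
  have Field: "Field cardinal_h = \<H>"
    by (simp add: \<H>(1) Field_card_of)
  obtain X0 where X0: "infinite X0" "\<And>Y. infinite Y \<Longrightarrow> Y \<subseteq>\<^sup>* X0 \<Longrightarrow> \<exists>D\<in>\<H>. Y \<notin> D"
    using \<H>(4) unfolding ae_dense_def infsets_def by blast
  define \<phi> where "\<phi> = enumerate X0"
  have inj: "inj \<phi>" and ran: "range \<phi> = X0"
    using X0(1) by (simp_all add: \<phi>_def inj_enumerate range_enumerate)
  have fin_iff: "finite (\<phi> ` B) \<longleftrightarrow> finite B" for B
    using inj by (simp add: finite_image_iff inj_on_subset)
  have as_iff: "\<phi> ` A \<subseteq>\<^sup>* \<phi> ` B \<longleftrightarrow> A \<subseteq>\<^sup>* B" for A B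
    using fin_iff[of "A - B"] inj by (simp add: almost_subset_def image_set_diff)
  define D where "D i = {B. infinite B \<and> \<phi> ` B \<in> i}" for i
  show thesis
  proof (rule that[of D])
    fix i assume "i \<in> Field cardinal_h"
    then have i: "ae_dense i" "ae_down_closed i"
      using \<H>(2,3) Field by auto
    show "ae_dense (D i)"
      unfolding ae_dense_def
    proof (intro conjI ballI)
      fix X :: "nat set" assume "X \<in> infsets"
      then have "infinite (\<phi> ` X)"
        by (simp add: infsets_def fin_iff)
      then obtain Y where Y: "Y \<in> i" "infinite Y" "Y \<subseteq>\<^sup>* \<phi> ` X"
        using ae_denseE[OF i(1)] by blast
      \<comment> \<open>\<open>Y\<close> is only almost contained in the image of \<open>X\<close>;
        it is cut down to that image before being pulled back.\<close>
      define B where "B = \<phi> -` Y \<inter> X"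
      have B: "\<phi> ` B = Y \<inter> \<phi> ` X"
        by (auto simp: B_def)
      have "infinite (Y \<inter> \<phi> ` X)"
        using Y by (simp add: almost_subset_imp_infinite_Int)
      then have "infinite B"
        using B fin_iff by metis
      moreover have "\<phi> ` B \<in> i"
        using \<open>infinite (Y \<inter> \<phi> ` X)\<close> Y(1) i(2) unfolding B
        by (intro ae_down_closedD[OF i(2) Y(1)] subset_almost_subset) auto
      ultimately have "B \<in> D i"
        by (simp add: D_def)
      moreover have "B \<subseteq>\<^sup>* X"
        by (auto simp: B_def intro: subset_almost_subset)
      ultimately show "\<exists>Y\<in>D i. Y \<subseteq>\<^sup>* X"
        by blast
    qed (auto simp: D_def infsets_def)
    show "ae_down_closed (D i)"
      using ae_down_closedD[OF i(2)] by (auto simp: ae_down_closed_def D_def infsets_def as_iff fin_iff)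
  next
    fix X :: "nat set" assume X: "infinite X"
    then have "infinite (\<phi> ` X)" "\<phi> ` X \<subseteq>\<^sup>* X0"
      using ran by (auto simp: fin_iff intro: subset_almost_subset)
    then show "\<exists>i\<in>Field cardinal_h. X \<notin> D i"
      using X0(2) Field by (auto simp: D_def)
  qed
qed

subsection \<open>Refining systems of maximal antichains\<close>

text \<open>Unlike \<open>mad_family\<close> this allows finite families, so that the root level
  \<open>{UNIV}\<close> is treated like the other levels.\<close>

definition maximal_antichain :: "nat set set \<Rightarrow> bool" where
  "maximal_antichain L \<longleftrightarrow> (\<forall>a\<in>L. infinite a) \<and>
     (\<forall>a\<in>L. \<forall>b\<in>L. infinite (a \<inter> b) \<longrightarrow> a = b) \<and> (\<forall>X. infinite X \<longrightarrow> (\<exists>a\<in>L. infinite (a \<inter> X)))"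

lemma maximal_antichainD:
  assumes "maximal_antichain L"
  shows "\<And>a. a \<in> L \<Longrightarrow> infinite a"
    and "\<And>a b. a \<in> L \<Longrightarrow> b \<in> L \<Longrightarrow> infinite (a \<inter> b) \<Longrightarrow> a = b"
    and "\<And>X. infinite X \<Longrightarrow> \<exists>a\<in>L. infinite (a \<inter> X)"
  using assms unfolding maximal_antichain_def by blast+

lemma mad_family_maximal_antichain: "mad_family L \<Longrightarrow> maximal_antichain L"
  unfolding maximal_antichain_def by (intro conjI ballI allI impI) (erule mad_familyD; assumption)+

lemma maximal_antichain_UNIV: "maximal_antichain {UNIV}"
  by (simp add: maximal_antichain_def)

text \<open>Strictness separates the levels: a set cannot reappear on a later level, so its level
  index can be recovered from it.\<close>

definition strictly_below :: "nat set set \<Rightarrow> nat set set" where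
  "strictly_below L = {Y. infinite Y \<and> (\<exists>s\<in>L. Y \<subseteq>\<^sup>* s \<and> \<not> s \<subseteq>\<^sup>* Y)}"

text \<open>Splitting \<open>s \<inter> X\<close> into disjoint infinite parts leaves an infinite
  piece of \<open>s\<close> outside the chosen part.\<close>

lemma ae_dense_strictly_below:
  assumes L: "maximal_antichain L"
  shows "ae_dense (strictly_below L)"
  unfolding ae_dense_def
proof (intro conjI ballI)
  fix X :: "nat set" assume "X \<in> infsets"
  then obtain s where s: "s \<in> L" "infinite (s \<inter> X)"
    using maximal_antichainD(3)[OF L] by (auto simp: infsets_def)
  obtain C :: "nat \<Rightarrow> nat set" where
    C: "pairwise (\<lambda>i j. disjnt (C i) (C j)) UNIV" "(\<Union>i. C i) \<subseteq> s \<inter> X" "\<And>i. infinite (C i)"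
    using infinite_infinite_partition[OF s(2)] by blast
  have "C i \<subseteq> s" for i
    using C(2) by blast
  moreover have "disjnt (C 0) (C 1)"
    using C(1) by (simp add: pairwise_def)
  ultimately have "C 1 \<subseteq> s - C 0"
    by (auto simp: disjnt_def)
  then have "\<not> s \<subseteq>\<^sup>* C 0"
    using C(3)[of 1] finite_subset by (auto simp: almost_subset_def)
  moreover have "C 0 \<subseteq>\<^sup>* s" "C 0 \<subseteq>\<^sup>* X"
    using C(2) by (auto intro!: subset_almost_subset)
  ultimately show "\<exists>Y\<in>strictly_below L. Y \<subseteq>\<^sup>* X"
    using s(1) C(3) by (auto simp: strictly_below_def)
qed (auto simp: strictly_below_def infsets_def)

lemma ae_down_closed_strictly_below: "ae_down_closed (strictly_below L)"
  unfolding ae_down_closed_def strictly_below_def infsets_def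
  by (blast intro: almost_subset_trans)

text \<open>Recursion along \<hh>: at \<open>i\<close> fewer than \<hh> dense conditions have
  accumulated, so their intersection is dense and contains a MAD family with a member below
  \<open>X i\<close>. Membership in \<open>D j\<close> is imposed only on levels after
  \<open>j\<close>, since the root has to be \<open>{UNIV}\<close>. The sets \<open>X i\<close> are
  a means to make the union of the levels dense.\<close>

lemma ex_refining_system:
  assumes D: "\<And>i. i \<in> Field cardinal_h \<Longrightarrow> ae_dense (D i)"
      "\<And>i. i \<in> Field cardinal_h \<Longrightarrow> ae_down_closed (D i)"
    and X: "\<And>i. i \<in> Field cardinal_h \<Longrightarrow> infinite (X i)"
  obtains L where "\<And>i. i \<in> Field cardinal_h \<Longrightarrow> maximal_antichain (L i)"
    and "\<And>i. i \<in> Field cardinal_h \<Longrightarrow> underS cardinal_h i = {} \<Longrightarrow> L i = {UNIV}"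
    and "\<And>i. i \<in> Field cardinal_h \<Longrightarrow> underS cardinal_h i \<noteq> {} \<Longrightarrow> mad_family (L i)"
    and "\<And>i. i \<in> Field cardinal_h \<Longrightarrow> underS cardinal_h i \<noteq> {} \<Longrightarrow> \<exists>t\<in>L i. t \<subseteq>\<^sup>* X i"
    and "\<And>i j. i \<in> Field cardinal_h \<Longrightarrow> j \<in> underS cardinal_h i \<Longrightarrow> L i \<subseteq> D j"
    and "\<And>i j. i \<in> Field cardinal_h \<Longrightarrow> j \<in> underS cardinal_h i \<Longrightarrow> L i \<subseteq> strictly_below (L j)"
proof -
  define P where "P L i A \<longleftrightarrow> i \<in> Field cardinal_h \<longrightarrow>
      (if underS cardinal_h i = {} then A = {UNIV}
       else mad_family A \<and> (\<exists>t\<in>A. t \<subseteq>\<^sup>* X i) \<and>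
         A \<subseteq> infsets \<inter> \<Inter>((\<lambda>j. D j \<inter> strictly_below (L j)) ` underS cardinal_h i))" for L i A
  have max: "maximal_antichain A" if "P L i A" "i \<in> Field cardinal_h" for L i A
    using that mad_family_maximal_antichain maximal_antichain_UNIV
    by (auto simp: P_def split: if_splits)
  have "\<exists>L. \<forall>i. P L i (L i)"
  proof (rule dependent_wf_choice)
    show "wf (cardinal_h - Id)"
      using Card_order_cardinal_h unfolding card_order_on_def well_order_on_def by blast
  next
    fix L L' :: "nat set set \<Rightarrow> nat set set" and i A
    assume "\<And>j. (j, i) \<in> cardinal_h - Id \<Longrightarrow> L j = L' j"
    then have "L j = L' j" if "j \<in> underS cardinal_h i" for j
      using that by (auto simp: underS_def)
    then show "P L i A = P L' i A"
      by (simp add: P_def)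
  next
    fix i and L :: "nat set set \<Rightarrow> nat set set"
    assume IH: "\<And>j. (j, i) \<in> cardinal_h - Id \<Longrightarrow> P L j (L j)"
    show "\<exists>A. P L i A"
    proof (cases "i \<in> Field cardinal_h \<and> underS cardinal_h i \<noteq> {}")
      case True
      define E where "E j = D j \<inter> strictly_below (L j)" for j
      have j: "j \<in> Field cardinal_h" "maximal_antichain (L j)" if "j \<in> underS cardinal_h i" for j
      proof -
        show "j \<in> Field cardinal_h"
          using that by (rule underS_Field)
        then show "maximal_antichain (L j)"
          using max IH[of j] that by (auto simp: underS_def)
      qed
      have "ae_dense (E j)" if "j \<in> underS cardinal_h i" for j
      proof -
        \<comment> \<open>Two dense sets are handled as a sequence that is constant from index 1
          on.\<close>
        define F where "F n = (if n = (0::nat) then D j else strictly_below (L j))" for n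
        have "ae_dense (infsets \<inter> \<Inter>(range F))"
          using j[OF that] D ae_dense_strictly_below ae_down_closed_strictly_below
          by (intro ae_dense_countable_Inter) (auto simp: F_def)
        moreover have "infsets \<inter> \<Inter>(range F) \<subseteq> F 0 \<inter> F 1"
          by blast
        then have "infsets \<inter> \<Inter>(range F) \<subseteq> E j"
          by (simp add: E_def F_def)
        ultimately show ?thesis
          by (rule ae_dense_mono) (auto simp: E_def strictly_below_def infsets_def)
      qed
      moreover have "ae_down_closed (E j)" if "j \<in> underS cardinal_h i" for j
        unfolding E_def
        by (rule ae_down_closed_Int[OF D(2)[OF j(1)[OF that]] ae_down_closed_strictly_below])
      ultimately have "ae_dense (infsets \<inter> \<Inter>(E ` underS cardinal_h i))"
        using True by (intro ae_dense_Inter_less_cardinal_h card_of_underS Card_order_cardinal_h) auto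
      moreover have "infinite (X i)"
        using X True by simp
      ultimately obtain A where
        "mad_family A" "A \<subseteq> infsets \<inter> \<Inter>(E ` underS cardinal_h i)" "\<exists>t\<in>A. t \<subseteq>\<^sup>* X i"
        using ex_mad_family_dense[of "infsets \<inter> \<Inter>(E ` underS cardinal_h i)" "X i"] by metis
      then have "P L i A"
        unfolding P_def E_def[symmetric] using True by simp
      then show ?thesis ..
    qed (auto simp: P_def)
  qed
  then obtain L where L: "\<And>i. P L i (L i)"
    by blast
  show thesis
  proof (rule that[of L])
    show "L i \<subseteq> D j" "L i \<subseteq> strictly_below (L j)"
      if "i \<in> Field cardinal_h" "j \<in> underS cardinal_h i" for i j
    proof -
      have "underS cardinal_h i \<noteq> {}"
        using that by blast
      then show "L i \<subseteq> D j" "L i \<subseteq> strictly_below (L j)"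
        using L[of i] that by (auto simp: P_def)
    qed
  next
    show "maximal_antichain (L i)" if "i \<in> Field cardinal_h" for i
      using max L that .
  next
    show "L i = {UNIV}" if "i \<in> Field cardinal_h" "underS cardinal_h i = {}" for i
      using L[of i] that by (simp add: P_def)
  next
    show "mad_family (L i)" "\<exists>t\<in>L i. t \<subseteq>\<^sup>* X i"
      if "i \<in> Field cardinal_h" "underS cardinal_h i \<noteq> {}" for i
      using L[of i] that by (simp_all add: P_def)
  qed
qed

section \<open>Filters meeting antichains, and labellings by reals\<close>

lemma infinite_Int_common_almost_subset:
  assumes "infinite w" "w \<subseteq>\<^sup>* a" "w \<subseteq>\<^sup>* b"
  shows "infinite (a \<inter> b)"
proof -
  have "infinite (a \<inter> w)"
    using almost_subset_imp_infinite_Int[OF assms(1,2)] by (simp add: Int_commute)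
  then show ?thesis
    using assms(3) by (rule infinite_Int_almost_subset)
qed

text \<open>Members of a filter have a common infinite set almost below them; consequently a filter
  contains at most one member of a maximal antichain.\<close>

lemma ae_filter_infinite_Int:
  assumes G: "ae_filter G" and ab: "a \<in> G" "b \<in> G"
  shows "infinite (a \<inter> b)"
proof -
  obtain w where w: "w \<in> G" "w \<subseteq>\<^sup>* a" "w \<subseteq>\<^sup>* b"
    using G ab unfolding ae_filter_def by metis
  moreover have "G \<subseteq> infsets"
    using G by (simp add: ae_filter_def)
  ultimately have "infinite w"
    by (auto simp: infsets_def)
  then show ?thesis
    using w(2,3) by (rule infinite_Int_common_almost_subset)
qed

lemma ae_filter_upward:
  "ae_filter G \<Longrightarrow> a \<in> G \<Longrightarrow> infinite b \<Longrightarrow> a \<subseteq>\<^sup>* b \<Longrightarrow> b \<in> G"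
  unfolding ae_filter_def infsets_def by blast

text \<open>Greedy choice: fewer than \<open>|I|\<close> values are excluded at each step.\<close>
lemma ex_injective_choice:
  fixes M :: "'i \<Rightarrow> 'a set"
  assumes large: "\<And>i. i \<in> I \<Longrightarrow> |I| \<le>o |M i|"
  shows "\<exists>f. inj_on f I \<and> (\<forall>i\<in>I. f i \<in> M i)"
proof -
  define r where "r = |I|"
  have r: "Card_order r" "Field r = I"
    unfolding r_def by (rule card_of_Card_order) (rule Field_card_of)
  define P where "P f i z \<longleftrightarrow> i \<in> I \<longrightarrow> z \<in> M i - f ` underS r i" for f :: "'i \<Rightarrow> 'a" and i z
  have "\<exists>f. \<forall>i. P f i (f i)"
  proof (rule dependent_wf_choice)
    show "wf (r - Id)"
      using r(1) unfolding card_order_on_def well_order_on_def by blast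
  next
    fix f g :: "'i \<Rightarrow> 'a" and i z
    assume "\<And>j. (j, i) \<in> r - Id \<Longrightarrow> f j = g j"
    then have "f ` underS r i = g ` underS r i"
      by (intro image_cong) (auto simp: underS_def)
    then show "P f i z = P g i z"
      by (simp add: P_def)
  next
    fix i and f :: "'i \<Rightarrow> 'a"
    show "\<exists>z. P f i z"
    proof (cases "i \<in> I")
      case True
      have "\<not> M i \<subseteq> f ` underS r i"
      proof
        assume "M i \<subseteq> f ` underS r i"
        then have "|M i| \<le>o |underS r i|"
          using card_of_mono1 card_of_image ordLeq_transitive by blast
        then have "r \<le>o |underS r i|"
          using large[OF True] ordLeq_transitive unfolding r_def by blast
        moreover have "|underS r i| <o r"
          using r True by (simp add: card_of_underS)
        ultimately show False
          by (simp add: not_ordLess_ordLeq)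
      qed
      then show ?thesis
        by (auto simp: P_def)
    qed (simp add: P_def)
  qed
  then obtain f where f: "\<And>i. i \<in> I \<Longrightarrow> f i \<in> M i - f ` underS r i"
    unfolding P_def by blast
  have "inj_on f I"
  proof (rule inj_onI, rule ccontr)
    fix i j assume ij: "i \<in> I" "j \<in> I" "f i = f j" "i \<noteq> j"
    have "total_on I r"
      using r unfolding order_on_defs card_order_on_def by blast
    then have "i \<in> underS r j \<or> j \<in> underS r i"
      using ij unfolding total_on_def underS_def by blast
    then show False
      using f[OF ij(1)] f[OF ij(2)] ij(3) by (metis Diff_iff imageI)
  qed
  with f show ?thesis by blast
qed

text \<open>There are at most \<cc> pairs of a set \<open>X\<close> and a label, so distinct pairs
  can be given distinct elements of the respective \<open>M X\<close>; such an element carries the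
  label of its pair, all others an unspecified one.\<close>

lemma ex_labelling:
  fixes M :: "'x \<Rightarrow> 'a set"
  assumes S: "|S| \<le>o continuum" and large: "\<And>X. X \<in> S \<Longrightarrow> continuum \<le>o |M X|"
  shows "\<exists>e :: 'a \<Rightarrow> nat set. \<forall>X\<in>S. \<forall>\<xi>. \<exists>a\<in>M X. e a = \<xi>"
proof -
  define I where "I = S \<times> (UNIV :: nat set set)"
  have "|I| \<le>o |(UNIV :: nat set set) \<times> (UNIV :: nat set set)|"
    using S unfolding I_def continuum_def by (rule card_of_Times_mono1)
  also have "|(UNIV :: nat set set) \<times> (UNIV :: nat set set)| =o continuum"
    unfolding continuum_def by (rule card_of_Times_same_infinite[OF infinite_UNIV_nat_set])
  finally have "|I| \<le>o continuum" .
  then have "|I| \<le>o |M (fst i)|" if "i \<in> I" for i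
    using large[of "fst i"] that ordLeq_transitive by (auto simp: I_def)
  then obtain f where f: "inj_on f I" "\<And>i. i \<in> I \<Longrightarrow> f i \<in> M (fst i)"
    using ex_injective_choice[of I "\<lambda>i. M (fst i)"] by metis
  have "\<exists>a\<in>M X. snd (the_inv_into I f a) = \<xi>" if "X \<in> S" for X \<xi>
  proof (rule bexI[of _ "f (X, \<xi>)"])
    have "(X, \<xi>) \<in> I"
      using that by (simp add: I_def)
    then show "snd (the_inv_into I f (f (X, \<xi>))) = \<xi>" "f (X, \<xi>) \<in> M X"
      using f by (simp_all add: the_inv_into_f_f) (metis fst_conv)
  qed
  then show ?thesis
    by (intro exI[of _ "\<lambda>a. snd (the_inv_into I f a)"]) blast
qed

text \<open>Each infinite set meets two members of some level; iterating this along the binary tree uses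
  only countably many levels, and any later level separates the \<open>\<cc>\<close> many branches.\<close>
lemma large_intersection:
  assumes D: "\<And>i. i \<in> Field cardinal_h \<Longrightarrow> ae_down_closed (D i)"
      "\<And>X. infinite X \<Longrightarrow> \<exists>i\<in>Field cardinal_h. X \<notin> D i"
    and L: "\<And>i. i \<in> Field cardinal_h \<Longrightarrow> maximal_antichain (L i)"
      "\<And>i j. i \<in> Field cardinal_h \<Longrightarrow> j \<in> underS cardinal_h i \<Longrightarrow> L i \<subseteq> D j"
      "\<And>i j. i \<in> Field cardinal_h \<Longrightarrow> j \<in> underS cardinal_h i \<Longrightarrow> L i \<subseteq> strictly_below (L j)"
    and X: "infinite X"
  shows "\<exists>j\<in>Field cardinal_h. continuum \<le>o |{a \<in> L j. infinite (a \<inter> X)}|"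
proof -
  define Q where "Q Z i A B \<longleftrightarrow> i \<in> Field cardinal_h \<and> A \<in> L i \<and> B \<in> L i \<and> A \<noteq> B \<and>
    infinite (Z \<inter> A) \<and> infinite (Z \<inter> B)" for Z i A B
  have "\<exists>i A B. Q Z i A B" if Z: "infinite Z" for Z
  proof -
    obtain j where j: "j \<in> Field cardinal_h" "Z \<notin> D j"
      using D(2)[OF Z] by blast
    \<comment> \<open>Level \<open>i\<close> lies in the downward closed \<open>D j\<close>, which
      omits \<open>Z\<close>; hence \<open>Z\<close> is almost contained in no member of the level
      and meets two of them infinitely.\<close>
    obtain i where i: "i \<in> Field cardinal_h" "j \<in> underS cardinal_h i"
      using countable_bounded_cardinal_h[of "{j}"] j(1) by auto
    obtain A where A: "A \<in> L i" "infinite (A \<inter> Z)"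
      using maximal_antichainD(3)[OF L(1)[OF i(1)] Z] by blast
    have "A \<in> D j"
      using A(1) L(2)[OF i] by blast
    then have "\<not> Z \<subseteq>\<^sup>* A"
      using ae_down_closedD[OF D(1)[OF j(1)] _ Z] j(2) by blast
    then have "infinite (Z - A)"
      by (simp add: almost_subset_def)
    then obtain B where B: "B \<in> L i" "infinite (B \<inter> (Z - A))"
      using maximal_antichainD(3)[OF L(1)[OF i(1)]] by blast
    have "A \<noteq> B"
      using B(2) by (metis Diff_disjoint Int_Diff finite.emptyI Int_commute)
    moreover have "infinite (Z \<inter> B)"
      using B(2) by (rule infinite_super[rotated]) blast
    ultimately show ?thesis
      using A B(1) i(1) unfolding Q_def by (metis Int_commute)
  qed
  then obtain ind A B where "\<And>Z. infinite Z \<Longrightarrow> Q Z (ind Z) (A Z) (B Z)"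
    by metis
  then have
    ind: "\<And>Z. infinite Z \<Longrightarrow> ind Z \<in> Field cardinal_h"
    and A: "\<And>Z. infinite Z \<Longrightarrow> A Z \<in> L (ind Z)" "\<And>Z. infinite Z \<Longrightarrow> infinite (Z \<inter> A Z)"
    and B: "\<And>Z. infinite Z \<Longrightarrow> B Z \<in> L (ind Z)" "\<And>Z. infinite Z \<Longrightarrow> infinite (Z \<inter> B Z)"
    and AB: "\<And>Z. infinite Z \<Longrightarrow> A Z \<noteq> B Z"
    unfolding Q_def by blast+
  define C where "C b Z = (if b then A Z else B Z)" for b Z
  have C: "C b Z \<in> L (ind Z)" "infinite (Z \<inter> C b Z)" if "infinite Z" for b Z
    using that A B by (simp_all add: C_def)
  \<comment> \<open>At stage \<open>n\<close> the bit \<open>n \<in> x\<close> decides which of the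
    two members is intersected with the current set.\<close>
  define Z where "Z x = rec_nat X (\<lambda>n Z. Z \<inter> C (n \<in> x) Z)" for x :: "nat set"
  have Z_0: "Z x 0 = X" and Z_Suc: "Z x (Suc n) = Z x n \<inter> C (n \<in> x) (Z x n)" for x n
    by (simp_all add: Z_def)
  have Z_inf: "infinite (Z x n)" for x n
    by (induction n) (simp_all add: Z_0 Z_Suc X C(2))
  have Z_cong: "Z x n = Z y n" if "x \<inter> {..<n} = y \<inter> {..<n}" for x y n
    using that
  proof (induction n)
    case (Suc n)
    have "x \<inter> {..<n} = (x \<inter> {..<Suc n}) \<inter> {..<n}" "y \<inter> {..<n} = (y \<inter> {..<Suc n}) \<inter> {..<n}"
      by auto
    then have "Z x n = Z y n"
      using Suc by metis
    moreover have "n \<in> x \<longleftrightarrow> n \<in> x \<inter> {..<Suc n}" "n \<in> y \<longleftrightarrow> n \<in> y \<inter> {..<Suc n}"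
      by auto
    then have "n \<in> x \<longleftrightarrow> n \<in> y"
      using Suc.prems by metis
    ultimately show ?case
      by (simp add: Z_Suc)
  qed (simp add: Z_0)
  \<comment> \<open>\<open>Z x n\<close> depends only on the bits of \<open>x\<close> below
    \<open>n\<close>, so finite sets \<open>s\<close> already produce all the indices, and these are
    countably many.\<close>
  define J where "J = (\<lambda>(s, n). ind (Z s n)) ` (Collect finite \<times> UNIV)"
  have J: "ind (Z x n) \<in> J" for x n
  proof -
    have "ind (Z x n) = ind (Z (x \<inter> {..<n}) n)"
      using Z_cong[of x n "x \<inter> {..<n}"] by (simp add: Int_assoc)
    then show ?thesis
      by (auto simp: J_def)
  qed
  have "countable J"
    unfolding J_def by (intro countable_image countable_SIGMA countable_Collect_finite) auto
  moreover have "J \<noteq> {}"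
    using J by blast
  moreover have "J \<subseteq> Field cardinal_h"
    using ind Z_inf by (auto simp: J_def)
  ultimately obtain j where j: "j \<in> Field cardinal_h" "J \<subseteq> underS cardinal_h j"
    using countable_bounded_cardinal_h by blast
  have "\<exists>Y. infinite Y \<and> (\<forall>n. Y \<subseteq>\<^sup>* Z x n)" for x
    using Z_inf by (intro pseudo_intersection subset_almost_subset) (auto simp: Z_Suc)
  then obtain Y where Y: "\<And>x. infinite (Y x)" "\<And>x n. Y x \<subseteq>\<^sup>* Z x n"
    by metis
  obtain a where a: "\<And>x. a x \<in> L j" "\<And>x. infinite (a x \<inter> Y x)"
    using maximal_antichainD(3)[OF L(1)[OF j(1)] Y(1)] by metis
  have a_C: "infinite (a x \<inter> C (n \<in> x) (Z x n))" for x n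
  proof -
    have "Z x (Suc n) \<subseteq>\<^sup>* C (n \<in> x) (Z x n)"
      by (rule subset_almost_subset) (simp add: Z_Suc)
    then have "Y x \<subseteq>\<^sup>* C (n \<in> x) (Z x n)"
      using Y(2) almost_subset_trans by blast
    then show ?thesis
      using infinite_Int_almost_subset[OF a(2)] by blast
  qed
  have "inj a"
  proof (rule injI, rule ccontr)
    fix x y assume eq: "a x = a y" and "x \<noteq> y"
    then have ex: "\<exists>n. (n \<in> x) \<noteq> (n \<in> y)"
      by blast
    define n where "n = (LEAST n. (n \<in> x) \<noteq> (n \<in> y))"
    have n: "(n \<in> x) \<noteq> (n \<in> y)"
      unfolding n_def using ex by (rule LeastI_ex)
    have "m \<in> x \<longleftrightarrow> m \<in> y" if "m < n" for m
      using not_less_Least[of m "\<lambda>n. (n \<in> x) \<noteq> (n \<in> y)"] that by (simp add: n_def)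
    then have Zxy: "Z x n = Z y n"
      by (intro Z_cong) auto
    \<comment> \<open>At the first difference \<open>n\<close> both branches split the same set but
      choose different members of level \<open>i\<close>. The common \<open>a x\<close> lies below a
      single member of that level, which would have to equal both.\<close>
    define i where "i = ind (Z x n)"
    have i: "i \<in> Field cardinal_h" "i \<in> underS cardinal_h j"
      using ind Z_inf J j(2) by (auto simp: i_def)
    obtain s where s: "s \<in> L i" "a x \<subseteq>\<^sup>* s"
      using L(3)[OF j(1) i(2)] a(1) by (auto simp: strictly_below_def)
    have "s = C (n \<in> z) (Z x n)" if "infinite (a x \<inter> C (n \<in> z) (Z x n))" for z
    proof (rule maximal_antichainD(2)[OF L(1)[OF i(1)]])
      show "infinite (s \<inter> C (n \<in> z) (Z x n))"
        using infinite_Int_almost_subset s(2) that by (metis Int_commute)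
    qed (use s C(1)[OF Z_inf] in \<open>simp_all add: i_def\<close>)
    then have "C (n \<in> x) (Z x n) = C (n \<in> y) (Z x n)"
      using a_C[of x n] a_C[of y n] eq Zxy by metis
    then show False
      using n AB[OF Z_inf[of x n]] by (auto simp: C_def split: if_splits)
  qed
  moreover have "a x \<in> {a \<in> L j. infinite (a \<inter> X)}" for x
    using a(1) infinite_Int_almost_subset[OF a(2)] Y(2)[of x 0] by (simp add: Z_0)
  ultimately have "continuum \<le>o |{a \<in> L j. infinite (a \<inter> X)}|"
    unfolding continuum_def by (rule card_of_ordLeqI)
  with j(1) show ?thesis by blast
qed

text \<open>A filter meeting all the sets of the \<open>\<xi>\<close>-labelled refinements picks one member from each of
  the levels, and their labels exhaust a set of size \<open>\<cc>\<close>.\<close>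
lemma forcing_axiom_imp_cardinal_h:
  assumes FA: "forcing_axiom continuum"
  shows "cardinal_h =o continuum"
proof -
  obtain D where D: "\<And>i. i \<in> Field cardinal_h \<Longrightarrow> ae_dense (D i)"
      "\<And>i. i \<in> Field cardinal_h \<Longrightarrow> ae_down_closed (D i)"
      "\<And>X. infinite X \<Longrightarrow> \<exists>i\<in>Field cardinal_h. X \<notin> D i"
    using cardinal_h_empty_Inter by metis
  obtain L where L: "\<And>i. i \<in> Field cardinal_h \<Longrightarrow> maximal_antichain (L i)"
    and LD: "\<And>i j. i \<in> Field cardinal_h \<Longrightarrow> j \<in> underS cardinal_h i \<Longrightarrow> L i \<subseteq> D j"
      "\<And>i j. i \<in> Field cardinal_h \<Longrightarrow> j \<in> underS cardinal_h i \<Longrightarrow> L i \<subseteq> strictly_below (L j)"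
    by (rule ex_refining_system[of D "\<lambda>_. UNIV"];
      (erule D(1) | erule D(2) | rule infinite_UNIV_nat | (rule that; assumption)))
  define M where "M j X = {a \<in> L j. infinite (a \<inter> X)}" for j X
  define S where "S j = {X. infinite X \<and> continuum \<le>o |M j X|}" for j
  have "\<exists>e :: nat set \<Rightarrow> nat set. \<forall>X\<in>S j. \<forall>\<xi>. \<exists>a\<in>M j X. e a = \<xi>" for j
    by (rule ex_labelling[OF card_of_nat_sets_ordLeq_continuum]) (simp add: S_def)
  then obtain e :: "nat set set \<Rightarrow> nat set \<Rightarrow> nat set"
    where e: "\<And>j X \<xi>. X \<in> S j \<Longrightarrow> \<exists>a\<in>M j X. e j a = \<xi>"
    by metis
  define E where "E \<xi> = {Y. infinite Y \<and> (\<exists>j\<in>Field cardinal_h. \<exists>a\<in>L j. e j a = \<xi> \<and> Y \<subseteq>\<^sup>* a)}" for \<xi>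
  have "ae_dense (E \<xi>)" for \<xi>
    unfolding ae_dense_def
  proof (intro conjI ballI)
    fix X :: "nat set" assume "X \<in> infsets"
    then have X: "infinite X"
      by (simp add: infsets_def)
    have "\<exists>j\<in>Field cardinal_h. continuum \<le>o |M j X|"
      unfolding M_def using D(2,3) L LD X by (rule large_intersection)
    then obtain j where j: "j \<in> Field cardinal_h" "X \<in> S j"
      using X by (auto simp: S_def)
    then obtain a where a: "a \<in> L j" "infinite (a \<inter> X)" "e j a = \<xi>"
      using e[OF j(2), of \<xi>] by (auto simp: M_def)
    then have "a \<inter> X \<in> E \<xi>"
      using j(1) by (auto simp: E_def intro!: bexI[of _ j] bexI[of _ a] subset_almost_subset)
    then show "\<exists>Y\<in>E \<xi>. Y \<subseteq>\<^sup>* X"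
      by (intro bexI[of _ "a \<inter> X"] subset_almost_subset) auto
  qed (auto simp: E_def infsets_def)
  then obtain G where G: "ae_filter G" "\<And>\<xi>. G \<inter> E \<xi> \<noteq> {}"
    using forcing_axiom_indexed[OF FA card_of_nat_sets_ordLeq_continuum[of UNIV], of E] by auto
  \<comment> \<open>The label of the only member of level \<open>j\<close> in \<open>G\<close>; an
    arbitrary value if \<open>G\<close> misses that level.\<close>
  define h where "h j = e j (SOME a. a \<in> L j \<inter> G)" for j
  have "\<xi> \<in> h ` Field cardinal_h" for \<xi>
  proof -
    obtain Y j a where Y: "Y \<in> G" "j \<in> Field cardinal_h" "a \<in> L j" "e j a = \<xi>" "Y \<subseteq>\<^sup>* a"
      using G(2)[of \<xi>] by (auto simp: E_def)
    have "infinite a"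
      using maximal_antichainD(1)[OF L[OF Y(2)] Y(3)] .
    then have aG: "a \<in> L j \<inter> G"
      using ae_filter_upward[OF G(1) Y(1)] Y(3,5) by blast
    have uniq: "b = a" if b: "b \<in> L j \<inter> G" for b
    proof -
      have "infinite (b \<inter> a)"
        using ae_filter_infinite_Int[OF G(1)] aG b by blast
      then show ?thesis
        using maximal_antichainD(2)[OF L[OF Y(2)]] b aG by blast
    qed
    have "(SOME a. a \<in> L j \<inter> G) = a"
      using aG uniq by (rule some_equality)
    then have "h j = \<xi>"
      using Y(4) by (simp add: h_def)
    with Y(2) show ?thesis
      by blast
  qed
  then have "h ` Field cardinal_h = UNIV"
    by blast
  then have "|UNIV :: nat set set| \<le>o |Field cardinal_h|"
    using card_of_image[of h "Field cardinal_h"] by simp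
  then have "continuum \<le>o cardinal_h"
    using card_of_Field_ordIso[OF Card_order_cardinal_h] ordLeq_ordIso_trans
    unfolding continuum_def by blast
  with cardinal_h_ordLeq_continuum show ?thesis
    by (simp add: ordIso_iff_ordLeq)
qed

section \<open>Ordinals below \<hh> as initial segments\<close>

text \<open>The link between two indexings: levels of a tree are given by order types, levels of a
  refining system by elements of the field of \<hh>.\<close>

definition initial_segment :: "'a rel \<Rightarrow> 'a \<Rightarrow> 'a rel" where
  "initial_segment r i = Restr r (underS r i)"

lemma Well_order_cardinal_h: "Well_order cardinal_h"
  using Card_order_cardinal_h by (simp add: card_order_on_well_order_on)

lemma initial_segment_ordLess:
  assumes "Well_order r" "i \<in> underS r j"
  shows "initial_segment r i <o initial_segment r j"
proof -
  have wo: "wo_rel r"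
    using assms(1) by (simp add: wo_rel_def)
  have "trans r" "antisym r"
    using assms(1) unfolding order_on_defs by blast+
  then have "underS r i \<subset> underS r j"
    using assms(2) unfolding underS_def by (auto dest: transD antisymD)
  moreover have "wo_rel.ofilter r (underS r i)" "wo_rel.ofilter r (underS r j)"
    by (rule wo_rel.underS_ofilter[OF wo])+
  ultimately show ?thesis
    using ofilter_subset_ordLess[OF assms(1)] unfolding initial_segment_def by blast
qed

lemma initial_segment_ordIso_imp_eq:
  fixes \<alpha> :: "'b rel"
  assumes "i \<in> Field cardinal_h" "j \<in> Field cardinal_h"
    and "initial_segment cardinal_h i =o \<alpha>" "initial_segment cardinal_h j =o \<alpha>"
  shows "i = j"
proof (rule ccontr)
  assume "i \<noteq> j"
  then have "initial_segment cardinal_h i <o initial_segment cardinal_h j \<or>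
             initial_segment cardinal_h j <o initial_segment cardinal_h i"
    using cardinal_h_total[OF assms(1,2)] initial_segment_ordLess[OF Well_order_cardinal_h] by blast
  moreover have "initial_segment cardinal_h i =o initial_segment cardinal_h j"
    using assms(3,4) ordIso_symmetric ordIso_transitive by blast
  ultimately show False
    using not_ordLess_ordIso ordIso_symmetric by blast
qed

lemma ordLess_cardinal_h_iff:
  "\<alpha> <o cardinal_h \<longleftrightarrow> (\<exists>i\<in>Field cardinal_h. \<alpha> =o initial_segment cardinal_h i)" if "Well_order \<alpha>"
  unfolding initial_segment_def by (rule ordLess_iff_ordIso_Restr[OF Well_order_cardinal_h that])

lemma initial_segment_cardinal_h_ordLess:
  "i \<in> Field cardinal_h \<Longrightarrow> initial_segment cardinal_h i <o cardinal_h"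
  unfolding initial_segment_def by (rule underS_Restr_ordLess[OF Well_order_cardinal_h]) blast

lemma initial_segment_eq_empty_iff:
  "initial_segment cardinal_h i = {} \<longleftrightarrow> underS cardinal_h i = {}"
proof
  assume empty: "initial_segment cardinal_h i = {}"
  have "refl_on (Field cardinal_h) cardinal_h"
    using Linear_order_cardinal_h unfolding order_on_defs by blast
  then have "(j, j) \<in> initial_segment cardinal_h i" if "j \<in> underS cardinal_h i" for j
    using that underS_Field[OF that] by (auto simp: initial_segment_def refl_on_def)
  with empty show "underS cardinal_h i = {}"
    by blast
qed (simp add: initial_segment_def)

lemma ordIso_empty_imp_empty:
  fixes \<alpha> :: "'a rel"
  assumes "\<alpha> =o ({} :: 'b rel)"
  shows "\<alpha> = {}"
proof -
  obtain f where "bij_betw f (Field \<alpha>) (Field ({} :: 'b rel))"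
    using assms by (auto simp: ordIso_def iso_def)
  then have "Field \<alpha> = {}"
    by (simp add: bij_betw_def)
  then show ?thesis
    by (auto simp: Field_def)
qed

text \<open>Lets the level of a predecessor \<open>s\<close> be computed inside the predecessors of
  \<open>t\<close>.\<close>

lemma Restr_Restr_underS:
  assumes r: "trans r" "antisym r" and s: "s \<in> underS r t"
  shows "Restr (Restr r (underS r t)) (underS (Restr r (underS r t)) s) = Restr r (underS r s)"
proof -
  have "underS (Restr r (underS r t)) s = underS r s"
    using r s by (auto simp: underS_def dest: transD antisymD)
  moreover have "underS r s \<subseteq> underS r t"
    using r s by (auto simp: underS_def dest: transD antisymD)
  ultimately show ?thesis
    by auto
qed

subsection \<open>From the forcing axiom to long branches\<close>

text \<open>Choosing one node per level yields only a chain, whereas a branch has to be maximal;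
  Zorn enlarges it.\<close>

lemma maxchain_extends:
  assumes "pred_on.chain T P b0"
  shows "\<exists>b. b0 \<subseteq> b \<and> pred_on.maxchain T P b"
proof -
  define \<S> where "\<S> = {b. b0 \<subseteq> b \<and> pred_on.chain T P b}"
  have "\<exists>b\<in>\<S>. \<forall>c\<in>\<S>. b \<subseteq> c \<longrightarrow> c = b"
  proof (rule subset_Zorn_nonempty)
    show "\<S> \<noteq> {}"
      using assms by (auto simp: \<S>_def)
    fix \<C> assume \<C>: "\<C> \<noteq> {}" "subset.chain \<S> \<C>"
    have sub: "\<C> \<subseteq> \<S>"
      using \<C>(2) by (simp add: subset.chain_def)
    have "P\<^sup>=\<^sup>= x y \<or> P\<^sup>=\<^sup>= y x" if xy: "x \<in> \<Union>\<C>" "y \<in> \<Union>\<C>" for x y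
    proof -
      obtain c d where cd: "c \<in> \<C>" "x \<in> c" "d \<in> \<C>" "y \<in> d"
        using xy by blast
      then have "c \<subseteq> d \<or> d \<subseteq> c"
        using \<C>(2) unfolding subset.chain_def by blast
      then obtain e where "e \<in> \<C>" "x \<in> e" "y \<in> e"
        using cd by blast
      then have "pred_on.chain T P e" "x \<in> e" "y \<in> e"
        using sub by (auto simp: \<S>_def)
      then show ?thesis
        unfolding pred_on.chain_def by blast
    qed
    moreover have "\<Union>\<C> \<subseteq> T"
    proof (rule Union_least)
      fix c assume "c \<in> \<C>"
      then have "pred_on.chain T P c"
        using sub by (auto simp: \<S>_def)
      then show "c \<subseteq> T"
        by (simp add: pred_on.chain_def)
    qed
    moreover have "b0 \<subseteq> \<Union>\<C>"
      using \<C>(1) sub by (auto simp: \<S>_def)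
    ultimately show "\<Union>\<C> \<in> \<S>"
      by (simp add: \<S>_def pred_on.chain_def)
  qed
  then obtain b where b: "b \<in> \<S>" "\<And>c. c \<in> \<S> \<Longrightarrow> b \<subseteq> c \<Longrightarrow> c = b"
    by blast
  have "pred_on.maxchain T P b"
    unfolding pred_on.maxchain_def
  proof (intro conjI notI)
    show "pred_on.chain T P b"
      using b(1) by (simp add: \<S>_def)
    assume "\<exists>c. pred_on.chain T P c \<and> b \<subset> c"
    then obtain c where "pred_on.chain T P c" "b \<subset> c"
      by blast
    then have "c \<in> \<S>" "b \<subset> c"
      using b(1) by (auto simp: \<S>_def)
    with b(2) show False
      by blast
  qed
  with b(1) show ?thesis
    by (auto simp: \<S>_def)
qed

text \<open>The sets below some node of a given level are dense, so a filter picks one node on each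
  of the \<hh> levels, and \<hh> = \<cc>. The picked nodes form a chain: the predecessor on level
  \<open>i\<close> of a later picked node is in the filter as well, hence is the picked one.\<close>

lemma forcing_axiom_imp_branch:
  assumes FA: "forcing_axiom continuum" and T: "base_tree T"
  shows "\<exists>b. branch T b \<and> |b| =o continuum"
proof -
  let ?r = "ae_order T"
  have h: "cardinal_h =o continuum"
    using FA by (rule forcing_axiom_imp_cardinal_h)
  have po: "trans ?r" "antisym ?r"
    using T unfolding base_tree_def tree_order_def order_on_defs by blast+
  have TI: "T \<subseteq> infsets"
    using T by (simp add: base_tree_def)
  have FT: "Field ?r \<subseteq> T"
    by (auto simp: Field_def ae_order_def)
  define L where "L i = tree_level ?r (initial_segment cardinal_h i)" for i
  have LT: "L i \<subseteq> T" for i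
    using FT by (auto simp: L_def tree_level_def)
  have L: "maximal_antichain (L i)" if i: "i \<in> Field cardinal_h" for i
  proof (cases "underS cardinal_h i = {}")
    case True
    then have "L i = {UNIV}"
      using T by (simp add: L_def initial_segment_def base_tree_def)
    then show ?thesis
      using maximal_antichain_UNIV by simp
  next
    case False
    then have "initial_segment cardinal_h i \<noteq> {}"
      by (simp add: initial_segment_eq_empty_iff)
    then have "mad_family (L i)"
      using T initial_segment_cardinal_h_ordLess[OF i] unfolding base_tree_def L_def by blast
    then show ?thesis
      by (rule mad_family_maximal_antichain)
  qed
  define D where "D i = {Y. infinite Y \<and> (\<exists>t\<in>L i. Y \<subseteq>\<^sup>* t)}" for i
  have "ae_dense (D i)" if i: "i \<in> Field cardinal_h" for i
    unfolding ae_dense_def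
  proof (intro conjI ballI)
    fix X :: "nat set" assume "X \<in> infsets"
    then obtain t where "t \<in> L i" "infinite (t \<inter> X)"
      using maximal_antichainD(3)[OF L[OF i]] by (auto simp: infsets_def)
    moreover have "t \<inter> X \<subseteq>\<^sup>* t" "t \<inter> X \<subseteq>\<^sup>* X"
      by (simp_all add: subset_almost_subset)
    ultimately show "\<exists>Y\<in>D i. Y \<subseteq>\<^sup>* X"
      unfolding D_def by blast
  qed (auto simp: D_def infsets_def)
  moreover have "|Field cardinal_h| \<le>o continuum"
    using card_of_Field_ordIso[OF Card_order_cardinal_h] cardinal_h_ordLeq_continuum
    by (rule ordIso_ordLeq_trans)
  ultimately obtain G where G: "ae_filter G" "\<And>i. i \<in> Field cardinal_h \<Longrightarrow> G \<inter> D i \<noteq> {}"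
    using forcing_axiom_indexed[OF FA, of "Field cardinal_h" D] by blast
  have "\<exists>t. t \<in> L i \<inter> G" if i: "i \<in> Field cardinal_h" for i
  proof -
    obtain Y t where "Y \<in> G" "t \<in> L i" "Y \<subseteq>\<^sup>* t"
      using G(2)[OF i] by (auto simp: D_def)
    then show ?thesis
      using ae_filter_upward[OF G(1)] maximal_antichainD(1)[OF L[OF i]] by blast
  qed
  then obtain t where t: "\<And>i. i \<in> Field cardinal_h \<Longrightarrow> t i \<in> L i" "\<And>i. i \<in> Field cardinal_h \<Longrightarrow> t i \<in> G"
    by (metis IntE)
  have below: "t j \<subseteq>\<^sup>* t i" if ij: "j \<in> Field cardinal_h" "i \<in> underS cardinal_h j" for i j
  proof -
    have i: "i \<in> Field cardinal_h"
      using ij(2) by (rule underS_Field)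
    have iso: "Restr ?r (underS ?r (t j)) =o initial_segment cardinal_h j"
      using t(1)[OF ij(1)] by (simp add: L_def tree_level_def)
    \<comment> \<open>The order type belonging to \<open>i\<close> is smaller than that of the
      predecessors of \<open>t j\<close>, so some predecessor \<open>s\<close> sits exactly on level
      \<open>i\<close>.\<close>
    have "initial_segment cardinal_h i <o Restr ?r (underS ?r (t j))"
      using initial_segment_ordLess[OF Well_order_cardinal_h ij(2)] iso ordIso_symmetric
        ordLess_ordIso_trans by blast
    moreover then have "Well_order (Restr ?r (underS ?r (t j)))" "Well_order (initial_segment cardinal_h i)"
      by (auto simp: ordLess_def)
    ultimately obtain s where s: "s \<in> Field (Restr ?r (underS ?r (t j)))"
      "initial_segment cardinal_h i =o
         Restr (Restr ?r (underS ?r (t j))) (underS (Restr ?r (underS ?r (t j))) s)"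
      using ordLess_iff_ordIso_Restr by blast
    have su: "s \<in> underS ?r (t j)"
      using s(1) by (auto simp: Field_def)
    have "Restr ?r (underS ?r s) =o initial_segment cardinal_h i"
      using s(2) unfolding Restr_Restr_underS[OF po su] by (rule ordIso_symmetric)
    then have sL: "s \<in> L i"
      using underS_Field[OF su] by (simp add: L_def tree_level_def)
    have ts: "t j \<subseteq>\<^sup>* s"
      using su by (simp add: underS_def ae_order_def)
    then have "s \<in> G"
      using ae_filter_upward[OF G(1) t(2)[OF ij(1)]] maximal_antichainD(1)[OF L[OF i] sL] by blast
    then have "s = t i"
      using maximal_antichainD(2)[OF L[OF i] sL t(1)[OF i]]
        ae_filter_infinite_Int[OF G(1) _ t(2)[OF i]] by blast
    with ts show ?thesis by simp
  qed
  define b0 where "b0 = t ` Field cardinal_h"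
  have "pred_on.chain T (\<lambda>s t. t \<subseteq>\<^sup>* s) b0"
    unfolding pred_on.chain_def b0_def
  proof (intro conjI ballI)
    show "t ` Field cardinal_h \<subseteq> T"
      using t(1) LT by blast
    fix x y assume "x \<in> t ` Field cardinal_h" "y \<in> t ` Field cardinal_h"
    then obtain i j where "i \<in> Field cardinal_h" "x = t i" "j \<in> Field cardinal_h" "y = t j"
      by blast
    then show "(\<lambda>s t. t \<subseteq>\<^sup>* s)\<^sup>=\<^sup>= x y \<or> (\<lambda>s t. t \<subseteq>\<^sup>* s)\<^sup>=\<^sup>= y x"
      using cardinal_h_total below by blast
  qed
  then obtain b where b: "b0 \<subseteq> b" "pred_on.maxchain T (\<lambda>s t. t \<subseteq>\<^sup>* s) b"
    using maxchain_extends by blast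
  have "inj_on t (Field cardinal_h)"
  proof (rule inj_onI)
    fix i j assume "i \<in> Field cardinal_h" "j \<in> Field cardinal_h" "t i = t j"
    with t(1)[of i] t(1)[of j] show "i = j"
      by (intro initial_segment_ordIso_imp_eq[of i j "Restr ?r (underS ?r (t j))"])
        (auto simp: L_def tree_level_def intro: ordIso_symmetric)
  qed
  then have "|Field cardinal_h| \<le>o |b|"
    using b(1) by (intro card_of_ordLeqI[of t]) (auto simp: b0_def)
  moreover have "continuum =o |Field cardinal_h|"
    using h card_of_Field_ordIso[OF Card_order_cardinal_h] ordIso_symmetric ordIso_transitive by blast
  ultimately have "continuum \<le>o |b|"
    using ordIso_ordLeq_trans by blast
  then have "|b| =o continuum"
    using card_of_nat_sets_ordLeq_continuum by (simp add: ordIso_iff_ordLeq)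
  with b(2) show ?thesis
    by (auto simp: branch_def)
qed

section \<open>The tree of a refining system\<close>

locale refining_system =
  fixes L :: "nat set set \<Rightarrow> nat set set" and T :: "nat set set"
  assumes antichain: "\<And>i. i \<in> Field cardinal_h \<Longrightarrow> maximal_antichain (L i)"
    and refines: "\<And>i j. i \<in> Field cardinal_h \<Longrightarrow> j \<in> underS cardinal_h i \<Longrightarrow> L i \<subseteq> strictly_below (L j)"
  defines "T \<equiv> \<Union>i\<in>Field cardinal_h. L i"
begin

lemma mem_T: "t \<in> T \<longleftrightarrow> (\<exists>i\<in>Field cardinal_h. t \<in> L i)"
  by (simp add: T_def)

text \<open>\<open>t\<close> lies strictly below some \<open>s'\<close> on the level of
  \<open>s\<close>. If \<open>s\<close> were almost contained in \<open>t\<close>, then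
  \<open>s\<close> and \<open>s'\<close> would meet infinitely and coincide, against
  strictness.\<close>

lemma not_below:
  assumes "j \<in> Field cardinal_h" "i \<in> underS cardinal_h j" "s \<in> L i" "t \<in> L j"
  shows "\<not> s \<subseteq>\<^sup>* t"
proof
  assume st: "s \<subseteq>\<^sup>* t"
  have i: "i \<in> Field cardinal_h"
    using assms(2) by (rule underS_Field)
  obtain s' where s': "s' \<in> L i" "t \<subseteq>\<^sup>* s'" "\<not> s' \<subseteq>\<^sup>* t"
    using refines[OF assms(1,2)] assms(4) by (auto simp: strictly_below_def)
  have "infinite (s \<inter> s')"
    using maximal_antichainD(1)[OF antichain[OF i] assms(3)] almost_subset_trans[OF st s'(2)]
    by (rule almost_subset_imp_infinite_Int)
  then have "s = s'"
    by (rule maximal_antichainD(2)[OF antichain[OF i] assms(3) s'(1)])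
  with s'(3) st show False by simp
qed

lemma same_level:
  assumes "i \<in> Field cardinal_h" "s \<in> L i" "t \<in> L i" "t \<subseteq>\<^sup>* s"
  shows "s = t"
proof -
  have "infinite (t \<inter> s)"
    using maximal_antichainD(1)[OF antichain] assms almost_subset_imp_infinite_Int by blast
  then show ?thesis
    using maximal_antichainD(2)[OF antichain] assms by blast
qed

text \<open>Comparable sets on one level are equal, and an inverted order of levels is excluded by
  \<open>not_below\<close>.\<close>

lemma strictly_above_iff:
  assumes i: "i \<in> Field cardinal_h" "s \<in> L i" and j: "j \<in> Field cardinal_h" "t \<in> L j"
  shows "t \<subseteq>\<^sup>* s \<and> s \<noteq> t \<longleftrightarrow> t \<subseteq>\<^sup>* s \<and> i \<in> underS cardinal_h j"
proof (cases "t \<subseteq>\<^sup>* s")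
  case True
  consider "i \<in> underS cardinal_h j" | "i = j" | "j \<in> underS cardinal_h i"
    using cardinal_h_total i(1) j(1) by blast
  then show ?thesis
  proof cases
    case 1
    then show ?thesis
      using not_below[OF j(1) 1 i(2) j(2)] almost_subset_refl by auto
  next
    case 2
    then have "s = t"
      using same_level[OF i] j True by simp
    then show ?thesis
      using 2 by (auto simp: underS_def)
  next
    case 3
    then show ?thesis
      using not_below[OF i(1) 3 j(2) i(2)] True by simp
  qed
qed simp

lemma level_unique:
  assumes "i \<in> Field cardinal_h" "t \<in> L i" "j \<in> Field cardinal_h" "t \<in> L j"
  shows "i = j"
  using strictly_above_iff[OF assms] strictly_above_iff[OF assms(3,4,1,2)] assms
    cardinal_h_total[of i j] by auto

lemma ex_predecessor:
  assumes "j \<in> Field cardinal_h" "i \<in> underS cardinal_h j" "t \<in> L j"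
  shows "\<exists>s\<in>L i. t \<subseteq>\<^sup>* s"
  using refines[OF assms(1,2)] assms(3) by (auto simp: strictly_below_def)

lemma unique_predecessor:
  assumes "i \<in> Field cardinal_h" "s \<in> L i" "s' \<in> L i" "infinite t" "t \<subseteq>\<^sup>* s" "t \<subseteq>\<^sup>* s'"
  shows "s = s'"
  using infinite_Int_common_almost_subset[OF assms(4-6)]
  by (rule maximal_antichainD(2)[OF antichain[OF assms(1)] assms(2,3)])

lemma T_infinite: "t \<in> T \<Longrightarrow> infinite t"
  using maximal_antichainD(1)[OF antichain] by (auto simp: mem_T)

lemma antisym_T:
  assumes "s \<in> T" "t \<in> T" "t \<subseteq>\<^sup>* s" "s \<subseteq>\<^sup>* t"
  shows "s = t"
proof (rule ccontr)
  assume "s \<noteq> t"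
  obtain i j where "i \<in> Field cardinal_h" "s \<in> L i" "j \<in> Field cardinal_h" "t \<in> L j"
    using assms by (auto simp: mem_T)
  with \<open>s \<noteq> t\<close> assms(3,4) not_below[of j i s t] strictly_above_iff[of i s j t] show False
    by blast
qed

lemma partial_order_T: "partial_order_on T (ae_order T)"
  unfolding order_on_defs
proof (intro conjI)
  show "trans (ae_order T)"
    by (rule transI) (auto simp: ae_order_def intro: almost_subset_trans)
  show "antisym (ae_order T)"
    unfolding antisym_def ae_order_def using antisym_T by blast
qed (auto simp: ae_order_def refl_on_def)

text \<open>Sending \<open>i\<close> to the unique member of level \<open>i\<close> above
  \<open>t\<close> is an order isomorphism onto the predecessors of \<open>t\<close>; this
  identifies the levels of the tree with the \<open>L j\<close>.\<close>

lemma predecessors_ordIso: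
  assumes j: "j \<in> Field cardinal_h" "t \<in> L j"
  shows "initial_segment cardinal_h j =o Restr (ae_order T) (underS (ae_order T) t)"
proof -
  let ?U = "underS cardinal_h j"
  have tT: "t \<in> T"
    using j by (auto simp: mem_T)
  obtain pr where pr: "\<And>i. i \<in> ?U \<Longrightarrow> pr i \<in> L i" "\<And>i. i \<in> ?U \<Longrightarrow> t \<subseteq>\<^sup>* pr i"
    using ex_predecessor[OF j(1) _ j(2)] by metis
  have UF: "i \<in> Field cardinal_h" if "i \<in> ?U" for i
    using that by (rule underS_Field)
  have under: "s \<in> underS (ae_order T) t \<longleftrightarrow> (\<exists>i\<in>?U. s = pr i)" for s
  proof
    assume "s \<in> underS (ae_order T) t"
    then have s: "s \<in> T" "t \<subseteq>\<^sup>* s" "s \<noteq> t"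
      by (auto simp: underS_def ae_order_def)
    then obtain i where i: "i \<in> Field cardinal_h" "s \<in> L i"
      by (auto simp: mem_T)
    then have "i \<in> ?U"
      using strictly_above_iff[OF i j] s by blast
    moreover then have "s = pr i"
      using unique_predecessor[OF i _ T_infinite[OF tT] s(2)] pr by blast
    ultimately show "\<exists>i\<in>?U. s = pr i"
      by blast
  next
    assume "\<exists>i\<in>?U. s = pr i"
    then obtain i where i: "i \<in> ?U" "s = pr i"
      by blast
    then have "s \<in> T" "t \<subseteq>\<^sup>* s" "s \<noteq> t"
      using pr[OF i(1)] UF[OF i(1)] strictly_above_iff[OF UF[OF i(1)] pr(1)[OF i(1)] j] by (auto simp: mem_T)
    then show "s \<in> underS (ae_order T) t"
      using tT by (simp add: underS_def ae_order_def)
  qed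
  have refl: "refl_on (Field cardinal_h) cardinal_h" and total: "total_on (Field cardinal_h) cardinal_h"
    using Linear_order_cardinal_h unfolding order_on_defs by blast+
  have le_iff: "pr i' \<subseteq>\<^sup>* pr i \<longleftrightarrow> (i, i') \<in> cardinal_h" if i: "i \<in> ?U" "i' \<in> ?U" for i i'
  proof (cases "i = i'")
    case True
    then show ?thesis
      using refl UF[OF i(1)] by (simp add: refl_on_def)
  next
    case False
    then have neq: "pr i \<noteq> pr i'"
      using level_unique[OF UF[OF i(1)] _ UF[OF i(2)]] pr(1)[OF i(1)] pr(1)[OF i(2)] by metis
    have "pr i' \<subseteq>\<^sup>* pr i \<longleftrightarrow> i \<in> underS cardinal_h i'"
    proof
      assume "pr i' \<subseteq>\<^sup>* pr i"
      then show "i \<in> underS cardinal_h i'"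
        using strictly_above_iff[OF UF[OF i(1)] pr(1)[OF i(1)] UF[OF i(2)] pr(1)[OF i(2)]] neq by blast
    next
      assume "i \<in> underS cardinal_h i'"
      then obtain s where s: "s \<in> L i" "pr i' \<subseteq>\<^sup>* s"
        using ex_predecessor[OF UF[OF i(2)] _ pr(1)[OF i(2)]] by blast
      have "t \<subseteq>\<^sup>* s"
        using pr(2)[OF i(2)] s(2) by (rule almost_subset_trans)
      then have "s = pr i"
        using unique_predecessor[OF UF[OF i(1)] s(1) pr(1)[OF i(1)] T_infinite[OF tT]] pr(2)[OF i(1)] by blast
      with s show "pr i' \<subseteq>\<^sup>* pr i"
        by simp
    qed
    with False show ?thesis
      by (simp add: underS_def)
  qed
  have "Field (initial_segment cardinal_h j) \<subseteq> ?U"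
    by (auto simp: initial_segment_def Field_def)
  moreover have "inj_on pr ?U"
    using level_unique pr(1) UF by (metis inj_onI)
  ultimately have inj: "inj_on pr (Field (initial_segment cardinal_h j))"
    by (rule inj_on_subset[rotated])
  have "Restr (ae_order T) (underS (ae_order T) t) = dir_image (initial_segment cardinal_h j) pr"
  proof (intro set_eqI iffI)
    fix p assume "p \<in> Restr (ae_order T) (underS (ae_order T) t)"
    then obtain x y where p: "p = (x, y)" "y \<subseteq>\<^sup>* x" "x \<in> underS (ae_order T) t" "y \<in> underS (ae_order T) t"
      by (auto simp: ae_order_def)
    obtain i where i: "i \<in> ?U" "x = pr i"
      using p(3) unfolding under by (elim bexE)
    moreover obtain i' where "i' \<in> ?U" "y = pr i'"
      using p(4) unfolding under by (elim bexE)
    ultimately show "p \<in> dir_image (initial_segment cardinal_h j) pr"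
      using p le_iff[of i i'] by (auto simp: dir_image_def initial_segment_def)
  next
    fix p assume "p \<in> dir_image (initial_segment cardinal_h j) pr"
    then obtain i i' where i: "p = (pr i, pr i')" "(i, i') \<in> cardinal_h" "i \<in> ?U" "i' \<in> ?U"
      by (auto simp: dir_image_def initial_segment_def)
    then have "pr i \<in> underS (ae_order T) t" "pr i' \<in> underS (ae_order T) t" "pr i' \<subseteq>\<^sup>* pr i"
      using under le_iff[of i i'] by auto
    moreover then have "pr i \<in> T" "pr i' \<in> T"
      by (auto simp: underS_def ae_order_def)
    ultimately show "p \<in> Restr (ae_order T) (underS (ae_order T) t)"
      using i(1) by (simp add: ae_order_def)
  qed
  moreover have "Well_order (initial_segment cardinal_h j)"
    using initial_segment_cardinal_h_ordLess[OF j(1)] by (auto simp: ordLess_def)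
  ultimately show ?thesis
    using dir_image_ordIso inj by metis
qed

lemma Field_ae_order_T: "Field (ae_order T) = T"
  by (auto simp: Field_def ae_order_def)

lemma mem_tree_level_T:
  fixes \<alpha> :: "'b rel"
  assumes "j \<in> Field cardinal_h" "t \<in> L j"
  shows "t \<in> tree_level (ae_order T) \<alpha> \<longleftrightarrow> initial_segment cardinal_h j =o \<alpha>"
proof -
  have "t \<in> T"
    using assms by (auto simp: mem_T)
  then have "t \<in> tree_level (ae_order T) \<alpha> \<longleftrightarrow> Restr (ae_order T) (underS (ae_order T) t) =o \<alpha>"
    unfolding tree_level_def Field_ae_order_T by simp
  also have "\<dots> \<longleftrightarrow> initial_segment cardinal_h j =o \<alpha>"
    by (rule iffI; rule ordIso_transitive[rotated], assumption)
      (rule predecessors_ordIso[OF assms] ordIso_symmetric[OF predecessors_ordIso[OF assms]])+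
  finally show ?thesis .
qed

lemma tree_level_T:
  fixes \<alpha> :: "'b rel"
  assumes "j \<in> Field cardinal_h" "initial_segment cardinal_h j =o \<alpha>"
  shows "tree_level (ae_order T) \<alpha> = L j"
proof (rule set_eqI)
  fix t
  show "t \<in> tree_level (ae_order T) \<alpha> \<longleftrightarrow> t \<in> L j"
  proof
    assume t: "t \<in> tree_level (ae_order T) \<alpha>"
    then obtain i where i: "i \<in> Field cardinal_h" "t \<in> L i"
      by (auto simp: tree_level_def Field_ae_order_T mem_T)
    then have "i = j"
      using mem_tree_level_T[OF i] t assms initial_segment_ordIso_imp_eq by blast
    with i show "t \<in> L j" by simp
  qed (use mem_tree_level_T assms in blast)
qed

lemma tree_order_T: "tree_order T (ae_order T)"
  unfolding tree_order_def
proof (intro conjI ballI partial_order_T)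
  fix t assume t: "t \<in> T"
  then obtain j where "j \<in> Field cardinal_h" "t \<in> L j"
    by (auto simp: mem_T)
  then have "Well_order (Restr (ae_order T) (underS (ae_order T) t))"
    using predecessors_ordIso by (auto simp: ordIso_def)
  moreover have "Field (Restr (ae_order T) (underS (ae_order T) t)) = underS (ae_order T) t"
    by (auto simp: Field_def underS_def ae_order_def)
  ultimately show "well_order_on (underS (ae_order T) t) (Restr (ae_order T) (underS (ae_order T) t))"
    by simp
qed

lemma tree_height_T: "tree_height (ae_order T) cardinal_h"
  unfolding tree_height_def
proof (intro conjI allI impI Well_order_cardinal_h)
  show "tree_level (ae_order T) cardinal_h = {}"
  proof (rule equals0I)
    fix t assume t: "t \<in> tree_level (ae_order T) cardinal_h"
    then obtain i where i: "i \<in> Field cardinal_h" "t \<in> L i"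
      by (auto simp: tree_level_def Field_ae_order_T mem_T)
    then have "initial_segment cardinal_h i =o cardinal_h"
      using mem_tree_level_T[OF i] t by blast
    then show False
      using initial_segment_cardinal_h_ordLess[OF i(1)] not_ordLess_ordIso by blast
  qed
next
  fix \<beta> :: "nat set set rel" assume \<beta>: "\<beta> <o cardinal_h"
  then have "Well_order \<beta>"
    by (auto simp: ordLess_def)
  with \<beta> obtain j where j: "j \<in> Field cardinal_h" "\<beta> =o initial_segment cardinal_h j"
    using ordLess_cardinal_h_iff by blast
  then have "tree_level (ae_order T) \<beta> = L j"
    using tree_level_T ordIso_symmetric by blast
  then show "tree_level (ae_order T) \<beta> \<noteq> {}"
    using maximal_antichainD(3)[OF antichain[OF j(1)] infinite_UNIV_nat] by blast
qed

lemma base_tree_T: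
  assumes inf: "infinite (Field cardinal_h)"
    and root: "\<And>i. i \<in> Field cardinal_h \<Longrightarrow> underS cardinal_h i = {} \<Longrightarrow> L i = {UNIV}"
    and mad: "\<And>i. i \<in> Field cardinal_h \<Longrightarrow> underS cardinal_h i \<noteq> {} \<Longrightarrow> mad_family (L i)"
    and dense: "ae_dense T"
  shows "base_tree T"
proof -
  have "tree_level (ae_order T) ({} :: nat set set rel) = {UNIV}"
  proof -
    obtain k where k: "k \<in> Field cardinal_h"
      using inf by (metis ex_in_conv finite.emptyI)
    have "wf (cardinal_h - Id)"
      using Well_order_cardinal_h unfolding well_order_on_def by blast
    \<comment> \<open>The least index has order type 0 and carries the root.\<close>
    then obtain j where j: "j \<in> Field cardinal_h" "\<And>i. (i, j) \<in> cardinal_h - Id \<Longrightarrow> i \<notin> Field cardinal_h"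
      using k by (rule wfE_min) blast
    then have "underS cardinal_h j = {}"
      by (auto simp: underS_def Field_def)
    moreover then have "initial_segment cardinal_h j =o ({} :: nat set set rel)"
      using initial_segment_cardinal_h_ordLess[OF j(1)] ordIso_reflexive[of "initial_segment cardinal_h j"]
      by (simp add: initial_segment_def ordLess_def)
    ultimately show ?thesis
      using tree_level_T[OF j(1)] root[OF j(1)] by simp
  qed
  moreover have "mad_family (tree_level (ae_order T) \<alpha>)"
    if \<alpha>: "\<alpha> <o cardinal_h" "\<alpha> \<noteq> {}" for \<alpha> :: "nat set set rel"
  proof -
    have "Well_order \<alpha>"
      using \<alpha>(1) by (auto simp: ordLess_def)
    then obtain j where j: "j \<in> Field cardinal_h" "\<alpha> =o initial_segment cardinal_h j"
      using \<alpha>(1) ordLess_cardinal_h_iff by blast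
    have "underS cardinal_h j \<noteq> {}"
    proof
      assume "underS cardinal_h j = {}"
      then have "\<alpha> =o ({} :: nat set set rel)"
        using j(2) by (simp add: initial_segment_def)
      then show False
        using ordIso_empty_imp_empty \<alpha>(2) by blast
    qed
    moreover have "tree_level (ae_order T) \<alpha> = L j"
      using tree_level_T[OF j(1) ordIso_symmetric[OF j(2)]] .
    ultimately show ?thesis
      using mad[OF j(1)] by simp
  qed
  ultimately show ?thesis
    using tree_order_T tree_height_T dense T_infinite unfolding base_tree_def infsets_def by blast
qed

text \<open>The level is injective on a chain, so a chain confined to levels up to \<open>i\<close>
  has fewer than \<hh> members. The index \<open>k\<close> above \<open>i\<close> places these
  levels in a proper initial segment.\<close>

lemma branch_cofinal:
  assumes b: "branch T b" "|b| =o cardinal_h" and i: "i \<in> Field cardinal_h"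
  shows "\<exists>j\<in>Field cardinal_h. i \<in> underS cardinal_h j \<and> b \<inter> L j \<noteq> {}"
proof (rule ccontr)
  assume *: "\<not> ?thesis"
  obtain k where k: "k \<in> Field cardinal_h" "i \<in> underS cardinal_h k"
    using countable_bounded_cardinal_h[of "{i}"] i by auto
  have "b \<subseteq> T" and comp: "\<And>s t. s \<in> b \<Longrightarrow> t \<in> b \<Longrightarrow> s \<noteq> t \<Longrightarrow> t \<subseteq>\<^sup>* s \<or> s \<subseteq>\<^sup>* t"
    using b(1) unfolding branch_def pred_on.maxchain_def pred_on.chain_def by auto
  then obtain lev where lev: "\<And>t. t \<in> b \<Longrightarrow> lev t \<in> Field cardinal_h" "\<And>t. t \<in> b \<Longrightarrow> t \<in> L (lev t)"
    unfolding subset_iff mem_T by metis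
  have "inj_on lev b"
  proof (rule inj_onI)
    fix s t assume st: "s \<in> b" "t \<in> b" "lev s = lev t"
    then have "s \<in> L (lev s)" "t \<in> L (lev s)"
      using lev(2) by metis+
    then show "s = t"
      using comp[OF st(1,2)] same_level[OF lev(1)[OF st(1)]] by blast
  qed
  moreover have "lev t \<in> underS cardinal_h k" if t: "t \<in> b" for t
  proof -
    have "i \<notin> underS cardinal_h (lev t)"
      using * lev t by blast
    then have "lev t \<in> underS cardinal_h i \<or> lev t = i"
      using cardinal_h_total[OF i lev(1)[OF t]] by blast
    moreover have "trans cardinal_h" "antisym cardinal_h"
      using Linear_order_cardinal_h unfolding order_on_defs by blast+
    ultimately show ?thesis
      using k(2) by (auto simp: underS_def dest: transD antisymD)
  qed
  ultimately have "|b| \<le>o |underS cardinal_h k|"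
    by (rule card_of_ordLeqI)
  also have "|underS cardinal_h k| <o cardinal_h"
    using k(1) by (rule card_of_underS[OF Card_order_cardinal_h])
  finally show False
    using b(2) not_ordLess_ordIso by blast
qed

end

subsection \<open>From long branches to the forcing axiom\<close>

text \<open>As \<hh> = \<cc>, the field of \<hh> can index both the given dense sets and all
  infinite sets. The former are built into the levels, the latter make the tree dense. A branch of
  size \<hh> has nodes beyond every level, so it enters every dense set.\<close>

lemma long_branches_imp_forcing_axiom:
  assumes h: "cardinal_h =o continuum"
    and branches: "\<And>T. base_tree T \<Longrightarrow> \<exists>b. branch T b \<and> |b| =o continuum"
  shows "forcing_axiom continuum"
  unfolding forcing_axiom_def
proof (intro allI impI, elim conjE)
  fix \<D> :: "nat set set set"
  assume card: "|\<D>| =o continuum" and dense: "\<forall>D\<in>\<D>. ae_dense D"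
  have K: "continuum =o |Field cardinal_h|"
    using h card_of_Field_ordIso[OF Card_order_cardinal_h] ordIso_symmetric ordIso_transitive by blast
  have inf: "infinite (Field cardinal_h)"
    using K card_of_ordIso_finite[of UNIV "Field cardinal_h"] infinite_UNIV_nat_set
    unfolding continuum_def by blast
  have "|\<D>| =o |Field cardinal_h|"
    using card K by (rule ordIso_transitive)
  then obtain g where "bij_betw g (Field cardinal_h) \<D>"
    using card_of_ordIso ordIso_symmetric by blast
  then have g: "g ` Field cardinal_h = \<D>"
    by (simp add: bij_betw_def)
  have "|infsets| \<le>o |Field cardinal_h|"
    using card_of_nat_sets_ordLeq_continuum K by (rule ordLeq_ordIso_trans)
  moreover have "infsets \<noteq> {}"
    using infinite_UNIV_nat by (auto simp: infsets_def)
  ultimately obtain X where X: "X ` Field cardinal_h = infsets"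
    using card_of_ordLeq2[of infsets "Field cardinal_h"] by metis
  \<comment> \<open>The downward closure of \<open>g i\<close>, as required for refinement; the
    upward closure of the branch later recovers a member of \<open>g i\<close> itself.\<close>
  define D where "D i = {Z. infinite Z \<and> (\<exists>Y\<in>g i. Z \<subseteq>\<^sup>* Y)}" for i
  have D_dense: "ae_dense (D i)" if i: "i \<in> Field cardinal_h" for i
  proof (rule ae_dense_mono)
    show "ae_dense (g i)"
      using i g dense by blast
    then show "g i \<subseteq> D i"
      unfolding D_def ae_dense_def infsets_def using almost_subset_refl by blast
  qed (auto simp: D_def infsets_def)
  have D_down: "ae_down_closed (D i)" for i
    unfolding ae_down_closed_def D_def infsets_def by (auto intro: almost_subset_trans)
  have X_inf: "infinite (X i)" if "i \<in> Field cardinal_h" for i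
    using that X by (auto simp: infsets_def)
  obtain L where L: "\<And>i. i \<in> Field cardinal_h \<Longrightarrow> maximal_antichain (L i)"
      "\<And>i. i \<in> Field cardinal_h \<Longrightarrow> underS cardinal_h i = {} \<Longrightarrow> L i = {UNIV}"
      "\<And>i. i \<in> Field cardinal_h \<Longrightarrow> underS cardinal_h i \<noteq> {} \<Longrightarrow> mad_family (L i)"
      "\<And>i. i \<in> Field cardinal_h \<Longrightarrow> underS cardinal_h i \<noteq> {} \<Longrightarrow> \<exists>t\<in>L i. t \<subseteq>\<^sup>* X i"
      "\<And>i j. i \<in> Field cardinal_h \<Longrightarrow> j \<in> underS cardinal_h i \<Longrightarrow> L i \<subseteq> D j"
      "\<And>i j. i \<in> Field cardinal_h \<Longrightarrow> j \<in> underS cardinal_h i \<Longrightarrow> L i \<subseteq> strictly_below (L j)"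
    by (rule ex_refining_system[of D X];
      (erule D_dense | rule D_down | erule X_inf | (rule that; assumption)))
  define T where "T = (\<Union>i\<in>Field cardinal_h. L i)"
  interpret refining_system L T
    using L(1,6) by unfold_locales (simp_all add: T_def)
  have "ae_dense T"
    unfolding ae_dense_def
  proof (intro conjI ballI)
    show "T \<subseteq> infsets"
      using T_infinite by (auto simp: infsets_def)
    fix Y :: "nat set" assume "Y \<in> infsets"
    then have Y: "infinite Y"
      by (simp add: infsets_def)
    then obtain y where y: "y \<in> Y"
      by (metis ex_in_conv finite.emptyI)
    have "Y \<in> X ` Field cardinal_h" "Y - {y} \<in> X ` Field cardinal_h"
      using X Y by (simp_all add: infsets_def)
    then obtain i i' where i: "i \<in> Field cardinal_h" "X i = Y" "i' \<in> Field cardinal_h" "X i' = Y - {y}"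
      by (metis imageE)
    \<comment> \<open>\<open>X\<close> is not used at the root, but one of \<open>Y\<close> and \<open>Y - {y}\<close> has an index other than the root.\<close>
    then have "i \<noteq> i'"
      using y by auto
    then have "underS cardinal_h i \<noteq> {} \<or> underS cardinal_h i' \<noteq> {}"
      using cardinal_h_total[OF i(1,3)] by blast
    moreover have "X i \<subseteq>\<^sup>* Y" "X i' \<subseteq>\<^sup>* Y"
      using i by (auto intro: subset_almost_subset)
    ultimately obtain k where k: "k \<in> Field cardinal_h" "underS cardinal_h k \<noteq> {}" "X k \<subseteq>\<^sup>* Y"
      using i by blast
    then obtain t where "t \<in> L k" "t \<subseteq>\<^sup>* X k"
      using L(4) by blast
    then show "\<exists>t\<in>T. t \<subseteq>\<^sup>* Y"
      using k almost_subset_trans mem_T by blast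
  qed
  then have "base_tree T"
    using base_tree_T inf L(2,3) by blast
  then obtain b where b: "branch T b" "|b| =o continuum"
    using branches by blast
  have bh: "|b| =o cardinal_h"
    using b(2) h ordIso_symmetric ordIso_transitive by blast
  have bT: "b \<subseteq> T" and comp: "\<And>s t. s \<in> b \<Longrightarrow> t \<in> b \<Longrightarrow> s = t \<or> t \<subseteq>\<^sup>* s \<or> s \<subseteq>\<^sup>* t"
    using b(1) unfolding branch_def pred_on.maxchain_def pred_on.chain_def by auto
  define G where "G = {Y \<in> infsets. \<exists>t\<in>b. t \<subseteq>\<^sup>* Y}"
  have meets: "G \<inter> g i \<noteq> {}" if i: "i \<in> Field cardinal_h" for i
  proof -
    obtain j t where j: "j \<in> Field cardinal_h" "i \<in> underS cardinal_h j" "t \<in> b" "t \<in> L j"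
      using branch_cofinal[OF b(1) bh i] by blast
    then have "t \<in> D i"
      using L(5) by blast
    then obtain Y where Y: "Y \<in> g i" "t \<subseteq>\<^sup>* Y"
      by (auto simp: D_def)
    moreover have "Y \<in> infsets"
      using Y(1) i g dense unfolding ae_dense_def by blast
    ultimately show ?thesis
      using j(3) by (auto simp: G_def)
  qed
  have "ae_filter G"
    unfolding G_def
  proof (rule ae_filter_above)
    show "b \<subseteq> infsets"
      using bT T_infinite by (auto simp: infsets_def)
    obtain i where "i \<in> Field cardinal_h"
      using inf by (metis ex_in_conv finite.emptyI)
    then show "b \<noteq> {}"
      using meets by (auto simp: G_def)
    show "\<exists>u\<in>b. u \<subseteq>\<^sup>* s \<and> u \<subseteq>\<^sup>* t" if "s \<in> b" "t \<in> b" for s t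
      using comp[OF that] that almost_subset_refl by blast
  qed
  with meets g show "\<exists>G. ae_filter G \<and> (\<forall>D\<in>\<D>. G \<inter> D \<noteq> {})"
    by blast
qed

theorem corollary16:
  shows "let
      s1 = (continuum <o novak_number omega_star);
      s2 = forcing_axiom continuum;
      s3 = (\<forall>\<A>. mad_family \<A> \<longrightarrow> ka_pseudocompact continuum free_ultrafilters (Psi \<A>));
      s4 = (\<forall>\<A>. mad_family \<A> \<longrightarrow> (\<exists>p\<in>free_ultrafilters. p_pseudocompact p (Psi \<A>)));
      s5 = (\<forall>\<A>. mad_family \<A> \<longrightarrow> (\<exists>p\<in>free_ultrafilters. p_pseudocompact p (vietoris (Psi \<A>))));
      s6 = (\<forall>\<A>. mad_family \<A> \<longrightarrow> pseudocompact_space (vietoris (Psi \<A>)));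
      s7 = (cardinal_h =o continuum \<and>
            (\<forall>T. base_tree T \<longrightarrow> (\<exists>b. branch T b \<and> |b| =o continuum)))
    in (s1 \<longleftrightarrow> s2) \<and> (s2 \<longleftrightarrow> s3) \<and> (s3 \<longleftrightarrow> s4) \<and> (s4 \<longleftrightarrow> s5) \<and> (s5 \<longleftrightarrow> s6) \<and> (s6 \<longleftrightarrow> s7)"
proof -
  let ?s2 = "forcing_axiom continuum"
  let ?s3 = "\<forall>\<A>. mad_family \<A> \<longrightarrow> ka_pseudocompact continuum free_ultrafilters (Psi \<A>)"
  let ?s4 = "\<forall>\<A>. mad_family \<A> \<longrightarrow> (\<exists>p\<in>free_ultrafilters. p_pseudocompact p (Psi \<A>))"
  let ?s5 = "\<forall>\<A>. mad_family \<A> \<longrightarrow> (\<exists>p\<in>free_ultrafilters. p_pseudocompact p (vietoris (Psi \<A>)))"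
  let ?s6 = "\<forall>\<A>. mad_family \<A> \<longrightarrow> pseudocompact_space (vietoris (Psi \<A>))"
  \<comment> \<open>Statements (2) to (6) are closed into one cycle, and (1) and (7) are each tied
    to (2).\<close>
  have "?s2 \<Longrightarrow> ?s3"
    using forcing_axiom_imp_ka_pseudocompact by blast
  moreover have "?s3 \<Longrightarrow> ?s4"
    using ka_pseudocompact_imp_p_pseudocompact by blast
  moreover have "?s4 \<Longrightarrow> ?s5"
    using p_pseudocompact_vietoris_Psi by blast
  moreover have "?s5 \<Longrightarrow> ?s6"
    using p_pseudocompact_imp_pseudocompact_space by blast
  moreover have "?s6 \<Longrightarrow> ?s2"
    using pseudocompact_imp_forcing_axiom by blast
  moreover have "?s2 \<longleftrightarrow> cardinal_h =o continuum \<and>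
      (\<forall>T. base_tree T \<longrightarrow> (\<exists>b. branch T b \<and> |b| =o continuum))"
    using forcing_axiom_imp_cardinal_h forcing_axiom_imp_branch long_branches_imp_forcing_axiom
    by blast
  ultimately show ?thesis
    unfolding Let_def novak_iff_forcing_axiom by argo
qed

end
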